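(* Let $M$ and $N$ be atomic JBW-algebras with units $e_M$ and $e_N$ such that $[0,e_M]$ is order isomorphic to $[0,e_N]$. Then every order isomorphism $f\colon[0,e_M]\to[0,e_N]$ satisfies $f((0,e_M])=(0,e_N]$ if and only if the centre $Z(M)$ is finite dimensional.
   Context: A JB-algebra is a real Banach space $A$ with a commutative bilinear product $\circ$ satisfying $x\circ(y\circ x^2)=(x\circ y)\circ x^2$, $\|x\circ y\|\le\|x\|\|y\|$, $\|x^2\|=\|x\|^2$ and $\|x^2\|\le\|x^2+y^2\|$ for all $x,y\in A$. A JBW-algebra is a JB-algebra that is a dual Banach space; it has a unit $e$. $x\le y$ means that $y-x$ lies in the cone of squares, and $[x,y]=\{w: x\le w\le y\}$. An element $x$ is invertible if it is invertible in the JB-subalgebra generated by $x$ and $e$ (which is isomorphic to $C(\sigma(x))$). $(0,e]$ denotes the set of invertible elements of $[0,e]$. An order isomorphism is a bijection $f$ with $x\le y\iff f(x)\le f(y)$. A projection is an element $p$ with $p^2=p$; an atom is a minimal non-zero projection; a JBW-algebra is atomic if every non-zero projection dominates an atom. Elements $x,y\in M$ operator commute if $x\circ(y\circ w)=y\circ(x\circ w)$ for all $w\in M$; the centre $Z(M)$ is the set of elements operator commuting with all elements of $M$. *)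

theory Defs
  imports "HOL-Analysis.Analysis"
begin

text \<open>
  The product is an explicit parameter, and the algebra is the whole of a type of class
  \<open>banach\<close>, which supplies the real vector space structure and the complete norm.
\<close>

locale jb_algebra =
  fixes jprod :: "'a::banach \<Rightarrow> 'a \<Rightarrow> 'a"
  assumes bilinear_jprod: "bilinear jprod"
    and jprod_commute: "jprod x y = jprod y x"
    and jordan_identity: "jprod x (jprod y (jprod x x)) = jprod (jprod x y) (jprod x x)"
    and norm_jprod_le: "norm (jprod x y) \<le> norm x * norm y"
    and norm_square: "norm (jprod x x) = (norm x)\<^sup>2"
    and norm_square_le: "norm (jprod x x) \<le> norm (jprod x x + jprod y y)"

text \<open>
  The dual of \<open>'p\<close> is the type of bounded linear functionals
  \<open>'p \<Rightarrow>\<^sub>L real\<close> with the operator norm.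
\<close>

definition isometric_to_dual :: "'a::real_normed_vector itself \<Rightarrow> 'p::banach itself \<Rightarrow> bool" where
  "isometric_to_dual A P \<longleftrightarrow>
     (\<exists>T :: 'a \<Rightarrow> ('p \<Rightarrow>\<^sub>L real). linear T \<and> surj T \<and> (\<forall>x. norm (T x) = norm x))"

text \<open>
  One cannot quantify existentially over types, so the type of the predual is a parameter. In a
  theorem that assumes \<open>jbw_algebra\<close> for an arbitrary type \<open>'p\<close> not occurring in the
  conclusion, this amounts to assuming that some predual exists. The unit is unique, and the
  locale only names it.
\<close>

locale jbw_algebra = jb_algebra jprod
  for jprod :: "'a::banach \<Rightarrow> 'a \<Rightarrow> 'a" +
  fixes e :: 'a
    and predual :: "'p::banach itself"
  assumes dual_space: "isometric_to_dual TYPE('a) predual"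
    and unit: "jprod e x = x"

definition jb_le :: "('a::banach \<Rightarrow> 'a \<Rightarrow> 'a) \<Rightarrow> 'a \<Rightarrow> 'a \<Rightarrow> bool" where
  "jb_le jprod x y \<longleftrightarrow> y - x \<in> range (\<lambda>z. jprod z z)"

definition jb_interval :: "('a::banach \<Rightarrow> 'a \<Rightarrow> 'a) \<Rightarrow> 'a \<Rightarrow> 'a \<Rightarrow> 'a set" where
  "jb_interval jprod x y = {w. jb_le jprod x w \<and> jb_le jprod w y}"

definition jb_subalgebra :: "('a::banach \<Rightarrow> 'a \<Rightarrow> 'a) \<Rightarrow> 'a set \<Rightarrow> bool" where
  "jb_subalgebra jprod B \<longleftrightarrow>
     subspace B \<and> closed B \<and> (\<forall>x\<in>B. \<forall>y\<in>B. jprod x y \<in> B)"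

text \<open>\<open>jb_subalgebra jprod hull {x, e}\<close> is the intersection of all JB-subalgebras containing
  \<open>x\<close> and \<open>e\<close>. It is associative, so invertibility in it has the usual meaning.\<close>

definition jb_invertible :: "('a::banach \<Rightarrow> 'a \<Rightarrow> 'a) \<Rightarrow> 'a \<Rightarrow> 'a \<Rightarrow> bool" where
  "jb_invertible jprod e x \<longleftrightarrow> (\<exists>y \<in> jb_subalgebra jprod hull {x, e}. jprod x y = e)"

definition effects :: "('a::banach \<Rightarrow> 'a \<Rightarrow> 'a) \<Rightarrow> 'a \<Rightarrow> 'a set" where
  "effects jprod e = jb_interval jprod 0 e"

definition invertible_effects :: "('a::banach \<Rightarrow> 'a \<Rightarrow> 'a) \<Rightarrow> 'a \<Rightarrow> 'a set" where
  "invertible_effects jprod e = {x \<in> effects jprod e. jb_invertible jprod e x}"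

definition order_iso_betw ::
  "('a \<Rightarrow> 'a \<Rightarrow> bool) \<Rightarrow> 'a set \<Rightarrow> ('b \<Rightarrow> 'b \<Rightarrow> bool) \<Rightarrow> 'b set \<Rightarrow> ('a \<Rightarrow> 'b) \<Rightarrow> bool"
where
  "order_iso_betw le_A A le_B B f \<longleftrightarrow>
     bij_betw f A B \<and> (\<forall>x\<in>A. \<forall>y\<in>A. le_A x y \<longleftrightarrow> le_B (f x) (f y))"

definition jb_projection :: "('a::banach \<Rightarrow> 'a \<Rightarrow> 'a) \<Rightarrow> 'a \<Rightarrow> bool" where
  "jb_projection jprod p \<longleftrightarrow> jprod p p = p"

definition jb_atom :: "('a::banach \<Rightarrow> 'a \<Rightarrow> 'a) \<Rightarrow> 'a \<Rightarrow> bool" where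
  "jb_atom jprod p \<longleftrightarrow> jb_projection jprod p \<and> p \<noteq> 0 \<and>
     (\<forall>q. jb_projection jprod q \<and> q \<noteq> 0 \<and> jb_le jprod q p \<longrightarrow> q = p)"

definition jb_atomic :: "('a::banach \<Rightarrow> 'a \<Rightarrow> 'a) \<Rightarrow> bool" where
  "jb_atomic jprod \<longleftrightarrow>
     (\<forall>p. jb_projection jprod p \<and> p \<noteq> 0 \<longrightarrow> (\<exists>a. jb_atom jprod a \<and> jb_le jprod a p))"

definition operator_commute :: "('a::banach \<Rightarrow> 'a \<Rightarrow> 'a) \<Rightarrow> 'a \<Rightarrow> 'a \<Rightarrow> bool" where
  "operator_commute jprod x y \<longleftrightarrow> (\<forall>w. jprod x (jprod y w) = jprod y (jprod x w))"

definition jb_centre :: "('a::banach \<Rightarrow> 'a \<Rightarrow> 'a) \<Rightarrow> 'a set" where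
  "jb_centre jprod = {z. \<forall>x. operator_commute jprod z x}"

definition finite_dimensional :: "'a::real_vector set \<Rightarrow> bool" where
  "finite_dimensional V \<longleftrightarrow> (\<exists>B. finite B \<and> span B = V)"

end

theory Submission
  imports Defs "HOL-Computational_Algebra.Fundamental_Theorem_Algebra"
begin

text \<open>
  Call \<open>w \<in> [0, e]\<close> a chain element if \<open>w \<noteq> 0\<close> and \<open>[0, w]\<close> is totally ordered, and say that
  \<open>x \<in> [0, e]\<close> meets chains if below every chain element there is some \<open>v \<noteq> 0\<close> with \<open>v \<le> x\<close>. An
  order isomorphism preserves these notions, and an invertible effect \<open>x \<ge> c e\<close> meets chains because
  \<open>c w \<le> x\<close>. Atoms are chain elements, so an \<open>x\<close> that meets chains dominates a positive multiple
  of every atom. Baire's theorem on the closed set of atoms makes the multiple uniform near some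
  atom \<open>p\<close>, and rotating \<open>p\<close> slightly spreads the bound to all atoms that are linked to \<open>p\<close>, hence to a
  central summand. If the centre is finite dimensional, finitely many summands exhaust the algebra,
  and \<open>x\<close> is invertible: invertibility is then an order-theoretic property.

  Finite dimensionality of the centre is an order invariant as well: it holds if and only if the
  effects that meet chains have a countable coinitial subset (the multiples \<open>e/n\<close>). Indeed, an
  infinite-dimensional centre contains orthogonal projections \<open>z n\<close> such that \<open>[0, e]\<close> is the product
  of the intervals \<open>[0, z n]\<close>, and a diagonal argument applies. In that case, applying to \<open>[0, z n]\<close> the
  order automorphism \<open>x \<mapsto> (1 - k) (e - k x)\<^sup>-\<^sup>1 x\<close> with \<open>k = k n\<close> tending to \<open>1\<close> gives an order
  automorphism of \<open>[0, e]\<close> under which the image of \<open>e/2\<close> is not invertible.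
\<close>

text \<open>Preservation of invertibility compares both algebras, whereas the dimension hypothesis
  concerns \<open>M\<close> alone. The criterion for invertibility must also hold in
  \<open>N\<close>, and for this reason the dimension of the centre itself has to be visible in the
  order. For the converse, if \<open>g\<close> and \<open>g \<circ> h\<close> both match the
  invertible effects, with \<open>h\<close> an order automorphism of the unit interval of
  \<open>M\<close>, then so does \<open>h\<close>, which fails for the \<open>h\<close> built from
  the Moebius maps.

  On the algebraic side the obstacle is that a product of positive elements need not be positive.
  Positivity is argued inside the associative subalgebra generated by one element, or by means of
  the operator \<open>quad c\<close>, which is \<open>y \<mapsto> c y c\<close> in an associative
  algebra; its positivity for \<open>c \<ge> 0\<close> comes from a differential equation. On the
  order side the obstacle is that the bound \<open>t p \<le> x\<close> depends on the atom
  \<open>p\<close>. Uniformity is obtained on one central summand at a time, and a minimum over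
  finitely many summands is still positive: this is where finite dimension enters.\<close>

lemma subspace_closure:
  fixes S :: "'a::real_normed_vector set"
  assumes "subspace S"
  shows "subspace (closure S)"
proof (rule subspaceI)
  show "0 \<in> closure S"
    using assms subspace_0 closure_subset by blast
  show "x + y \<in> closure S" if xy: "x \<in> closure S" "y \<in> closure S" for x y
  proof -
    obtain f g where "\<forall>n. f n \<in> S" "f \<longlonglongrightarrow> x" "\<forall>n. g n \<in> S" "g \<longlonglongrightarrow> y"
      using xy unfolding closure_sequential by blast
    then show ?thesis
      unfolding closure_sequential
      by (intro exI[of _ "\<lambda>n. f n + g n"]) (auto intro!: tendsto_intros subspace_add assms)
  qed
  show "c *\<^sub>R x \<in> closure S" if x: "x \<in> closure S" for c x
  proof -
    obtain f where "\<forall>n. f n \<in> S" "f \<longlonglongrightarrow> x"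
      using x unfolding closure_sequential by blast
    then show ?thesis
      unfolding closure_sequential
      by (intro exI[of _ "\<lambda>n. c *\<^sub>R f n"]) (auto intro!: tendsto_intros subspace_scale assms)
  qed
qed

section \<open>Unital JB-algebras: bilinear calculus and linearized Jordan identities\<close>

locale jb_unital = jb_algebra jprod
  for jprod :: "'a::banach \<Rightarrow> 'a \<Rightarrow> 'a" (infixl "\<odot>" 70) +
  fixes e :: 'a
  assumes unit_left: "e \<odot> x = x"
begin

lemma unit_right [simp]: "x \<odot> e = x"
  using unit_left jprod_commute by metis

declare unit_left [simp]

lemma
  shows jadd_left: "(x + y) \<odot> z = x \<odot> z + y \<odot> z"
    and jadd_right: "z \<odot> (x + y) = z \<odot> x + z \<odot> y"
    and jdiff_left: "(x - y) \<odot> z = x \<odot> z - y \<odot> z"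
    and jdiff_right: "z \<odot> (x - y) = z \<odot> x - z \<odot> y"
    and jneg_left: "(- x) \<odot> z = - (x \<odot> z)"
    and jneg_right: "z \<odot> (- x) = - (z \<odot> x)"
    and jscale_left: "(c *\<^sub>R x) \<odot> z = c *\<^sub>R (x \<odot> z)"
    and jscale_right: "z \<odot> (c *\<^sub>R x) = c *\<^sub>R (z \<odot> x)"
    and jzero_left [simp]: "0 \<odot> z = 0"
    and jzero_right [simp]: "z \<odot> 0 = 0"
  by (simp_all add: bilinear_ladd[OF bilinear_jprod] bilinear_radd[OF bilinear_jprod]
      bilinear_lsub[OF bilinear_jprod] bilinear_rsub[OF bilinear_jprod]
      bilinear_lneg[OF bilinear_jprod] bilinear_rneg[OF bilinear_jprod]
      bilinear_lmul[OF bilinear_jprod] bilinear_rmul[OF bilinear_jprod]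
      bilinear_lzero[OF bilinear_jprod] bilinear_rzero[OF bilinear_jprod])

lemmas jdistrib = jadd_left jadd_right jdiff_left jdiff_right jneg_left jneg_right
  jscale_left jscale_right

lemma bounded_bilinear_jprod: "bounded_bilinear (\<odot>)"
  by (rule bounded_bilinear.intro)
    (auto simp: jdistrib intro!: exI[of _ 1] norm_jprod_le)

lemmas bounded_linear_jprod = bounded_bilinear.bounded_linear_right[OF bounded_bilinear_jprod]

lemmas tendsto_jprod [tendsto_intros] = bounded_bilinear.tendsto[OF bounded_bilinear_jprod]
lemmas continuous_on_jprod [continuous_intros] =
  bounded_bilinear.continuous_on[OF bounded_bilinear_jprod]

text \<open>Polarization: \<open>D\<close> is cubic in \<open>x\<close> and vanishes identically, so
  its third-order difference, which is twice the trilinear form \<open>?L - ?R\<close>,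
  vanishes.\<close>

lemma jordan_linearized:
  "x \<odot> ((y \<odot> z) \<odot> w) + y \<odot> ((z \<odot> x) \<odot> w) + z \<odot> ((x \<odot> y) \<odot> w)
   = (y \<odot> z) \<odot> (x \<odot> w) + (z \<odot> x) \<odot> (y \<odot> w) + (x \<odot> y) \<odot> (z \<odot> w)"
proof -
  define D where "D x = x \<odot> (w \<odot> (x \<odot> x)) - (x \<odot> w) \<odot> (x \<odot> x)" for x
  have D0: "D x = 0" for x
    unfolding D_def using jordan_identity by simp
  let ?L = "x \<odot> ((y \<odot> z) \<odot> w) + y \<odot> ((z \<odot> x) \<odot> w) + z \<odot> ((x \<odot> y) \<odot> w)"
  let ?R = "(y \<odot> z) \<odot> (x \<odot> w) + (z \<odot> x) \<odot> (y \<odot> w) + (x \<odot> y) \<odot> (z \<odot> w)"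
  have "2 *\<^sub>R (?L - ?R)
      = D (x + y + z) - D (x + y) - D (y + z) - D (x + z) + D x + D y + D z"
    unfolding D_def scaleR_2 by (simp add: jdistrib jprod_commute algebra_simps)
  then show ?thesis by (simp add: D0)
qed

text \<open>The right-hand side of the linearized identity is symmetric in all four variables, so
  \<open>w\<close> may trade places with \<open>x\<close>. In this form multiplication by a triple
  product is expressed by multiplications by its factors and their pairwise products.\<close>

lemma jordan_operator:
  "(x \<odot> (y \<odot> z)) \<odot> w
   = (y \<odot> z) \<odot> (x \<odot> w) + (z \<odot> x) \<odot> (y \<odot> w) + (x \<odot> y) \<odot> (z \<odot> w)
     - y \<odot> (x \<odot> (z \<odot> w)) - z \<odot> (x \<odot> (y \<odot> w))"
  using jordan_linearized[of x y z w] jordan_linearized[of w y z x]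
  by (simp add: jprod_commute algebra_simps)

text \<open>The case of two equal arguments. With an idempotent for \<open>x\<close> it becomes the
  basic commutation rule of Peirce theory.\<close>

lemma jordan_commutator:
  "y \<odot> ((x \<odot> x) \<odot> w) + 2 *\<^sub>R (x \<odot> ((x \<odot> y) \<odot> w))
   = (x \<odot> x) \<odot> (y \<odot> w) + 2 *\<^sub>R ((x \<odot> y) \<odot> (x \<odot> w))"
  using jordan_linearized[of x x y w] unfolding scaleR_2
  by (simp add: jprod_commute[of y x] algebra_simps)

lemma square_commute: "x \<odot> ((x \<odot> x) \<odot> w) = (x \<odot> x) \<odot> (x \<odot> w)"
  using jordan_identity[of x w] by (simp add: jprod_commute)

lemma norm_unit_le: "norm e \<le> 1"
proof -
  have "norm e = (norm e)\<^sup>2" using norm_square[of e] by simp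
  then show ?thesis by (metis power2_eq_square mult_cancel_left1 mult.commute order_refl zero_le_one)
qed

section \<open>Power associativity and the subalgebra generated by one element\<close>

primrec jpow :: "'a \<Rightarrow> nat \<Rightarrow> 'a" where
  "jpow x 0 = e"
| "jpow x (Suc n) = x \<odot> jpow x n"

abbreviation gen :: "'a \<Rightarrow> 'a set" where
  "gen x \<equiv> jb_subalgebra (\<odot>) hull {x, e}"

text \<open>Multiplication by \<open>x \<odot> x\<close> is in general not a polynomial in
  multiplication by \<open>x\<close>, so \<open>T\<close> has to commute with both.\<close>

definition bicommutant :: "'a \<Rightarrow> 'a set" where
  "bicommutant x = {y. \<forall>T. bounded_linear T \<and> (\<forall>w. T (x \<odot> w) = x \<odot> T w)
      \<and> (\<forall>w. T ((x \<odot> x) \<odot> w) = (x \<odot> x) \<odot> T w) \<longrightarrow> (\<forall>w. T (y \<odot> w) = y \<odot> T w)}"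

text \<open>\<open>jordan_operator\<close> writes multiplication by
  \<open>x \<odot> (x \<odot> y)\<close> through those by \<open>x\<close>,
  \<open>x \<odot> x\<close>, \<open>y\<close> and \<open>x \<odot> y\<close>; hence the induction
  carries two consecutive powers.\<close>

lemma bicommutant_jpow:
  "jpow x n \<in> bicommutant x \<and> x \<odot> jpow x n \<in> bicommutant x"
proof (induction n)
  case 0
  then show ?case by (simp add: bicommutant_def)
next
  case (Suc n)
  define y where "y = jpow x n"
  have y: "y \<in> bicommutant x" "x \<odot> y \<in> bicommutant x"
    using Suc y_def by auto
  have "x \<odot> (x \<odot> y) \<in> bicommutant x"
    unfolding bicommutant_def
  proof (clarify)
    fix T w
    assume T: "bounded_linear T" "\<forall>w. T (x \<odot> w) = x \<odot> T w"
      "\<forall>w. T ((x \<odot> x) \<odot> w) = (x \<odot> x) \<odot> T w"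
    interpret T: bounded_linear T by fact
    have "T (y \<odot> w) = y \<odot> T w" "T ((x \<odot> y) \<odot> w) = (x \<odot> y) \<odot> T w" for w
      using y T unfolding bicommutant_def by blast+
    then show "T ((x \<odot> (x \<odot> y)) \<odot> w) = (x \<odot> (x \<odot> y)) \<odot> T w"
      using T(2,3) by (simp add: jordan_operator[of x x y] jprod_commute[of y x] T.add T.diff)
  qed
  then show ?case using y by (simp add: y_def)
qed

lemma subspace_bicommutant: "subspace (bicommutant x)"
  unfolding subspace_def bicommutant_def
  by (auto simp: jdistrib bounded_linear.linear linear_add linear_scale linear_0)

lemma closed_bicommutant: "closed (bicommutant x)"
proof -
  have "bicommutant x = (\<Inter>T\<in>{T. bounded_linear T \<and> (\<forall>w. T (x \<odot> w) = x \<odot> T w)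
      \<and> (\<forall>w. T ((x \<odot> x) \<odot> w) = (x \<odot> x) \<odot> T w)}. \<Inter>w. {y. T (y \<odot> w) = y \<odot> T w})"
    unfolding bicommutant_def by auto
  moreover have "closed {y. T (y \<odot> w) = y \<odot> T w}" if "bounded_linear T" for T w
    by (intro closed_Collect_eq continuous_intros
        bounded_linear.continuous_on[OF that])
  ultimately show ?thesis by (metis (no_types, lifting) closed_INT mem_Collect_eq)
qed

lemma jpow_add: "jpow x m \<odot> jpow x n = jpow x (m + n)"
proof (induction n)
  case (Suc n)
  have "bounded_linear (\<lambda>w. x \<odot> w)" by (rule bounded_linear_jprod)
  then have "x \<odot> (jpow x m \<odot> jpow x n) = jpow x m \<odot> (x \<odot> jpow x n)"
    using bicommutant_jpow[of x m] unfolding bicommutant_def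
    by (auto simp: square_commute)
  then show ?case using Suc by simp
qed simp

lemma jb_subalgebra_closure_span_jpow:
  "jb_subalgebra (\<odot>) (closure (span (range (jpow x))))"
proof -
  let ?S = "span (range (jpow x))"
  have 1: "a \<odot> b \<in> ?S" if "a \<in> ?S" "b \<in> ?S" for a b
  proof -
    have *: "jpow x n \<odot> b \<in> ?S" for n
      using \<open>b \<in> ?S\<close>
    proof (induction rule: span_induct_alt)
      case base then show ?case by (simp add: span_zero)
    next
      case (step c y z)
      then show ?case
        by (auto simp: jdistrib jpow_add span_add span_scale span_base)
    qed
    from \<open>a \<in> ?S\<close> show ?thesis
    proof (induction rule: span_induct_alt)
      case base then show ?case by (simp add: span_zero)
    next
      case (step c y z)
      then show ?case
        using * by (auto simp: jdistrib intro!: span_add span_scale)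
    qed
  qed
  have "a \<odot> b \<in> closure ?S" if ab: "a \<in> closure ?S" "b \<in> closure ?S" for a b
  proof -
    obtain f g where "\<forall>n. f n \<in> ?S" "f \<longlonglongrightarrow> a" "\<forall>n. g n \<in> ?S" "g \<longlonglongrightarrow> b"
      using ab unfolding closure_sequential by blast
    then show ?thesis
      unfolding closure_sequential
      by (intro exI[of _ "\<lambda>n. f n \<odot> g n"]) (auto intro!: 1 tendsto_intros)
  qed
  then show ?thesis
    unfolding jb_subalgebra_def by (auto intro: subspace_closure)
qed

lemma subalgebra_Inter: "(\<And>s. s \<in> F \<Longrightarrow> jb_subalgebra (\<odot>) s) \<Longrightarrow> jb_subalgebra (\<odot>) (\<Inter>F)"
  unfolding jb_subalgebra_def by (auto simp: subspace_Inter)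

lemma subalgebra_gen: "jb_subalgebra (\<odot>) (gen x)"
  by (rule hull_in) (auto intro: subalgebra_Inter)

lemma gen_self: "x \<in> gen x" and gen_unit: "e \<in> gen x"
  by (simp_all add: hull_inc)

lemma gen_least: "jb_subalgebra (\<odot>) S \<Longrightarrow> x \<in> S \<Longrightarrow> e \<in> S \<Longrightarrow> gen x \<subseteq> S"
  by (rule hull_minimal) auto

lemma gen_mono: "y \<in> gen x \<Longrightarrow> gen y \<subseteq> gen x"
  by (rule gen_least) (auto simp: subalgebra_gen gen_unit)

lemma gen_subset_span: "gen x \<subseteq> closure (span (range (jpow x)))"
proof (rule gen_least[OF jb_subalgebra_closure_span_jpow])
  have "jpow x 1 \<in> span (range (jpow x))" "jpow x 0 \<in> span (range (jpow x))"
    by (rule span_base, rule rangeI)+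
  then show "x \<in> closure (span (range (jpow x)))" "e \<in> closure (span (range (jpow x)))"
    using closure_subset by auto
qed

lemma gen_subset_bicommutant: "gen x \<subseteq> bicommutant x"
proof -
  have "span (range (jpow x)) \<subseteq> bicommutant x"
    using bicommutant_jpow by (intro span_minimal subspace_bicommutant) auto
  then show ?thesis
    using gen_subset_span closure_minimal[OF _ closed_bicommutant] by blast
qed

lemma
  shows gen_add: "y \<in> gen x \<Longrightarrow> z \<in> gen x \<Longrightarrow> y + z \<in> gen x"
    and gen_diff: "y \<in> gen x \<Longrightarrow> z \<in> gen x \<Longrightarrow> y - z \<in> gen x"
    and gen_scale: "y \<in> gen x \<Longrightarrow> c *\<^sub>R y \<in> gen x"
    and gen_zero: "0 \<in> gen x"
    and gen_prod: "y \<in> gen x \<Longrightarrow> z \<in> gen x \<Longrightarrow> y \<odot> z \<in> gen x"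
  using subalgebra_gen[of x] unfolding jb_subalgebra_def
  by (auto intro: subspace_add subspace_diff subspace_scale subspace_0)

lemma closed_gen: "closed (gen x)"
  using subalgebra_gen[of x] unfolding jb_subalgebra_def by auto

lemma gen_bicommutant:
  assumes "y \<in> gen x" "bounded_linear T" "\<And>w. T (x \<odot> w) = x \<odot> T w"
    "\<And>w. T ((x \<odot> x) \<odot> w) = (x \<odot> x) \<odot> T w"
  shows "T (y \<odot> w) = y \<odot> T w"
  using assms gen_subset_bicommutant[of x] unfolding bicommutant_def by blast

text \<open>Multiplications by \<open>x\<close> and \<open>x \<odot> x\<close> are admissible
  \<open>T\<close> for \<open>y\<close>. So multiplication by \<open>y\<close> commutes with both
  and is itself admissible for \<open>z\<close>.\<close>

lemma gen_commute:
  assumes "y \<in> gen x" "z \<in> gen x"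
  shows "y \<odot> (z \<odot> w) = z \<odot> (y \<odot> w)"
proof -
  have 1: "x \<odot> (y \<odot> w) = y \<odot> (x \<odot> w)" for w
    by (rule gen_bicommutant[OF assms(1) bounded_linear_jprod]) (simp_all add: square_commute)
  have 2: "(x \<odot> x) \<odot> (y \<odot> w) = y \<odot> ((x \<odot> x) \<odot> w)" for w
    by (rule gen_bicommutant[OF assms(1) bounded_linear_jprod]) (simp_all add: square_commute)
  show ?thesis
    by (rule gen_bicommutant[OF assms(2) bounded_linear_jprod]) (simp_all add: 1 2)
qed

lemma gen_assoc:
  assumes "y \<in> gen x" "z \<in> gen x" "u \<in> gen x"
  shows "(y \<odot> z) \<odot> u = y \<odot> (z \<odot> u)"
  using gen_commute[OF assms(3,1), of z] by (simp add: jprod_commute)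

lemma gen_limit:
  assumes "\<And>n. f n \<in> gen x" "f \<longlonglongrightarrow> y"
  shows "y \<in> gen x"
  using closed_gen assms closed_sequentially by blast

text \<open>Positivity as a distance, as for bounded functions: \<open>x \<ge> 0\<close> if and only
  if \<open>\<bar>r - x\<bar> \<le> r\<close> for some constant \<open>r\<close>. Sums and limits
  can be treated with it before any square root exists; agreement with the cone of squares is
  \<open>jb_le_iff\<close>.\<close>

definition pos :: "'a \<Rightarrow> bool" where
  "pos x \<longleftrightarrow> (\<exists>r. norm (r *\<^sub>R e - x) \<le> r)"

abbreviation le (infix "\<preceq>" 50) where
  "x \<preceq> y \<equiv> pos (y - x)"

text \<open>The fixed point \<open>b = (y + b\<^sup>2)/2\<close> satisfies \<open>(e - b)\<^sup>2 = e - y\<close>.\<close>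

lemma near_unit_square:
  assumes y: "norm y < 1"
  obtains w where "w \<in> gen y" "w \<odot> w = e - y"
proof -
  \<comment> \<open>The smaller root of \<open>(norm y + \<beta>\<^sup>2) / 2 = \<beta>\<close>: the
    ball of radius \<open>\<beta>\<close> is mapped into itself, and \<open>\<beta> < 1\<close> is
    the contraction constant.\<close>
  define \<beta> where "\<beta> = 1 - sqrt (1 - norm y)"
  have \<beta>: "0 \<le> \<beta>" "\<beta> < 1" "(norm y + \<beta> * \<beta>) / 2 = \<beta>"
    using y real_sqrt_pow2[of "1 - norm y"]
    by (auto simp: \<beta>_def field_simps power2_eq_square)
  define S where "S = gen y \<inter> cball 0 \<beta>"
  define f where "f b = (1/2) *\<^sub>R (y + b \<odot> b)" for b
  have "\<exists>!b\<in>S. f b = b"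
  proof (rule Banach_fix[where c = \<beta>])
    show "complete S"
      unfolding S_def by (intro closed_Int closed_gen closed_cball complete_eq_closed[THEN iffD2])
    have "0 \<in> S"
      using \<beta> gen_zero by (simp add: S_def)
    then show "S \<noteq> {}" by blast
    show "f ` S \<subseteq> S"
    proof clarify
      fix b assume b: "b \<in> S"
      have "norm (f b) \<le> (norm y + norm b * norm b) / 2"
        unfolding f_def using norm_triangle_ineq[of y "b \<odot> b"] norm_jprod_le[of b b]
        by simp
      also have "\<dots> \<le> (norm y + \<beta> * \<beta>) / 2"
        using b \<beta> by (intro divide_right_mono add_left_mono mult_mono) (auto simp: S_def)
      finally show "f b \<in> S"
        using b \<beta> by (auto simp: S_def f_def intro!: gen_scale gen_add gen_prod gen_self)
    qed
    show "dist (f x) (f z) \<le> \<beta> * dist x z" if xz: "x \<in> S" "z \<in> S" for x z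
    proof -
      have "f x - f z = (1/2) *\<^sub>R ((x - z) \<odot> (x + z))"
        by (simp add: f_def jdistrib jprod_commute algebra_simps)
      then have "norm (f x - f z) \<le> (norm (x - z) * norm (x + z)) / 2"
        using norm_jprod_le[of "x - z" "x + z"] by simp
      also have "\<dots> \<le> (norm (x - z) * (\<beta> + \<beta>)) / 2"
        using xz norm_triangle_ineq[of x z]
        by (intro divide_right_mono mult_left_mono) (auto simp: S_def)
      finally show "dist (f x) (f z) \<le> \<beta> * dist x z"
        by (simp add: dist_norm mult.commute)
    qed
  qed (use \<beta> in auto)
  then obtain b where b: "b \<in> S" "f b = b" by blast
  have "2 *\<^sub>R b = 2 *\<^sub>R f b" using b by simp
  also have "\<dots> = y + b \<odot> b" by (simp add: f_def)
  finally have "b + b = y + b \<odot> b" by (simp add: scaleR_2)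
  then have "(e - b) \<odot> (e - b) = e - y"
    by (simp add: jdistrib algebra_simps)
  moreover have "e - b \<in> gen y"
    using b by (auto simp: S_def intro: gen_diff gen_unit)
  ultimately show ?thesis using that by blast
qed

text \<open>For \<open>norm x < 1\<close> the element \<open>e - x \<odot> x\<close> is a square
  \<open>w \<odot> w\<close>, and the axiom \<open>norm_square_le\<close> bounds its norm by that of
  \<open>w \<odot> w + x \<odot> x = e\<close>. The boundary case is a limit of rescaled
  elements.\<close>

lemma norm_unit_minus_square:
  assumes "norm x \<le> 1"
  shows "norm (e - x \<odot> x) \<le> 1"
proof -
  have *: "norm (e - x \<odot> x) \<le> 1" if "norm x < 1" for x
  proof -
    have "norm (x \<odot> x) < 1"
      using that by (simp add: norm_square power_less_one_iff)
    then obtain w where "w \<odot> w = e - x \<odot> x"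
      using near_unit_square by blast
    then show ?thesis
      using norm_square_le[of w x] norm_unit_le by (auto simp: algebra_simps)
  qed
  define c :: "nat \<Rightarrow> real" where "c n = 1 - inverse (real (Suc n))" for n
  have c: "c \<longlonglongrightarrow> 1"
    unfolding c_def using LIMSEQ_inverse_real_of_nat_add_minus[of 1] by simp
  have "norm (c n *\<^sub>R x) < 1" for n
  proof -
    have "0 \<le> c n" "c n < 1" by (auto simp: c_def inverse_le_1_iff)
    then show ?thesis
      using assms mult_left_mono[of "norm x" 1 "c n"] by simp
  qed
  then have "norm (e - (c n *\<^sub>R x) \<odot> (c n *\<^sub>R x)) \<le> 1" for n
    using * by blast
  moreover have "(\<lambda>n. norm (e - (c n *\<^sub>R x) \<odot> (c n *\<^sub>R x))) \<longlonglongrightarrow> norm (e - (1 *\<^sub>R x) \<odot> (1 *\<^sub>R x))"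
    by (intro tendsto_intros c)
  ultimately have "norm (e - (1 *\<^sub>R x) \<odot> (1 *\<^sub>R x)) \<le> 1"
    by (intro Lim_bounded[where M = 0]) auto
  then show ?thesis by simp
qed

lemma norm_scale_unit_minus_square:
  assumes "norm (x \<odot> x) \<le> s"
  shows "norm (s *\<^sub>R e - x \<odot> x) \<le> s"
proof (cases "s = 0")
  case False
  then have s: "s > 0" using assms norm_ge_zero[of "x \<odot> x"] by linarith
  have "(norm (x /\<^sub>R sqrt s))\<^sup>2 \<le> 1"
    using assms s by (simp add: norm_square power_mult_distrib power_inverse field_simps)
  then have "norm (x /\<^sub>R sqrt s) \<le> 1"
    by (metis norm_ge_zero one_power2 power2_le_imp_le zero_le_one)
  then have "norm (e - (x /\<^sub>R sqrt s) \<odot> (x /\<^sub>R sqrt s)) \<le> 1"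
    by (rule norm_unit_minus_square)
  then have "norm (s *\<^sub>R (e - inverse s *\<^sub>R (x \<odot> x))) \<le> s"
    using s by (simp add: jdistrib flip: inverse_mult_distrib)
  then show ?thesis using s by (simp add: scaleR_right_diff_distrib)
qed (use assms in simp)

lemma pos_square: "pos (x \<odot> x)"
  unfolding pos_def using norm_scale_unit_minus_square by blast

text \<open>Adding \<open>\<delta> e\<close> turns the weak inequality
  \<open>norm (r e - x) \<le> r\<close> into a strict one after division by
  \<open>r + \<delta>\<close>, so \<open>near_unit_square\<close> applies.\<close>

lemma pos_approx_square:
  assumes "pos x" "\<delta> > 0"
  obtains u where "u \<in> gen x" "u \<odot> u = x + \<delta> *\<^sub>R e"
proof -
  obtain r where r: "norm (r *\<^sub>R e - x) \<le> r"
    using assms by (auto simp: pos_def)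
  then have r0: "r \<ge> 0" using norm_ge_zero order_trans by blast
  define y where "y = (r *\<^sub>R e - x) /\<^sub>R (r + \<delta>)"
  have "norm y = norm (r *\<^sub>R e - x) / (r + \<delta>)"
    using r0 assms by (simp add: y_def divide_inverse mult.commute)
  then have "norm y < 1" using r r0 assms by simp
  then obtain w where w: "w \<in> gen y" "w \<odot> w = e - y"
    using near_unit_square by blast
  have "y \<in> gen x"
    unfolding y_def by (intro gen_scale gen_diff gen_unit gen_self)
  then have "sqrt (r + \<delta>) *\<^sub>R w \<in> gen x"
    using w gen_mono gen_scale by blast
  moreover have "(sqrt (r + \<delta>) *\<^sub>R w) \<odot> (sqrt (r + \<delta>) *\<^sub>R w) = (r + \<delta>) *\<^sub>R (e - y)"
    using r0 assms w by (simp add: jdistrib)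
  moreover have "(r + \<delta>) *\<^sub>R y = r *\<^sub>R e - x"
    using r0 assms by (simp add: y_def)
  then have "(r + \<delta>) *\<^sub>R (e - y) = x + \<delta> *\<^sub>R e"
    by (simp add: scaleR_right_diff_distrib scaleR_left_distrib)
  ultimately show ?thesis using that by metis
qed

lemma le_of_all_pos_add:
  fixes a b c :: real
  assumes "c > 0" "\<And>\<delta>. \<delta> > 0 \<Longrightarrow> a \<le> b + c * \<delta>"
  shows "a \<le> b"
proof (rule field_le_epsilon)
  fix \<epsilon> :: real assume "\<epsilon> > 0"
  then show "a \<le> b + \<epsilon>" using assms(2)[of "\<epsilon> / c"] \<open>c > 0\<close> by simp
qed

lemma norm_mono:
  assumes "pos x" "x \<preceq> y"
  shows "norm x \<le> norm y"
proof (rule le_of_all_pos_add[where c = 3])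
  show "(0::real) < 3" by simp
next
  fix \<delta> :: real assume \<delta>: "\<delta> > 0"
  obtain u where u: "u \<odot> u = x + \<delta> *\<^sub>R e" using pos_approx_square assms(1) \<delta> by blast
  obtain v where v: "v \<odot> v = y - x + \<delta> *\<^sub>R e" using pos_approx_square assms(2) \<delta> by blast
  have e: "norm (\<delta> *\<^sub>R e) \<le> \<delta>"
    using norm_unit_le \<delta> by (simp add: mult_left_le)
  have "norm x \<le> norm (x + \<delta> *\<^sub>R e) + norm (\<delta> *\<^sub>R e)"
    using norm_triangle_ineq4[of "x + \<delta> *\<^sub>R e" "\<delta> *\<^sub>R e"] by simp
  moreover have "norm (x + \<delta> *\<^sub>R e) \<le> norm (u \<odot> u + v \<odot> v)"
    using norm_square_le[of u v] u by simp
  moreover have "u \<odot> u + v \<odot> v = y + \<delta> *\<^sub>R e + \<delta> *\<^sub>R e"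
    by (simp add: u v)
  moreover have "norm (y + \<delta> *\<^sub>R e + \<delta> *\<^sub>R e) \<le> norm y + norm (\<delta> *\<^sub>R e) + norm (\<delta> *\<^sub>R e)"
    by (intro norm_triangle_le add_mono order_refl)
  ultimately have "norm x \<le> norm y + norm (\<delta> *\<^sub>R e) + norm (\<delta> *\<^sub>R e) + norm (\<delta> *\<^sub>R e)"
    by simp
  then show "norm x \<le> norm y + 3 * \<delta>" using e by linarith
qed

text \<open>This frees \<open>pos\<close> from its existential radius: any bound of the norm serves.
  With radius \<open>norm (f n)\<close>, positivity becomes a closed condition in
  \<open>pos_limit\<close>.\<close>

lemma pos_norm_bound:
  assumes "pos x" "norm x \<le> s"
  shows "norm (s *\<^sub>R e - x) \<le> s"
proof (rule le_of_all_pos_add[where c = 1])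
  show "(0::real) < 1" by simp
next
  fix \<delta> :: real assume \<delta>: "\<delta> > 0"
  obtain u where u: "u \<odot> u = x + \<delta> *\<^sub>R e" using pos_approx_square assms(1) \<delta> by blast
  have "norm (\<delta> *\<^sub>R e) \<le> \<delta>"
    using norm_unit_le \<delta> by (simp add: mult_left_le)
  then have "norm (u \<odot> u) \<le> s + \<delta>"
    unfolding u using assms(2) norm_triangle_ineq[of x "\<delta> *\<^sub>R e"] by simp
  then have "norm ((s + \<delta>) *\<^sub>R e - u \<odot> u) \<le> s + \<delta>"
    by (rule norm_scale_unit_minus_square)
  then show "norm (s *\<^sub>R e - x) \<le> s + 1 * \<delta>"
    unfolding u by (simp add: algebra_simps)
qed

lemma pos_add: "pos x \<Longrightarrow> pos y \<Longrightarrow> pos (x + y)"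
proof -
  assume "pos x" "pos y"
  then obtain r s where rs: "norm (r *\<^sub>R e - x) \<le> r" "norm (s *\<^sub>R e - y) \<le> s"
    by (auto simp: pos_def)
  have "norm ((r + s) *\<^sub>R e - (x + y)) \<le> norm (r *\<^sub>R e - x) + norm (s *\<^sub>R e - y)"
    using norm_triangle_ineq[of "r *\<^sub>R e - x" "s *\<^sub>R e - y"] by (simp add: algebra_simps)
  then show "pos (x + y)" using rs unfolding pos_def by (intro exI[of _ "r + s"]) linarith
qed

lemma pos_scale: "pos x \<Longrightarrow> c \<ge> 0 \<Longrightarrow> pos (c *\<^sub>R x)"
proof -
  assume "pos x" "c \<ge> 0"
  then obtain r where r: "norm (r *\<^sub>R e - x) \<le> r"
    by (auto simp: pos_def)
  have "norm ((c * r) *\<^sub>R e - c *\<^sub>R x) = norm (c *\<^sub>R (r *\<^sub>R e - x))"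
    by (simp add: scaleR_right_diff_distrib)
  also have "\<dots> = c * norm (r *\<^sub>R e - x)"
    using \<open>c \<ge> 0\<close> by simp
  also have "\<dots> \<le> c * r" using r \<open>c \<ge> 0\<close> by (rule mult_left_mono)
  finally show "pos (c *\<^sub>R x)" unfolding pos_def by blast
qed

lemma pos_scale_iff: "c > 0 \<Longrightarrow> pos (c *\<^sub>R x) \<longleftrightarrow> pos x"
  using pos_scale[of x c] pos_scale[of "c *\<^sub>R x" "inverse c"] by auto

lemma pos_zero [simp]: "pos 0"
  unfolding pos_def by (intro exI[of _ 0]) simp

lemma pos_unit [simp]: "pos e"
  using pos_square[of e] by simp

lemma pos_unit_scale [simp]: "c \<ge> 0 \<Longrightarrow> pos (c *\<^sub>R e)"
  by (simp add: pos_scale)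

lemma pos_limit:
  assumes "f \<longlonglongrightarrow> x" "\<And>n. pos (f n)"
  shows "pos x"
proof -
  have "norm (norm (f n) *\<^sub>R e - f n) \<le> norm (f n)" for n
    using pos_norm_bound assms by blast
  moreover have "(\<lambda>n. norm (norm (f n) *\<^sub>R e - f n)) \<longlonglongrightarrow> norm (norm x *\<^sub>R e - x)"
    by (intro tendsto_intros assms)
  ultimately have "norm (norm x *\<^sub>R e - x) \<le> norm x"
    using assms(1) by (intro LIMSEQ_le[OF _ tendsto_norm[OF assms(1)]]) auto
  then show ?thesis unfolding pos_def by blast
qed

lemma pos_approx:
  assumes "\<And>\<delta>. \<delta> > 0 \<Longrightarrow> pos (x + \<delta> *\<^sub>R y)"
  shows "pos x"
proof (rule pos_limit)
  show "(\<lambda>n. x + inverse (real (Suc n)) *\<^sub>R y) \<longlonglongrightarrow> x"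
    using tendsto_add[OF tendsto_const tendsto_scaleR[OF LIMSEQ_inverse_real_of_nat tendsto_const],
        of x y] by simp
qed (use assms in auto)

lemma pos_antisym:
  assumes "pos x" "pos (- x)"
  shows "x = 0"
proof -
  have "norm x \<le> norm (0::'a)"
    using assms by (intro norm_mono) auto
  then show ?thesis by simp
qed

lemma le_antisym: "x \<preceq> y \<Longrightarrow> y \<preceq> x \<Longrightarrow> x = y"
  using pos_antisym[of "x - y"] by simp

lemma le_trans [trans]: "x \<preceq> y \<Longrightarrow> y \<preceq> z \<Longrightarrow> x \<preceq> z"
  using pos_add[of "y - x" "z - y"] by simp

lemma pos_trans: "pos x \<Longrightarrow> x \<preceq> y \<Longrightarrow> pos y"
  using pos_add[of x "y - x"] by simp

text \<open>Inside one associative \<open>gen a\<close> a product of squares is the square of the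
  product; approximation by squares and a limit do the rest.\<close>

lemma pos_prod:
  assumes "x \<in> gen a" "y \<in> gen a" "pos x" "pos y"
  shows "pos (x \<odot> y)"
proof -
  have *: "pos ((x + \<delta> *\<^sub>R e) \<odot> (y + \<delta> *\<^sub>R e))" if \<delta>: "\<delta> > 0" for \<delta>
  proof -
    obtain u where u: "u \<in> gen x" "u \<odot> u = x + \<delta> *\<^sub>R e"
      using pos_approx_square assms \<delta> by metis
    obtain v where v: "v \<in> gen y" "v \<odot> v = y + \<delta> *\<^sub>R e"
      using pos_approx_square assms \<delta> by metis
    have uv: "u \<in> gen a" "v \<in> gen a" using u v assms gen_mono by blast+
    have "(u \<odot> u) \<odot> (v \<odot> v) = u \<odot> ((u \<odot> v) \<odot> v)"
      using uv gen_prod[of v a v] by (simp add: gen_assoc)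
    also have "\<dots> = (u \<odot> v) \<odot> (u \<odot> v)"
      using uv gen_prod[of u a v] by (rule_tac gen_commute)
    finally have "(u \<odot> u) \<odot> (v \<odot> v) = (u \<odot> v) \<odot> (u \<odot> v)" .
    then show ?thesis using u v pos_square by metis
  qed
  have "(\<lambda>n. (x + inverse (real (Suc n)) *\<^sub>R e) \<odot> (y + inverse (real (Suc n)) *\<^sub>R e))
      \<longlonglongrightarrow> (x + 0 *\<^sub>R e) \<odot> (y + 0 *\<^sub>R e)"
    by (intro tendsto_intros LIMSEQ_inverse_real_of_nat)
  then have "pos ((x + 0 *\<^sub>R e) \<odot> (y + 0 *\<^sub>R e))"
    by (rule pos_limit) (rule *, simp)
  then show ?thesis by simp
qed

lemma le_norm_unit: "norm x \<le> r \<Longrightarrow> x \<preceq> r *\<^sub>R e"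
  and neg_norm_unit_le: "norm x \<le> r \<Longrightarrow> pos (r *\<^sub>R e + x)"
  unfolding pos_def by (auto intro!: exI[of _ r])

text \<open>\<open>(r e - x) \<odot> (r e + x) = r\<^sup>2 e - x \<odot> x\<close> is positive, so
  \<open>norm (x \<odot> x) \<le> r\<^sup>2\<close>. With the two bounds above, the norm is the
  order unit norm of \<open>e\<close>.\<close>

lemma norm_le_of_unit_bounds:
  assumes "x \<preceq> r *\<^sub>R e" "pos (r *\<^sub>R e + x)" "r \<ge> 0"
  shows "norm x \<le> r"
proof -
  have "pos ((r *\<^sub>R e - x) \<odot> (r *\<^sub>R e + x))"
    using assms by (intro pos_prod[of _ x]) (auto intro: gen_diff gen_add gen_scale gen_unit gen_self)
  then have "pos ((r * r) *\<^sub>R e - x \<odot> x)"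
    by (simp add: jdistrib algebra_simps)
  then have "norm (x \<odot> x) \<le> norm ((r * r) *\<^sub>R e)"
    by (intro norm_mono pos_square)
  also have "\<dots> \<le> r * r"
    using norm_unit_le by (simp add: mult_left_le)
  finally show ?thesis
    using assms(3) by (metis norm_square power2_eq_square power2_le_imp_le)
qed

lemma norm_le_one_of_effect:
  assumes "pos x" "x \<preceq> e"
  shows "norm x \<le> 1"
  using norm_mono[OF assms] norm_unit_le by simp

end

subsection \<open>Functional calculus\<close>

lemma poly_map_poly_complex_mult:
  fixes p q :: "real poly"
  shows "poly (map_poly complex_of_real (p * q)) z
    = poly (map_poly complex_of_real p) z * poly (map_poly complex_of_real q) z"
proof -
  have "map_poly complex_of_real (p * q) = map_poly complex_of_real p * map_poly complex_of_real q"
    by (rule poly_eqI) (simp add: coeff_map_poly coeff_mult)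
  then show ?thesis by simp
qed

lemma poly_map_poly_complex_add:
  fixes p q :: "real poly"
  shows "poly (map_poly complex_of_real (p + q)) z
    = poly (map_poly complex_of_real p) z + poly (map_poly complex_of_real q) z"
proof -
  have "map_poly complex_of_real (p + q) = map_poly complex_of_real p + map_poly complex_of_real q"
    by (rule poly_eqI) (simp add: coeff_map_poly)
  then show ?thesis by simp
qed

text \<open>Division of \<open>p\<close> by the quadratic with roots \<open>z\<close> and its
  conjugate leaves a real remainder of degree at most one that vanishes at the non-real
  \<open>z\<close>, hence is zero.\<close>

lemma real_poly_factor:
  fixes p :: "real poly"
  assumes deg: "degree p > 0" and no_root: "\<And>r. poly p r \<noteq> 0"
  obtains a b q where "p = [:a\<^sup>2 + b\<^sup>2, - 2 * a, 1:] * q" "b \<noteq> 0"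
proof -
  have "\<not> constant (poly (map_poly complex_of_real p))"
    using deg by (simp add: constant_degree degree_map_poly)
  then obtain z where z: "poly (map_poly complex_of_real p) z = 0"
    using fundamental_theorem_of_algebra by blast
  define a b where "a = Re z" "b = Im z"
  have zab: "z = Complex a b" by (simp add: a_b_def)
  have b: "b \<noteq> 0"
  proof
    assume "b = 0"
    then have "z = complex_of_real a" by (simp add: zab complex_eq_iff)
    then have "complex_of_real (poly p a) = 0"
      using z by (simp add: poly_altdef degree_map_poly coeff_map_poly)
    then show False using no_root by simp
  qed
  define d where "d = [:a\<^sup>2 + b\<^sup>2, - 2 * a, 1:]"
  define r where "r = p mod d"
  have p: "p = d * (p div d) + r" by (simp add: r_def)
  have "poly (map_poly complex_of_real d) z = 0"
    unfolding d_def by (simp add: map_poly_pCons zab complex_eq_iff power2_eq_square algebra_simps)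
  moreover have "poly (map_poly complex_of_real d) z * poly (map_poly complex_of_real (p div d)) z
      + poly (map_poly complex_of_real r) z = 0"
    using z p by (metis poly_map_poly_complex_add poly_map_poly_complex_mult)
  ultimately have r: "poly (map_poly complex_of_real r) z = 0" by simp
  have "degree d = 2" by (simp add: d_def)
  then have "d \<noteq> 0" by auto
  with \<open>degree d = 2\<close> have "degree r \<le> 1"
    using degree_mod_less[of d p] by (auto simp: r_def)
  define r0 r1 where "r0 = coeff r 0" "r1 = coeff r 1"
  have r01: "r = [:r0, r1:]"
    using \<open>degree r \<le> 1\<close> unfolding r0_r1_def
    by (intro poly_eqI) (auto simp: coeff_pCons coeff_eq_0 split: nat.splits)
  have "r1 * b = 0" "r0 + r1 * a = 0"
    using r unfolding r01 by (auto simp: map_poly_pCons zab complex_eq_iff mult.commute)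
  then have "r = 0" using b r01 by simp
  then show ?thesis using that p b unfolding d_def by (metis add.right_neutral)
qed

context jb_unital
begin

definition peval :: "'a \<Rightarrow> real poly \<Rightarrow> 'a" where
  "peval x p = fold_coeffs (\<lambda>a y. a *\<^sub>R e + x \<odot> y) p 0"

lemma peval_0 [simp]: "peval x 0 = 0"
  by (simp add: peval_def)

lemma peval_pCons [simp]: "peval x (pCons a p) = a *\<^sub>R e + x \<odot> peval x p"
  by (cases "p = 0 \<and> a = 0") (auto simp: peval_def)

lemma peval_gen: "peval x p \<in> gen x"
  by (induction p) (auto intro: gen_zero gen_add gen_scale gen_unit gen_prod gen_self)

lemma peval_add: "peval x (p + q) = peval x p + peval x q"
  by (induction p q rule: poly_induct2) (auto simp: jdistrib scaleR_left_distrib)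

lemma peval_smult: "peval x (smult c p) = c *\<^sub>R peval x p"
  by (induction p) (auto simp: jdistrib scaleR_right_distrib)

lemma peval_uminus: "peval x (- p) = - peval x p"
  by (induction p) (auto simp: jdistrib)

lemma peval_diff: "peval x (p - q) = peval x p - peval x q"
  using peval_add[of x p "- q"] by (simp add: peval_uminus)

lemma peval_mult: "peval x (p * q) = peval x p \<odot> peval x q"
proof (induction p)
  case (pCons a p)
  then show ?case
    by (simp add: peval_add peval_smult jdistrib gen_assoc[OF gen_self peval_gen peval_gen])
qed simp

text \<open>A polynomial positive on the interval is a positive constant times factors of three
  kinds: \<open>(t - a)\<^sup>2 + b\<^sup>2\<close>, \<open>t - r\<close> with
  \<open>r < \<alpha>\<close>, and \<open>r - t\<close> with \<open>r > \<beta>\<close>. Each is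
  positive at \<open>x\<close>, and \<open>pos_prod\<close> multiplies them. This takes the place of
  a spectral theorem.\<close>

lemma peval_pos_strict:
  assumes x: "\<alpha> *\<^sub>R e \<preceq> x" "x \<preceq> \<beta> *\<^sub>R e" and "\<alpha> \<le> \<beta>"
  shows "(\<And>t. \<alpha> \<le> t \<Longrightarrow> t \<le> \<beta> \<Longrightarrow> poly p t > 0) \<Longrightarrow> pos (peval x p)"
proof (induction "degree p" arbitrary: p rule: less_induct)
  case less
  consider "degree p = 0" | "degree p > 0" "\<And>r. poly p r \<noteq> 0" | r where "degree p > 0" "poly p r = 0"
    by blast
  then show ?case
  proof cases
    case 1
    then obtain c where "p = [:c:]" by (rule degree_eq_zeroE)
    then show ?thesis using less.prems[of \<alpha>] \<open>\<alpha> \<le> \<beta>\<close> by simp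
  next
    case 2
    obtain a b q where q: "p = [:a\<^sup>2 + b\<^sup>2, - 2 * a, 1:] * q" "b \<noteq> 0"
      using real_poly_factor[OF 2] by blast
    have "q \<noteq> 0" using 2 q by auto
    then have "degree p = 2 + degree q" unfolding q(1) by (subst degree_mult_eq) auto
    moreover have "poly q t > 0" if t: "\<alpha> \<le> t" "t \<le> \<beta>" for t
    proof -
      have "poly [:a\<^sup>2 + b\<^sup>2, - 2 * a, 1:] t = (t - a)\<^sup>2 + b\<^sup>2"
        by (simp add: power2_eq_square algebra_simps)
      also have "\<dots> > 0" using \<open>b \<noteq> 0\<close> by (simp add: sum_power2_gt_zero_iff)
      finally show ?thesis
        using less.prems[OF t] unfolding q(1) poly_mult by (simp add: zero_less_mult_iff)
    qed
    ultimately have "pos (peval x q)" by (intro less.hyps) auto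
    moreover have "pos (peval x [:a\<^sup>2 + b\<^sup>2, - 2 * a, 1:])"
    proof -
      have "peval x [:a\<^sup>2 + b\<^sup>2, - 2 * a, 1:] = (x - a *\<^sub>R e) \<odot> (x - a *\<^sub>R e) + (b\<^sup>2) *\<^sub>R e"
        by (simp add: jdistrib power2_eq_square algebra_simps)
          (simp flip: scaleR_2)
      then show ?thesis by (auto intro: pos_add pos_square)
    qed
    ultimately show ?thesis
      unfolding q(1) peval_mult by (intro pos_prod[OF peval_gen peval_gen])
  next
    case (3 r)
    then obtain q where q: "p = [:- r, 1:] * q"
      by (metis poly_eq_0_iff_dvd dvdE)
    have "q \<noteq> 0" using 3 q by auto
    then have deg: "degree q < degree p" unfolding q by (subst degree_mult_eq) auto
    have pt: "poly p t = (t - r) * poly q t" for t by (simp add: q algebra_simps)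
    have "\<not> (\<alpha> \<le> r \<and> r \<le> \<beta>)" using less.prems[of r] 3 by auto
    then consider "r < \<alpha>" | "r > \<beta>" by linarith
    then show ?thesis
    proof cases
      case 1
      have "poly q t > 0" if "\<alpha> \<le> t" "t \<le> \<beta>" for t
        using less.prems[OF that] 1 that by (simp add: pt zero_less_mult_iff)
      then have "pos (peval x q)" using deg by (intro less.hyps) auto
      moreover have "pos (x - \<alpha> *\<^sub>R e + (\<alpha> - r) *\<^sub>R e)"
        using 1 x by (intro pos_add) auto
      then have "pos (peval x [:- r, 1:])"
        by (simp add: algebra_simps)
      ultimately show ?thesis
        unfolding q peval_mult by (intro pos_prod[OF peval_gen peval_gen])
    next
      case 2
      have "poly (- q) t > 0" if "\<alpha> \<le> t" "t \<le> \<beta>" for t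
        using less.prems[OF that] 2 that by (simp add: pt zero_less_mult_iff)
      then have "pos (peval x (- q))" using deg by (intro less.hyps) auto
      moreover have "pos (\<beta> *\<^sub>R e - x + (r - \<beta>) *\<^sub>R e)"
        using 2 x by (intro pos_add) auto
      then have "pos (peval x [:r, - 1:])"
        by (simp add: jdistrib algebra_simps)
      moreover have "p = [:r, - 1:] * (- q)" by (simp add: q)
      ultimately show ?thesis
        by (metis peval_mult pos_prod[OF peval_gen peval_gen])
    qed
  qed
qed

lemma peval_pos:
  assumes x: "\<alpha> *\<^sub>R e \<preceq> x" "x \<preceq> \<beta> *\<^sub>R e" and "\<alpha> \<le> \<beta>"
    and p: "\<And>t. \<alpha> \<le> t \<Longrightarrow> t \<le> \<beta> \<Longrightarrow> poly p t \<ge> 0"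
  shows "pos (peval x p)"
proof (rule pos_approx[where y = e])
  fix \<delta> :: real assume "\<delta> > 0"
  then have "pos (peval x (p + [:\<delta>:]))"
    using p by (intro peval_pos_strict[OF assms(1-3)]) (simp add: add_nonneg_pos)
  then show "pos (peval x p + \<delta> *\<^sub>R e)" by (simp add: peval_add)
qed

lemma norm_interval: "(- norm x) *\<^sub>R e \<preceq> x" "x \<preceq> norm x *\<^sub>R e"
  using neg_norm_unit_le[of x "norm x"] le_norm_unit[of x "norm x"] by (simp_all add: add.commute)

lemma norm_peval_le:
  assumes "\<And>t. \<bar>t\<bar> \<le> norm x \<Longrightarrow> \<bar>poly p t\<bar> \<le> C"
  shows "norm (peval x p) \<le> C"
proof -
  have "pos (peval x ([:C:] - p))" "pos (peval x ([:C:] + p))"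
    by (rule peval_pos[OF norm_interval], simp, use assms in \<open>force simp: abs_le_iff\<close>)+
  moreover have "C \<ge> 0" using assms[of 0] by simp
  ultimately show ?thesis
    by (intro norm_le_of_unit_bounds) (auto simp: peval_add peval_diff)
qed

text \<open>The intervals grow with \<open>n\<close>, so one sequence of polynomials serves elements
  of every norm.\<close>

definition approx_poly :: "(real \<Rightarrow> real) \<Rightarrow> nat \<Rightarrow> real poly" where
  "approx_poly g n = (SOME p. \<forall>t. \<bar>t\<bar> \<le> real n \<longrightarrow> \<bar>poly p t - g t\<bar> < inverse (real (Suc n)))"

lemma approx_poly:
  assumes "continuous_on UNIV g" "\<bar>t\<bar> \<le> real n"
  shows "\<bar>poly (approx_poly g n) t - g t\<bar> < inverse (real (Suc n))"
proof -
  have c: "continuous_on {- real n..real n} g"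
    using assms(1) continuous_on_subset by blast
  obtain f where f: "real_polynomial_function f"
      "\<And>t. t \<in> {- real n..real n} \<Longrightarrow> \<bar>g t - f t\<bar> < inverse (real (Suc n))"
    using Stone_Weierstrass_real_polynomial_function[OF compact_Icc c, of "inverse (real (Suc n))"]
    by auto
  obtain a m where am: "f = (\<lambda>x. \<Sum>i\<le>m. a i * x ^ i)"
    using f(1) by (auto simp: real_polynomial_function_iff_sum)
  define p where "p = (\<Sum>i\<le>m. monom (a i) i)"
  have "poly p t = f t" for t by (simp add: p_def am poly_sum poly_monom)
  then have "\<forall>t. \<bar>t\<bar> \<le> real n \<longrightarrow> \<bar>poly p t - g t\<bar> < inverse (real (Suc n))"
    using f(2) by (auto simp: abs_minus_commute abs_le_iff)
  then have "\<forall>t. \<bar>t\<bar> \<le> real n \<longrightarrow> \<bar>poly (approx_poly g n) t - g t\<bar> < inverse (real (Suc n))"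
    unfolding approx_poly_def by (rule someI)
  then show ?thesis using assms(2) by blast
qed

lemma uniform_limit_approx_poly:
  assumes "continuous_on UNIV g"
  shows "uniform_limit {- r..r} (\<lambda>n. poly (approx_poly g n)) g sequentially"
proof (rule uniform_limitI)
  fix \<epsilon> :: real assume "\<epsilon> > 0"
  then have "\<forall>\<^sub>F n in sequentially. inverse (real (Suc n)) < \<epsilon>"
    using LIMSEQ_inverse_real_of_nat by (auto simp: tendsto_iff dest!: spec[of _ \<epsilon>])
  moreover have "\<forall>\<^sub>F n in sequentially. r \<le> real n"
    using eventually_ge_at_top[of "nat \<lceil>r\<rceil>"] by eventually_elim linarith
  ultimately show "\<forall>\<^sub>F n in sequentially. \<forall>t\<in>{- r..r}. dist (poly (approx_poly g n) t) (g t) < \<epsilon>"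
  proof eventually_elim
    case (elim n)
    have "dist (poly (approx_poly g n) t) (g t) < \<epsilon>" if "t \<in> {- r..r}" for t
    proof -
      have "\<bar>t\<bar> \<le> real n" using that elim by auto
      then show ?thesis using approx_poly[OF assms, of t n] elim by (simp add: dist_real_def)
    qed
    then show ?case by blast
  qed
qed

definition fc :: "'a \<Rightarrow> (real \<Rightarrow> real) \<Rightarrow> 'a" where
  "fc x g = lim (\<lambda>n. peval x (approx_poly g n))"

lemma uniform_limit_peval_diff:
  assumes "uniform_limit {- norm x..norm x} (\<lambda>n. poly (p n)) g sequentially"
    and "uniform_limit {- norm x..norm x} (\<lambda>n. poly (q n)) g sequentially"
  shows "(\<lambda>n. peval x (p n) - peval x (q n)) \<longlonglongrightarrow> 0"
proof (rule tendstoI)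
  fix \<epsilon> :: real assume \<epsilon>: "\<epsilon> > 0"
  have "uniform_limit {- norm x..norm x} (\<lambda>n t. poly (p n) t - poly (q n) t) (\<lambda>t. g t - g t) sequentially"
    by (intro uniform_limit_intros assms)
  then have "\<forall>\<^sub>F n in sequentially. \<forall>t\<in>{- norm x..norm x}. dist (poly (p n) t - poly (q n) t) (g t - g t) < \<epsilon> / 2"
    using \<epsilon> by (intro uniform_limitD) auto
  then show "\<forall>\<^sub>F n in sequentially. dist (peval x (p n) - peval x (q n)) 0 < \<epsilon>"
  proof eventually_elim
    case (elim n)
    then have "norm (peval x (p n - q n)) \<le> \<epsilon> / 2"
      by (intro norm_peval_le) (auto simp: abs_le_iff less_imp_le)
    then show ?case using \<epsilon> by (simp add: peval_diff)
  qed
qed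

lemma convergent_approx_poly:
  assumes g: "continuous_on UNIV g"
  shows "(\<lambda>n. peval x (approx_poly g n)) \<longlonglongrightarrow> fc x g"
proof -
  have "Cauchy (\<lambda>n. peval x (approx_poly g n))"
  proof (rule metric_CauchyI)
    fix \<epsilon> :: real assume \<epsilon>: "\<epsilon> > 0"
    then have "\<forall>\<^sub>F n in sequentially. \<forall>t\<in>{- norm x..norm x}. dist (poly (approx_poly g n) t) (g t) < \<epsilon> / 4"
      using uniform_limit_approx_poly[OF g] by (intro uniform_limitD) auto
    then obtain M where M: "\<And>n t. n \<ge> M \<Longrightarrow> \<bar>t\<bar> \<le> norm x \<Longrightarrow> \<bar>poly (approx_poly g n) t - g t\<bar> < \<epsilon> / 4"
      unfolding eventually_sequentially dist_real_def Ball_def atLeastAtMost_iff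
      by (metis abs_le_iff minus_le_iff)
    have "dist (peval x (approx_poly g m)) (peval x (approx_poly g n)) < \<epsilon>" if "m \<ge> M" "n \<ge> M" for m n
    proof -
      have "\<bar>poly (approx_poly g m - approx_poly g n) t\<bar> \<le> \<epsilon> / 2" if "\<bar>t\<bar> \<le> norm x" for t
        using M[OF \<open>m \<ge> M\<close> that] M[OF \<open>n \<ge> M\<close> that] unfolding poly_diff by arith
      then have "norm (peval x (approx_poly g m - approx_poly g n)) \<le> \<epsilon> / 2"
        by (rule norm_peval_le)
      then show ?thesis using \<epsilon> by (simp add: peval_diff dist_norm)
    qed
    then show "\<exists>M. \<forall>m\<ge>M. \<forall>n\<ge>M. dist (peval x (approx_poly g m)) (peval x (approx_poly g n)) < \<epsilon>"
      by blast
  qed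
  then show ?thesis
    unfolding fc_def using Cauchy_convergent convergent_LIMSEQ_iff by blast
qed

lemma peval_tendsto_fc:
  assumes g: "continuous_on UNIV g"
    and p: "uniform_limit {- norm x..norm x} (\<lambda>n. poly (p n)) g sequentially"
  shows "(\<lambda>n. peval x (p n)) \<longlonglongrightarrow> fc x g"
  using tendsto_add[OF uniform_limit_peval_diff[OF p uniform_limit_approx_poly[OF g]]
      convergent_approx_poly[OF g, of x]] by simp

lemma fc_gen: "continuous_on UNIV g \<Longrightarrow> fc x g \<in> gen x"
  using gen_limit[OF peval_gen convergent_approx_poly] .

lemma fc_poly: "fc x (poly p) = peval x p"
proof -
  have "(\<lambda>n. peval x p) \<longlonglongrightarrow> fc x (poly p)"
    by (rule peval_tendsto_fc) (auto intro!: continuous_intros uniform_limitI)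
  then show ?thesis using LIMSEQ_unique tendsto_const by blast
qed

lemma fc_const: "fc x (\<lambda>t. c) = c *\<^sub>R e"
proof -
  have "poly [:c:] = (\<lambda>t. c)" by (rule ext) simp
  then show ?thesis using fc_poly[of x "[:c:]"] by simp
qed

lemma fc_id: "fc x (\<lambda>t. t) = x"
proof -
  have "poly [:0, 1:] = (\<lambda>t::real. t)" by (rule ext) simp
  then show ?thesis using fc_poly[of x "[:0, 1:]"] by simp
qed

lemma fc_add:
  assumes "continuous_on UNIV f" "continuous_on UNIV g"
  shows "fc x (\<lambda>t. f t + g t) = fc x f + fc x g"
proof -
  have "(\<lambda>n. poly (approx_poly f n + approx_poly g n))
      = (\<lambda>n t. poly (approx_poly f n) t + poly (approx_poly g n) t)"
    by (intro ext) simp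
  then have "uniform_limit {- norm x..norm x} (\<lambda>n. poly (approx_poly f n + approx_poly g n))
      (\<lambda>t. f t + g t) sequentially"
    by (simp add: assms uniform_limit_approx_poly uniform_limit_add)
  then have "(\<lambda>n. peval x (approx_poly f n + approx_poly g n)) \<longlonglongrightarrow> fc x (\<lambda>t. f t + g t)"
    by (intro peval_tendsto_fc continuous_intros assms)
  moreover have "(\<lambda>n. peval x (approx_poly f n + approx_poly g n)) \<longlonglongrightarrow> fc x f + fc x g"
    unfolding peval_add by (intro tendsto_add convergent_approx_poly assms)
  ultimately show ?thesis using LIMSEQ_unique by blast
qed

lemma fc_mult:
  assumes "continuous_on UNIV f" "continuous_on UNIV g"
  shows "fc x (\<lambda>t. f t * g t) = fc x f \<odot> fc x g"
proof -
  have b: "bounded (h ` {- norm x..norm x})" if "continuous_on UNIV h" for h :: "real \<Rightarrow> real"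
    by (intro compact_imp_bounded compact_continuous_image continuous_on_subset[OF that]) auto
  have "(\<lambda>n. poly (approx_poly f n * approx_poly g n))
      = (\<lambda>n t. poly (approx_poly f n) t * poly (approx_poly g n) t)"
    by (intro ext) simp
  then have "uniform_limit {- norm x..norm x} (\<lambda>n. poly (approx_poly f n * approx_poly g n))
      (\<lambda>t. f t * g t) sequentially"
    by (simp add: assms uniform_limit_approx_poly uniform_lim_mult b)
  then have "(\<lambda>n. peval x (approx_poly f n * approx_poly g n)) \<longlonglongrightarrow> fc x (\<lambda>t. f t * g t)"
    by (intro peval_tendsto_fc continuous_intros assms)
  moreover have "(\<lambda>n. peval x (approx_poly f n * approx_poly g n)) \<longlonglongrightarrow> fc x f \<odot> fc x g"
    unfolding peval_mult by (intro tendsto_jprod convergent_approx_poly assms)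
  ultimately show ?thesis using LIMSEQ_unique by blast
qed

lemma fc_scale:
  assumes "continuous_on UNIV f"
  shows "fc x (\<lambda>t. c * f t) = c *\<^sub>R fc x f"
  using fc_mult[of "\<lambda>t. c" f x] assms by (simp add: fc_const jdistrib)

lemma fc_diff:
  assumes "continuous_on UNIV f" "continuous_on UNIV g"
  shows "fc x (\<lambda>t. f t - g t) = fc x f - fc x g"
  using fc_add[of f "\<lambda>t. (-1) * g t" x] fc_scale[of g x "-1"] assms
  by (simp add: continuous_intros)

lemma fc_pos:
  assumes x: "\<alpha> *\<^sub>R e \<preceq> x" "x \<preceq> \<beta> *\<^sub>R e" and "\<alpha> \<le> \<beta>"
    and g: "continuous_on UNIV g" "\<And>t. \<alpha> \<le> t \<Longrightarrow> t \<le> \<beta> \<Longrightarrow> g t \<ge> 0"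
  shows "pos (fc x g)"
proof -
  \<comment> \<open>The shift by \<open>N\<close> puts the interval inside the domain of controlled
    error already for \<open>n = 0\<close>; the multiple of \<open>e\<close> added in
    \<open>h\<close> compensates that error.\<close>
  obtain N where N: "max \<bar>\<alpha>\<bar> \<bar>\<beta>\<bar> \<le> real N" using real_arch_simple by blast
  define h where "h n = peval x (approx_poly g (n + N)) + inverse (real (Suc (n + N))) *\<^sub>R e" for n
  have "pos (h n)" for n
  proof -
    have "pos (peval x (approx_poly g (n + N) + [:inverse (real (Suc (n + N))):]))"
    proof (rule peval_pos[OF x \<open>\<alpha> \<le> \<beta>\<close>])
      fix t assume t: "\<alpha> \<le> t" "t \<le> \<beta>"
      then have "\<bar>t\<bar> \<le> real (n + N)" using N by auto
      from approx_poly[OF g(1) this] show "0 \<le> poly (approx_poly g (n + N) + [:inverse (real (Suc (n + N))):]) t"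
        using g(2)[OF t] by simp
    qed
    then show ?thesis by (simp add: h_def peval_add)
  qed
  moreover have "h \<longlonglongrightarrow> fc x g + 0 *\<^sub>R e"
    unfolding h_def
    by (intro tendsto_intros LIMSEQ_ignore_initial_segment[OF convergent_approx_poly[OF g(1)]]
        LIMSEQ_ignore_initial_segment[OF LIMSEQ_inverse_real_of_nat])
  ultimately show ?thesis using pos_limit by fastforce
qed

lemma fc_le:
  assumes x: "\<alpha> *\<^sub>R e \<preceq> x" "x \<preceq> \<beta> *\<^sub>R e" and "\<alpha> \<le> \<beta>"
    and "continuous_on UNIV f" "continuous_on UNIV g" "\<And>t. \<alpha> \<le> t \<Longrightarrow> t \<le> \<beta> \<Longrightarrow> f t \<le> g t"
  shows "fc x f \<preceq> fc x g"
  using fc_pos[OF assms(1-3), of "\<lambda>t. g t - f t"] assms(4-)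
  by (auto simp: fc_diff intro!: continuous_intros)

lemma fc_cong:
  assumes x: "\<alpha> *\<^sub>R e \<preceq> x" "x \<preceq> \<beta> *\<^sub>R e" and "\<alpha> \<le> \<beta>"
    and "continuous_on UNIV f" "continuous_on UNIV g" "\<And>t. \<alpha> \<le> t \<Longrightarrow> t \<le> \<beta> \<Longrightarrow> f t = g t"
  shows "fc x f = fc x g"
  using fc_le[OF assms(1-3), of f g] fc_le[OF assms(1-3), of g f] assms(4-)
  by (auto intro!: le_antisym)

lemma pos_interval: "pos x \<Longrightarrow> 0 *\<^sub>R e \<preceq> x" "pos x \<Longrightarrow> x \<preceq> norm x *\<^sub>R e"
  using norm_interval by auto

lemma pos_sqrt:
  assumes "pos x"
  shows "fc x (\<lambda>t. sqrt \<bar>t\<bar>) \<odot> fc x (\<lambda>t. sqrt \<bar>t\<bar>) = x"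
proof -
  have c: "continuous_on UNIV (\<lambda>t::real. sqrt \<bar>t\<bar>)" by (intro continuous_intros)
  have "fc x (\<lambda>t. sqrt \<bar>t\<bar>) \<odot> fc x (\<lambda>t. sqrt \<bar>t\<bar>) = fc x (\<lambda>t. sqrt \<bar>t\<bar> * sqrt \<bar>t\<bar>)"
    using fc_mult[OF c c] by simp
  also have "\<dots> = fc x (\<lambda>t. t)"
    by (rule fc_cong[OF pos_interval[OF assms]]) (auto intro!: continuous_intros)
  finally show ?thesis by (simp add: fc_id)
qed

text \<open>Here the norm description of positivity meets the cone of squares: squares are positive,
  and functional calculus provides square roots of positive elements.\<close>

lemma jb_le_iff: "jb_le (\<odot>) x y \<longleftrightarrow> x \<preceq> y"
  unfolding jb_le_def using pos_sqrt pos_square by (metis (no_types, lifting) imageE rangeI)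

lemma effects_iff: "x \<in> effects (\<odot>) e \<longleftrightarrow> pos x \<and> x \<preceq> e"
  by (simp add: effects_def jb_interval_def jb_le_iff)

lemma square_le_scale:
  assumes "pos x"
  shows "x \<odot> x \<preceq> norm x *\<^sub>R x"
proof -
  have "pos (x \<odot> (norm x *\<^sub>R e - x))"
    using assms norm_interval[of x]
    by (intro pos_prod[of _ x]) (auto intro: gen_diff gen_scale gen_unit gen_self)
  then show ?thesis by (simp add: jdistrib)
qed

end

text \<open>The quadratic curve with coefficients \<open>y\<close>, \<open>2 v\<close>,
  \<open>q\<close> expanded about \<open>t\<close> instead of 0; its derivative there is
  \<open>2 (v + t q)\<close>.\<close>

lemma euler_step_identity:
  fixes y v q :: "'a::real_vector"
  shows "y + ((t - s) *\<^sub>R v + (t - s) *\<^sub>R v) + ((t - s) * (t - s)) *\<^sub>R q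
    = y + (t *\<^sub>R v + t *\<^sub>R v) + (t * t) *\<^sub>R q
      - (s *\<^sub>R (v + t *\<^sub>R q) + s *\<^sub>R (v + t *\<^sub>R q)) + (s * s) *\<^sub>R q"
  by (simp add: algebra_simps) (simp only: mult_2_right distrib_left scaleR_left_distrib)

context jb_unital
begin

subsection \<open>Quadratic operators and inverses\<close>

lemmas vec_simps = jdistrib scaleR_2 algebra_simps

lemma pos_add_unit: "pos x \<Longrightarrow> c \<ge> 0 \<Longrightarrow> pos (x + c *\<^sub>R e)"
  by (intro pos_add pos_unit_scale)

text \<open>If \<open>u \<ge> 0\<close> is not bounded below by a positive multiple of \<open>e\<close>, then neither is \<open>b \<odot> u\<close>,
  because \<open>b \<odot> u \<le> u\<^sup>2/(2s) + s b\<^sup>2/2\<close> for all \<open>s > 0\<close>. Apply this to \<open>u = y + \<mu> e\<close> with the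
  smallest possible \<open>\<mu>\<close>.\<close>

lemma lower_bound_of_jprod:
  assumes \<beta>: "\<beta> > 0" "\<beta> *\<^sub>R e \<preceq> b" and k: "k \<ge> 0" "pos (b \<odot> y + k *\<^sub>R e)"
  shows "pos (y + (k / \<beta>) *\<^sub>R e)"
proof -
  define T where "T = {t. t \<ge> 0 \<and> pos (y + t *\<^sub>R e)}"
  define \<mu> where "\<mu> = Inf T"
  have bdd: "bdd_below T" by (auto simp: T_def)
  have "norm y \<in> T"
    using neg_norm_unit_le[of y "norm y"] by (simp add: T_def add.commute)
  then have ne: "T \<noteq> {}" by blast
  have \<mu>0: "\<mu> \<ge> 0" unfolding \<mu>_def by (rule cInf_greatest[OF ne]) (simp add: T_def)
  have \<mu>: "pos (y + \<mu> *\<^sub>R e)"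
  proof (rule pos_approx[where y = e])
    fix \<delta> :: real assume "\<delta> > 0"
    then obtain t where t: "t \<in> T" "t < \<mu> + \<delta>"
      using cInf_lessD[OF ne, of "\<mu> + \<delta>"] by (auto simp: \<mu>_def)
    then have "pos (y + t *\<^sub>R e)" "0 \<le> \<mu> + \<delta> - t" by (auto simp: T_def)
    then have "pos (y + t *\<^sub>R e + (\<mu> + \<delta> - t) *\<^sub>R e)"
      by (rule pos_add_unit)
    then show "pos (y + \<mu> *\<^sub>R e + \<delta> *\<^sub>R e)" by (simp add: algebra_simps)
  qed
  have "\<mu> \<le> k / \<beta>"
  proof (rule ccontr)
    assume "\<not> \<mu> \<le> k / \<beta>"
    then have gap: "\<mu> * \<beta> - k > 0" using \<beta> by (simp add: field_simps)
    define u where "u = y + \<mu> *\<^sub>R e"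
    \<comment> \<open>\<open>s\<close> is so small that the error
      \<open>s/2 (norm b)\<^sup>2\<close> stays below the gap \<open>\<mu> \<beta> - k\<close>. What
      remains of the gap is \<open>\<eta>\<close>, and \<open>C u\<close> absorbs the term
      \<open>u \<odot> u / (2 s)\<close>.\<close>
    define s where "s = (\<mu> * \<beta> - k) / ((norm b)\<^sup>2 + 1)"
    define C where "C = norm u / (2 * s) + 1"
    define \<eta> where "\<eta> = \<mu> * \<beta> - k - s / 2 * (norm b)\<^sup>2"
    have n: "(norm b)\<^sup>2 + 1 > 0" by (simp add: add_nonneg_pos)
    have s: "s > 0" using gap n by (simp add: s_def)
    then have C: "C > 0" by (simp add: C_def add_nonneg_pos)
    have "s * (norm b)\<^sup>2 \<le> s * ((norm b)\<^sup>2 + 1)" using s by simp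
    also have "\<dots> = \<mu> * \<beta> - k" using n by (simp add: s_def)
    finally have \<eta>: "\<eta> > 0" using gap by (simp add: \<eta>_def)
    have "pos ((1 / (2 * s)) *\<^sub>R ((u - s *\<^sub>R b) \<odot> (u - s *\<^sub>R b)))"
      using s by (intro pos_scale pos_square) auto
    then have 1: "pos ((1 / (2 * s)) *\<^sub>R (u \<odot> u) + (s / 2) *\<^sub>R (b \<odot> b) - b \<odot> u)"
      using s by (simp add: jdistrib scaleR_right_diff_distrib scaleR_right_distrib jprod_commute[of u b]
          scaleR_half_double algebra_simps flip: scaleR_2)
    have 2: "pos ((1 / (2 * s)) *\<^sub>R (norm u *\<^sub>R u - u \<odot> u))"
      using s \<mu> by (intro pos_scale square_le_scale) (auto simp: u_def)
    have 3: "pos ((s / 2) *\<^sub>R ((norm b)\<^sup>2 *\<^sub>R e - b \<odot> b))"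
      using s by (intro pos_scale le_norm_unit) (auto simp: norm_square)
    have 4: "pos (\<mu> *\<^sub>R (b - \<beta> *\<^sub>R e))" using \<beta> \<mu>0 by (intro pos_scale)
    have "C *\<^sub>R u - \<eta> *\<^sub>R e
        = (b \<odot> y + k *\<^sub>R e)
          + ((1 / (2 * s)) *\<^sub>R (u \<odot> u) + (s / 2) *\<^sub>R (b \<odot> b) - b \<odot> u)
          + (1 / (2 * s)) *\<^sub>R (norm u *\<^sub>R u - u \<odot> u)
          + (s / 2) *\<^sub>R ((norm b)\<^sup>2 *\<^sub>R e - b \<odot> b)
          + \<mu> *\<^sub>R (b - \<beta> *\<^sub>R e) + u"
    proof -
      have "b \<odot> u = b \<odot> y + \<mu> *\<^sub>R b" by (simp add: u_def jdistrib)
      then show ?thesis by (simp add: C_def \<eta>_def algebra_simps)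
    qed
    moreover have "pos u" using \<mu> by (simp add: u_def)
    ultimately have "pos (C *\<^sub>R u - \<eta> *\<^sub>R e)"
      using pos_add[OF pos_add[OF pos_add[OF pos_add[OF pos_add[OF k(2) 1] 2] 3] 4]] by simp
    then have "pos (inverse C *\<^sub>R (C *\<^sub>R u - \<eta> *\<^sub>R e))" using C by (intro pos_scale) auto
    moreover have "inverse C *\<^sub>R (C *\<^sub>R u - \<eta> *\<^sub>R e) = u - (\<eta> / C) *\<^sub>R e"
      using C by (simp add: scaleR_right_diff_distrib divide_inverse mult.commute)
    ultimately have "pos (u - (\<eta> / C) *\<^sub>R e)" by (simp only:)
    then have *: "pos (y + (\<mu> - \<eta> / C) *\<^sub>R e)"
      by (simp add: u_def algebra_simps)
    have "\<mu> > 0"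
      using gap \<beta> k \<mu>0 by (metis diff_gt_0_iff_gt less_eq_real_def mult_zero_left not_less)
    \<comment> \<open>\<open>T\<close> contains only non-negative numbers, so the improved bound is
      cut off at 0; as \<open>\<mu> > 0\<close>, it still lies strictly below the infimum.\<close>
    define t where "t = max 0 (\<mu> - \<eta> / C)"
    have "pos (y + (\<mu> - \<eta> / C) *\<^sub>R e + (t - (\<mu> - \<eta> / C)) *\<^sub>R e)"
      by (rule pos_add_unit[OF *]) (auto simp: t_def)
    then have "t \<in> T" by (simp add: T_def t_def algebra_simps)
    then have "\<mu> \<le> t" unfolding \<mu>_def using bdd by (rule cInf_lower)
    moreover have "\<eta> / C > 0" using C \<eta> by simp
    ultimately show False using \<open>\<mu> > 0\<close> by (simp add: t_def)
  qed
  then have "pos (y + \<mu> *\<^sub>R e + (k / \<beta> - \<mu>) *\<^sub>R e)"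
    by (intro pos_add_unit[OF \<mu>]) auto
  then show ?thesis by (simp add: algebra_simps)
qed

lemma norm_le_of_jprod:
  assumes \<beta>: "\<beta> > 0" "\<beta> *\<^sub>R e \<preceq> b"
  shows "norm y \<le> norm (b \<odot> y) / \<beta>"
proof (rule norm_le_of_unit_bounds)
  have "pos (y + (norm (b \<odot> y) / \<beta>) *\<^sub>R e)"
    by (rule lower_bound_of_jprod[OF \<beta>]) (use neg_norm_unit_le[of "b \<odot> y", OF order_refl] in \<open>auto simp: add.commute\<close>)
  then show "pos ((norm (b \<odot> y) / \<beta>) *\<^sub>R e + y)" by (simp add: add.commute)
  have "pos (- y + (norm (b \<odot> y) / \<beta>) *\<^sub>R e)"
    by (rule lower_bound_of_jprod[OF \<beta>]) (use le_norm_unit[of "b \<odot> y", OF order_refl] in \<open>auto simp: jdistrib\<close>)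
  then show "y \<preceq> (norm (b \<odot> y) / \<beta>) *\<^sub>R e" by simp
qed (use \<beta> in auto)

lemma jprod_left_cancel:
  assumes "\<beta> > 0" "\<beta> *\<^sub>R e \<preceq> b" "b \<odot> y = b \<odot> z"
  shows "y = z"
  using norm_le_of_jprod[OF assms(1,2), of "y - z"] assms(3) by (simp add: jdistrib)

definition jinv :: "'a \<Rightarrow> 'a" where
  "jinv b = (THE c. b \<odot> c = e)"

lemma jinv:
  assumes \<beta>: "\<beta> > 0" "\<beta> *\<^sub>R e \<preceq> b"
  shows "b \<odot> jinv b = e" "jinv b \<in> gen b" "pos (jinv b)" "norm (jinv b) \<le> 1 / \<beta>"
proof -
  \<comment> \<open>The reciprocal, frozen below \<open>\<beta>\<close> to be continuous on the
    whole line; on the interval that contains \<open>b\<close> nothing changes.\<close>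
  let ?g = "\<lambda>t. inverse (max \<beta> t)"
  have c: "continuous_on UNIV ?g"
    using \<beta> by (intro continuous_intros) (auto simp: max_def)
  have "b \<preceq> max \<beta> (norm b) *\<^sub>R e" by (rule le_norm_unit) simp
  note i = \<beta>(2) this
  have "b \<odot> fc b ?g = fc b (\<lambda>t. t * ?g t)"
    using fc_mult[of "\<lambda>t. t" ?g b] c by (simp add: fc_id)
  also have "\<dots> = fc b (\<lambda>t. 1)"
    by (rule fc_cong[OF i]) (use \<beta> c in \<open>auto intro!: continuous_intros\<close>)
  finally have *: "b \<odot> fc b ?g = e" by (simp add: fc_const)
  have "jinv b = fc b ?g"
    unfolding jinv_def by (rule the_equality, rule *) (use jprod_left_cancel[OF \<beta>] * in metis)
  moreover have "pos (fc b ?g)"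
    by (rule fc_pos[OF i _ c]) (use \<beta> in auto)
  ultimately show "b \<odot> jinv b = e" "jinv b \<in> gen b" "pos (jinv b)"
    using * fc_gen[OF c] by auto
  then show "norm (jinv b) \<le> 1 / \<beta>"
    using norm_le_of_jprod[OF \<beta>, of "jinv b"] norm_unit_le \<beta>
    by (simp add: field_simps)
qed

text \<open>The quadratic operator \<open>U x y = 2 x (x y) - x\<^sup>2 y\<close>; in an associative
  algebra with the symmetrized product it is \<open>x y x\<close>.\<close>

definition quad :: "'a \<Rightarrow> 'a \<Rightarrow> 'a" where
  "quad x y = x \<odot> (x \<odot> y) + x \<odot> (x \<odot> y) - (x \<odot> x) \<odot> y"

lemma quad_add_right: "quad x (y + z) = quad x y + quad x z"
  and quad_diff_right: "quad x (y - z) = quad x y - quad x z"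
  and quad_scale_right: "quad x (c *\<^sub>R y) = c *\<^sub>R quad x y"
  and quad_unit_right: "quad x e = x \<odot> x"
  by (simp_all add: quad_def vec_simps)

lemma quad_unit_add: "quad (e + t *\<^sub>R b) y = y + (t *\<^sub>R (b \<odot> y) + t *\<^sub>R (b \<odot> y)) + (t * t) *\<^sub>R quad b y"
  by (simp add: quad_def vec_simps)

lemma norm_quad_le: "norm (quad x y) \<le> 3 * ((norm x)\<^sup>2 * norm y)"
proof -
  have "norm (x \<odot> (x \<odot> y)) \<le> norm x * (norm x * norm y)"
    by (rule order_trans[OF norm_jprod_le]) (simp add: mult_left_mono norm_jprod_le)
  moreover have "norm ((x \<odot> x) \<odot> y) \<le> (norm x)\<^sup>2 * norm y"
    using norm_jprod_le[of "x \<odot> x" y] by (simp add: norm_square)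
  moreover have "norm (quad x y) \<le> norm (x \<odot> (x \<odot> y)) + norm (x \<odot> (x \<odot> y)) + norm ((x \<odot> x) \<odot> y)"
    unfolding quad_def by (intro order_trans[OF norm_triangle_ineq4] add_mono norm_triangle_ineq order_refl)
  ultimately show ?thesis by (simp add: power2_eq_square)
qed

text \<open>Multiplications by elements of one \<open>gen g\<close> commute, which collapses
  \<open>jordan_operator\<close>. The formula is meant for pairs with a simple product
  \<open>a \<odot> x\<close>, namely \<open>a = b \<odot> jinv x\<close> and
  \<open>x = jinv a\<close>; it then yields the derivatives of the quadratic operator and of
  inversion.\<close>

lemma jprod_quad:
  assumes "a \<in> gen g" "x \<in> gen g"
  shows "a \<odot> quad x w = (a \<odot> x) \<odot> (x \<odot> w) + (a \<odot> x) \<odot> (x \<odot> w) - ((a \<odot> x) \<odot> x) \<odot> w"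
proof -
  have "a \<odot> (x \<odot> x) = (a \<odot> x) \<odot> x"
    using gen_assoc[OF assms(1,2,2)] by simp
  moreover have "(x \<odot> x) \<odot> (a \<odot> w) = a \<odot> ((x \<odot> x) \<odot> w)"
    using assms by (intro gen_commute[of _ g] gen_prod)
  moreover have "x \<odot> (a \<odot> (x \<odot> w)) = a \<odot> (x \<odot> (x \<odot> w))"
    using assms by (intro gen_commute[of _ g])
  ultimately show ?thesis
    using jordan_operator[of a x x w]
    by (simp add: quad_def jdistrib jprod_commute[of x a] scaleR_2 algebra_simps)
qed

text \<open>The curve \<open>t \<mapsto> quad (e + t b) y\<close> solves \<open>Y' = 2 a \<odot> Y\<close> with \<open>a = b \<odot> (e + t b)\<^sup>-\<^sup>1\<close>, and
  \<open>lower_bound_of_jprod\<close> shows that the implicit Euler steps for this equation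
  almost preserve positivity.\<close>

lemma quad_pos_strict:
  assumes c: "\<gamma> > 0" "\<gamma> *\<^sub>R e \<preceq> c" and y: "pos y"
  shows "pos (quad c y)"
proof -
  define b where "b = c - e"
  define X where "X t = e + t *\<^sub>R b" for t
  \<comment> \<open>Both \<open>e\<close> and \<open>c\<close> are at least
    \<open>\<gamma>' e\<close>, hence so is every point of the segment \<open>X\<close> between
    them.\<close>
  define \<gamma>' where "\<gamma>' = min 1 \<gamma>"
  define A where "A = norm b / \<gamma>'"
  define K where "K = norm (quad b y)"
  define Y where "Y t = quad (X t) y" for t
  have \<gamma>': "\<gamma>' > 0" using c by (simp add: \<gamma>'_def)
  have Y: "Y t = y + (t *\<^sub>R (b \<odot> y) + t *\<^sub>R (b \<odot> y)) + (t * t) *\<^sub>R quad b y" for t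
    by (simp add: Y_def X_def quad_unit_add)
  have bc: "b \<in> gen c" by (simp add: b_def gen_diff gen_self gen_unit)
  have Xc: "X t \<in> gen c" for t by (simp add: X_def gen_add gen_scale gen_unit bc)
  have Xpos: "\<gamma>' *\<^sub>R e \<preceq> X t" if t: "0 \<le> t" "t \<le> 1" for t
  proof -
    have "X t - \<gamma>' *\<^sub>R e = t *\<^sub>R (c - \<gamma> *\<^sub>R e) + (1 - t + t * \<gamma> - \<gamma>') *\<^sub>R e"
      by (simp add: X_def b_def algebra_simps)
    moreover have "1 - t + t * \<gamma> - \<gamma>' \<ge> 0"
    proof -
      have "\<gamma>' = (1 - t) * \<gamma>' + t * \<gamma>'" by (simp add: algebra_simps)
      also have "\<dots> \<le> (1 - t) * 1 + t * \<gamma>"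
        using t by (intro add_mono mult_left_mono) (auto simp: \<gamma>'_def)
      finally show ?thesis by simp
    qed
    ultimately show ?thesis using c t by (auto intro!: pos_add pos_scale)
  qed
  define a where "a t = b \<odot> jinv (X t)" for t
  have aA: "norm (a t) \<le> A" if "0 \<le> t" "t \<le> 1" for t
  proof -
    have "norm (a t) \<le> norm b * norm (jinv (X t))" unfolding a_def by (rule norm_jprod_le)
    also have "\<dots> \<le> norm b * (1 / \<gamma>')"
      using jinv(4)[OF \<gamma>' Xpos[OF that]] by (intro mult_left_mono) auto
    finally show ?thesis by (simp add: A_def)
  qed
  \<comment> \<open>The expansion is about the end point \<open>t\<close>, which makes the step
    implicit: \<open>Y t\<close> is multiplied by an element close to \<open>e\<close>, so
    \<open>lower_bound_of_jprod\<close> carries a lower bound of \<open>Y (t - s)\<close> over to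
    \<open>Y t\<close>.\<close>
  have step: "Y (t - s) = (e - (2 * s) *\<^sub>R a t) \<odot> Y t + (s * s) *\<^sub>R quad b y"
    if t: "0 \<le> t" "t \<le> 1" for s t
  proof -
    have jc: "jinv (X t) \<in> gen c"
      using jinv(2)[OF \<gamma>' Xpos[OF t]] Xc gen_mono by blast
    then have ac: "a t \<in> gen c" by (simp add: a_def gen_prod bc)
    have "a t \<odot> X t = b \<odot> (X t \<odot> jinv (X t))"
      unfolding a_def using gen_assoc[OF bc jc Xc] by (simp add: jprod_commute)
    then have "a t \<odot> X t = b" using jinv(1)[OF \<gamma>' Xpos[OF t]] by simp
    then have "a t \<odot> Y t = b \<odot> (X t \<odot> y) + b \<odot> (X t \<odot> y) - (b \<odot> X t) \<odot> y"
      unfolding Y_def using jprod_quad[OF ac Xc] by simp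
    also have "\<dots> = b \<odot> y + t *\<^sub>R quad b y"
      by (simp add: X_def quad_def vec_simps)
    finally have aY: "a t \<odot> Y t = b \<odot> y + t *\<^sub>R quad b y" .
    have two: "(2 * s) *\<^sub>R z = s *\<^sub>R z + s *\<^sub>R z" for z :: 'a
      by (simp only: mult_2 scaleR_left_distrib)
    have eq: "(e - (2 * s) *\<^sub>R a t) \<odot> Y t = Y t - (s *\<^sub>R (b \<odot> y + t *\<^sub>R quad b y) + s *\<^sub>R (b \<odot> y + t *\<^sub>R quad b y))"
      by (simp only: jdistrib unit_left two aY)
    show ?thesis unfolding eq by (subst (1 2) Y) (rule euler_step_identity)
  qed
  have main: "pos (Y 1 + (K / real n / (1 - 2 * A / real n) ^ n) *\<^sub>R e)"
    if n: "real n > 4 * A" "n > 0" for n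
  proof -
    define s where "s = 1 / real n"
    define \<rho> where "\<rho> = 1 - 2 * A / real n"
    have A0: "A \<ge> 0" using \<gamma>' by (simp add: A_def)
    have \<rho>: "\<rho> > 0" "\<rho> \<le> 1" using n A0 by (auto simp: \<rho>_def field_simps)
    \<comment> \<open>Each step adds the quadratic error \<open>s\<^sup>2 K\<close> and divides by
      \<open>\<rho>\<close>. After \<open>n\<close> steps the total is
      \<open>K / n / \<rho>^n\<close>, where \<open>\<rho>^n\<close> tends to
      \<open>exp (- 2 A)\<close>, so it vanishes in the limit.\<close>
    have ind: "pos (Y (real j * s) + (real j * (s * s * K) / \<rho> ^ j) *\<^sub>R e)" if "j \<le> n" for j
      using that
    proof (induction j)
      case 0 then show ?case using y by (simp add: Y)
    next
      case (Suc j)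
      define t where "t = real (Suc j) * s"
      define \<kappa> where "\<kappa> = real j * (s * s * K) / \<rho> ^ j"
      have t: "0 \<le> t" "t \<le> 1" using Suc n by (auto simp: t_def s_def field_simps)
      have K0: "s * s * K \<ge> 0" by (simp add: K_def)
      then have \<kappa>0: "\<kappa> \<ge> 0" using \<rho> by (simp add: \<kappa>_def)
      have "norm ((2 * s) *\<^sub>R a t) \<le> 2 * A / real n"
        using aA[OF t] n by (simp add: s_def field_simps)
      then have "pos ((2 * A / real n) *\<^sub>R e - (2 * s) *\<^sub>R a t)" by (rule le_norm_unit)
      then have 1: "\<rho> *\<^sub>R e \<preceq> e - (2 * s) *\<^sub>R a t"
        by (simp add: \<rho>_def algebra_simps)
      have "pos (Y (t - s) + \<kappa> *\<^sub>R e)"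
        using Suc by (simp add: t_def \<kappa>_def algebra_simps)
      moreover have "pos ((s * s) *\<^sub>R (K *\<^sub>R e - quad b y))"
        by (intro pos_scale le_norm_unit) (auto simp: K_def)
      ultimately have "pos (Y (t - s) + \<kappa> *\<^sub>R e + (s * s) *\<^sub>R (K *\<^sub>R e - quad b y))"
        by (rule pos_add)
      then have "pos ((e - (2 * s) *\<^sub>R a t) \<odot> Y t + (\<kappa> + s * s * K) *\<^sub>R e)"
        unfolding step[OF t] by (simp add: algebra_simps)
      then have 2: "pos (Y t + ((\<kappa> + s * s * K) / \<rho>) *\<^sub>R e)"
        using \<kappa>0 K0 by (intro lower_bound_of_jprod[OF \<rho>(1) 1]) auto
      have "s * s * K * \<rho> ^ j \<le> s * s * K * 1"
        using K0 \<rho> by (intro mult_left_mono power_le_one) auto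
      then have "s * s * K \<le> s * s * K / \<rho> ^ j" using \<rho> by (simp add: field_simps)
      then have "(\<kappa> + s * s * K) / \<rho> \<le> (\<kappa> + s * s * K / \<rho> ^ j) / \<rho>"
        using \<rho> by (intro divide_right_mono) auto
      also have "\<dots> = real (Suc j) * (s * s * K) / \<rho> ^ Suc j"
        using \<rho> by (simp add: \<kappa>_def field_simps)
      finally have "0 \<le> real (Suc j) * (s * s * K) / \<rho> ^ Suc j - (\<kappa> + s * s * K) / \<rho>"
        by simp
      from pos_add_unit[OF 2 this] show ?case
        by (simp add: t_def scaleR_left_diff_distrib)
    qed
    have "real n * s = 1" "real n * (s * s * K) = K / real n" using n by (auto simp: s_def)
    then show ?thesis using ind[of n] by (simp add: \<rho>_def)
  qed
  have "(\<lambda>n. K / real n / (1 + (- 2 * A) / real n) ^ n) \<longlonglongrightarrow> 0 / exp (- 2 * A)"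
    by (intro tendsto_divide tendsto_exp_limit_sequentially lim_const_over_n) auto
  then have "(\<lambda>n. Y 1 + (K / real n / (1 - 2 * A / real n) ^ n) *\<^sub>R e) \<longlonglongrightarrow> Y 1 + 0 *\<^sub>R e"
    by (intro tendsto_intros) simp
  then have lim: "(\<lambda>n. Y 1 + (K / real n / (1 - 2 * A / real n) ^ n) *\<^sub>R e) \<longlonglongrightarrow> Y 1" by simp
  obtain N where N: "real N > 4 * A" using reals_Archimedean2 by blast
  have "pos (Y 1)"
    by (rule pos_limit[OF LIMSEQ_ignore_initial_segment[OF lim, of "Suc N"]]) (rule main, use N in auto)
  then show ?thesis by (simp add: Y_def X_def b_def)
qed

lemma quad_pos:
  assumes "pos c" "pos y"
  shows "pos (quad c y)"
proof (rule pos_limit)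
  let ?\<delta> = "\<lambda>n. inverse (real (Suc n))"
  show "(\<lambda>n. quad (c + ?\<delta> n *\<^sub>R e) y) \<longlonglongrightarrow> quad c y"
  proof -
    have "(\<lambda>n. quad (c + ?\<delta> n *\<^sub>R e) y) \<longlonglongrightarrow> quad (c + 0 *\<^sub>R e) y"
      unfolding quad_def by (intro tendsto_intros LIMSEQ_inverse_real_of_nat)
    then show ?thesis by simp
  qed
  show "pos (quad (c + ?\<delta> n *\<^sub>R e) y)" for n
    by (rule quad_pos_strict[of "?\<delta> n"]) (use assms in auto)
qed

lemma quad_mono: "pos c \<Longrightarrow> x \<preceq> y \<Longrightarrow> quad c x \<preceq> quad c y"
  using quad_pos[of c "y - x"] by (simp add: quad_diff_right)

text \<open>The derivative of the inverse along \<open>X t = a + t h\<close> is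
  \<open>- quad (jinv (X t)) h\<close>, which is negative for \<open>h \<ge> 0\<close>. A step of
  length \<open>s\<close> costs an error of order \<open>s\<^sup>2\<close>, so the total over all
  steps is of order \<open>s\<close>.\<close>

lemma jinv_antimono:
  assumes a: "\<gamma> > 0" "\<gamma> *\<^sub>R e \<preceq> a" and ab: "a \<preceq> b"
  shows "jinv b \<preceq> jinv a"
proof -
  define h where "h = b - a"
  define X where "X t = a + t *\<^sub>R h" for t
  have Xpos: "\<gamma> *\<^sub>R e \<preceq> X t" if "t \<ge> 0" for t
  proof -
    have "pos (a - \<gamma> *\<^sub>R e + t *\<^sub>R h)" using a ab that by (intro pos_add pos_scale) (auto simp: h_def)
    then show ?thesis by (simp add: X_def algebra_simps)
  qed
  \<comment> \<open>The factor 3 comes from \<open>norm_quad_le\<close>. Of the three powers of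
    \<open>1 / \<gamma>\<close>, two bound \<open>jinv (X t)\<close> inside \<open>quad\<close> and
    one comes from cancelling \<open>X (t + s)\<close>.\<close>
  define K where "K = 3 * (norm h)\<^sup>2 / \<gamma> ^ 3"
  have step: "jinv (X (t + s)) \<preceq> jinv (X t) + (s * s * K) *\<^sub>R e" if ts: "t \<ge> 0" "s \<ge> 0" for t s
  proof -
    define c where "c = jinv (X t)"
    note J = jinv[OF a(1) Xpos[OF ts(1)], folded c_def]
    have J': "X (t + s) \<odot> jinv (X (t + s)) = e"
      using ts by (intro jinv[OF a(1) Xpos]) simp
    have q: "X t \<odot> quad c h = c \<odot> h"
      using jprod_quad[OF gen_self J(2)] J(1) by (simp add: scaleR_2)
    have "X (t + s) \<odot> (jinv (X (t + s)) - c + s *\<^sub>R quad c h)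
        = X (t + s) \<odot> jinv (X (t + s)) - (X t + s *\<^sub>R h) \<odot> c + s *\<^sub>R ((X t + s *\<^sub>R h) \<odot> quad c h)"
      by (simp add: X_def jdistrib algebra_simps)
    also have "\<dots> = (s * s) *\<^sub>R (h \<odot> quad c h)"
      using J(1) q J' by (simp add: jdistrib jprod_commute[of h c] algebra_simps)
    finally have eq: "norm (X (t + s) \<odot> (jinv (X (t + s)) - c + s *\<^sub>R quad c h)) = s * s * norm (h \<odot> quad c h)"
      by simp
    have "norm (h \<odot> quad c h) \<le> norm h * (3 * ((norm c)\<^sup>2 * norm h))"
      by (rule order_trans[OF norm_jprod_le mult_left_mono[OF norm_quad_le norm_ge_zero]])
    also have "\<dots> \<le> norm h * (3 * ((1 / \<gamma>)\<^sup>2 * norm h))"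
      using J(4) by (intro mult_left_mono mult_right_mono power_mono) auto
    finally have "norm (X (t + s) \<odot> (jinv (X (t + s)) - c + s *\<^sub>R quad c h))
        \<le> s * s * (norm h * (3 * ((1 / \<gamma>)\<^sup>2 * norm h)))"
      unfolding eq by (rule mult_left_mono) simp
    then have "norm (X (t + s) \<odot> (jinv (X (t + s)) - c + s *\<^sub>R quad c h)) / \<gamma>
        \<le> s * s * (norm h * (3 * ((1 / \<gamma>)\<^sup>2 * norm h))) / \<gamma>"
      using a(1) by (intro divide_right_mono) auto
    moreover have "norm (jinv (X (t + s)) - c + s *\<^sub>R quad c h)
        \<le> norm (X (t + s) \<odot> (jinv (X (t + s)) - c + s *\<^sub>R quad c h)) / \<gamma>"
      using ts by (intro norm_le_of_jprod a(1) Xpos) auto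
    ultimately have "norm (jinv (X (t + s)) - c + s *\<^sub>R quad c h)
        \<le> s * s * (norm h * (3 * ((1 / \<gamma>)\<^sup>2 * norm h))) / \<gamma>" by linarith
    also have "\<dots> = s * s * K"
      by (simp add: K_def power2_eq_square power3_eq_cube)
    finally have "pos ((s * s * K) *\<^sub>R e - (jinv (X (t + s)) - c + s *\<^sub>R quad c h))"
      by (rule le_norm_unit)
    moreover have "pos (s *\<^sub>R quad c h)"
      using ts ab J by (intro pos_scale quad_pos) (auto simp: h_def)
    ultimately have "pos ((s * s * K) *\<^sub>R e - (jinv (X (t + s)) - c + s *\<^sub>R quad c h) + s *\<^sub>R quad c h)"
      by (rule pos_add)
    then show ?thesis by (simp add: c_def algebra_simps)
  qed
  have bound: "pos (jinv (X 0) + (inverse (real (Suc n)) * K) *\<^sub>R e - jinv (X 1))" for n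
  proof -
    define s where "s = inverse (real (Suc n))"
    have "pos (jinv (X 0) + (real j * (s * s * K)) *\<^sub>R e - jinv (X (real j * s)))" for j
    proof (induction j)
      case (Suc j)
      have "pos (jinv (X (real j * s)) + (s * s * K) *\<^sub>R e - jinv (X (real j * s + s)))"
        by (rule step) (auto simp: s_def)
      from pos_add[OF Suc this] show ?case by (simp add: algebra_simps)
    qed simp
    note ind = this
    have 1: "real (Suc n) * s = 1" by (simp add: s_def del: of_nat_Suc)
    have "real (Suc n) * (s * s * K) = (real (Suc n) * s) * (s * K)" by (simp only: ac_simps)
    then have "real (Suc n) * (s * s * K) = s * K" unfolding 1 by simp
    then show ?thesis using ind[of "Suc n"] 1 by (simp only: s_def)
  qed
  have "(\<lambda>n. jinv (X 0) + (inverse (real (Suc n)) * K) *\<^sub>R e - jinv (X 1))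
      \<longlonglongrightarrow> jinv (X 0) + (0 * K) *\<^sub>R e - jinv (X 1)"
    by (intro tendsto_intros LIMSEQ_inverse_real_of_nat)
  then have "pos (jinv (X 0) + (0 * K) *\<^sub>R e - jinv (X 1))"
    by (rule pos_limit) (rule bound)
  then show ?thesis by (simp add: X_def h_def)
qed

end

lemma scaleR_3: "3 *\<^sub>R z = z + z + (z :: 'a :: real_vector)"
  and scaleR_4: "4 *\<^sub>R z = z + z + (z + (z :: 'a :: real_vector))"
proof -
  have "3 *\<^sub>R z = (1 + 1 + 1) *\<^sub>R z" "4 *\<^sub>R z = (1 + 1 + (1 + 1)) *\<^sub>R z" by simp_all
  then show "3 *\<^sub>R z = z + z + z" "4 *\<^sub>R z = z + z + (z + z)"
    by (simp_all only: scaleR_left_distrib scaleR_one)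
qed

lemma scaleR_half_sum: "(1 / 2) *\<^sub>R z + (1 / 2) *\<^sub>R z = (z :: 'a :: real_vector)"
  by (simp flip: scaleR_left_distrib)

context jb_unital
begin

subsection \<open>Moebius transformations of the unit interval\<close>

text \<open>The scalar function is \<open>(1 - k) t / (1 - k t)\<close>, an increasing bijection of
  the unit interval. In implicit form its uniqueness is a cancellation.\<close>

definition moebius :: "real \<Rightarrow> 'a \<Rightarrow> 'a" where
  "moebius k x = (THE y. (e - k *\<^sub>R x) \<odot> y = (1 - k) *\<^sub>R x)"

context
  fixes k :: real
  assumes k: "0 < k" "k < 1"
begin

lemma moebius_denominator:
  assumes "x \<preceq> e"
  shows "(1 - k) *\<^sub>R e \<preceq> e - k *\<^sub>R x"
proof -
  have "pos (k *\<^sub>R (e - x))" using assms k by (intro pos_scale) auto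
  then show ?thesis by (simp add: algebra_simps)
qed

lemma moebius_unique:
  assumes "x \<preceq> e" "(e - k *\<^sub>R x) \<odot> y = (1 - k) *\<^sub>R x"
  shows "moebius k x = y"
  unfolding moebius_def
proof (rule the_equality[where P = "\<lambda>y. (e - k *\<^sub>R x) \<odot> y = (1 - k) *\<^sub>R x"])
  show "y' = y" if "(e - k *\<^sub>R x) \<odot> y' = (1 - k) *\<^sub>R x" for y'
    by (rule jprod_left_cancel[OF _ moebius_denominator[OF assms(1)]]) (use k that assms in auto)
qed (rule assms)

text \<open>Partial fractions leave a single inverse as the only nonlinear ingredient, so
  monotonicity reduces to \<open>jinv_antimono\<close>.\<close>

lemma moebius_formula:
  assumes "x \<preceq> e"
  shows "moebius k x = ((1 - k) / k) *\<^sub>R (jinv (e - k *\<^sub>R x) - e)"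
proof (rule moebius_unique[OF assms])
  have *: "(e - k *\<^sub>R x) \<odot> jinv (e - k *\<^sub>R x) = e"
    using k by (intro jinv[OF _ moebius_denominator[OF assms]]) auto
  have "(e - k *\<^sub>R x) \<odot> (((1 - k) / k) *\<^sub>R (jinv (e - k *\<^sub>R x) - e)) = ((1 - k) / k) *\<^sub>R (k *\<^sub>R x)"
    unfolding jscale_right jdiff_right * by simp
  then show "(e - k *\<^sub>R x) \<odot> (((1 - k) / k) *\<^sub>R (jinv (e - k *\<^sub>R x) - e)) = (1 - k) *\<^sub>R x"
    using k by simp
qed

lemma moebius_eq: "x \<preceq> e \<Longrightarrow> (e - k *\<^sub>R x) \<odot> moebius k x = (1 - k) *\<^sub>R x"
proof -
  assume x: "x \<preceq> e"
  have *: "(e - k *\<^sub>R x) \<odot> jinv (e - k *\<^sub>R x) = e"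
    using k by (intro jinv[OF _ moebius_denominator[OF x]]) auto
  show ?thesis
    unfolding moebius_formula[OF x] jscale_right jdiff_right * using k by simp
qed

lemma moebius_mono:
  assumes "x \<preceq> y" "y \<preceq> e"
  shows "moebius k x \<preceq> moebius k y"
proof -
  have x: "x \<preceq> e" using assms le_trans by blast
  have "pos (k *\<^sub>R (y - x))" using assms k by (intro pos_scale) auto
  then have "pos ((e - k *\<^sub>R x) - (e - k *\<^sub>R y))" by (simp add: algebra_simps)
  then have "jinv (e - k *\<^sub>R x) \<preceq> jinv (e - k *\<^sub>R y)"
    using k assms by (intro jinv_antimono[OF _ moebius_denominator]) auto
  then have "pos (((1 - k) / k) *\<^sub>R (jinv (e - k *\<^sub>R y) - jinv (e - k *\<^sub>R x)))"
    using k by (intro pos_scale) auto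
  then show ?thesis
    by (simp add: moebius_formula x assms flip: scaleR_right_diff_distrib)
qed

lemma moebius_projection: "p \<odot> p = p \<Longrightarrow> p \<preceq> e \<Longrightarrow> moebius k p = p"
  by (rule moebius_unique) (simp_all add: jdistrib scaleR_left_diff_distrib)

lemma moebius_effect:
  assumes "pos x" "x \<preceq> e"
  shows "pos (moebius k x)" "moebius k x \<preceq> e"
  using moebius_mono[where x = 0 and y = x] moebius_mono[where x = x and y = e]
    moebius_projection[of 0] moebius_projection[of e] assms
  by auto

text \<open>The equation defining \<open>y = moebius k x\<close> is symmetric under \<open>(x, y) \<mapsto> (e - y, e - x)\<close>.\<close>

lemma moebius_dual:
  assumes "pos y" "y \<preceq> e"
  shows "moebius k (e - moebius k (e - y)) = y"
proof (rule moebius_unique)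
  define z where "z = moebius k (e - y)"
  have z: "pos z" "z \<preceq> e" unfolding z_def using assms by (auto intro: moebius_effect)
  then show "e - moebius k (e - y) \<preceq> e" by (simp add: z_def)
  have "(e - k *\<^sub>R (e - y)) \<odot> z = (1 - k) *\<^sub>R (e - y)"
    unfolding z_def using assms by (intro moebius_eq) auto
  then show "(e - k *\<^sub>R (e - moebius k (e - y))) \<odot> y = (1 - k) *\<^sub>R (e - moebius k (e - y))"
    unfolding z_def[symmetric] by (simp add: jprod_commute[of z y] vec_simps)
qed

end

subsection \<open>Peirce decomposition\<close>

abbreviation projection :: "'a \<Rightarrow> bool" where
  "projection p \<equiv> p \<odot> p = p"

lemma projection_pos: "projection p \<Longrightarrow> pos p"
  using pos_square[of p] by simp

lemma projection_compl: "projection p \<Longrightarrow> projection (e - p)"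
  by (simp add: jdistrib)

lemma projection_le_unit: "projection p \<Longrightarrow> p \<preceq> e"
  using projection_pos[OF projection_compl] .

lemma norm_projection_le: "projection p \<Longrightarrow> norm p \<le> 1"
  by (intro norm_le_one_of_effect projection_pos projection_le_unit)

lemma norm_projection: "projection p \<Longrightarrow> p \<noteq> 0 \<Longrightarrow> norm p = 1"
  using norm_square[of p] by (simp add: power2_eq_square)

lemma projection_diff:
  assumes "projection p" "projection s" "p \<odot> s = s"
  shows "projection (p - s)" "s \<preceq> p"
proof -
  show "projection (p - s)" using assms by (simp add: jdistrib jprod_commute[of s p])
  then show "s \<preceq> p" by (rule projection_pos)
qed

lemma projection_add:
  assumes "projection p" "projection s" "p \<odot> s = 0"
  shows "projection (p + s)"
  using assms by (simp add: jdistrib jprod_commute[of s p])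

text \<open>Multiplication \<open>L\<close> by an idempotent satisfies
  \<open>2 L\<^sup>3 - 3 L\<^sup>2 + L = 0\<close>, so its eigenvalues are among 0, 1/2 and
  1.\<close>

lemma jordan_operator_same: "p \<odot> p = p \<Longrightarrow>
  p \<odot> (p \<odot> (p \<odot> w)) + p \<odot> (p \<odot> (p \<odot> w)) + p \<odot> w = p \<odot> (p \<odot> w) + p \<odot> (p \<odot> w) + p \<odot> (p \<odot> w)"
  using jordan_operator[of p p p w] by (simp add: algebra_simps)

context
  fixes p :: 'a
  assumes p: "p \<odot> p = p"
begin

text \<open>At the idempotent, \<open>jordan_commutator\<close> reads
  \<open>a (p w) + 2 p (a w) = p (a w) + 2 a (p w)\<close>.\<close>

lemma jprod_commute_one:
  assumes "p \<odot> a = a"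
  shows "p \<odot> (a \<odot> w) = a \<odot> (p \<odot> w)"
  using jordan_commutator[of a p w] assms p by (simp add: scaleR_2)

lemma jprod_commute_zero:
  assumes "p \<odot> a = 0"
  shows "p \<odot> (a \<odot> w) = a \<odot> (p \<odot> w)"
  using jordan_commutator[of a p w] assms p by (simp add: scaleR_2)

lemma one_prod_zero:
  assumes "p \<odot> a = a" "p \<odot> b = 0"
  shows "a \<odot> b = 0"
  using jprod_commute_one[OF assms(1), of b] jprod_commute_zero[OF assms(2), of a] assms
  by (simp add: jprod_commute[of b a])

lemma half_prod_half:
  assumes "p \<odot> u = (1 / 2) *\<^sub>R u" "p \<odot> v = (1 / 2) *\<^sub>R v"
  shows "p \<odot> (p \<odot> (u \<odot> v)) = p \<odot> (u \<odot> v)"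
proof -
  have "p \<odot> (p \<odot> (u \<odot> v)) + ((1 / 2) *\<^sub>R (1 / 2) *\<^sub>R (u \<odot> v) + (1 / 2) *\<^sub>R (1 / 2) *\<^sub>R (u \<odot> v))
      = p \<odot> (u \<odot> v) + ((1 / 2) *\<^sub>R (1 / 2) *\<^sub>R (u \<odot> v) + (1 / 2) *\<^sub>R (1 / 2) *\<^sub>R (u \<odot> v))"
    using jordan_linearized[of p u v p] assms p
    by (simp add: jdistrib jprod_commute[of u p] jprod_commute[of v p] jprod_commute[of v u]
        jprod_commute[of "u \<odot> v" p] algebra_simps)
  then show ?thesis by simp
qed

text \<open>An instance of \<open>jordan_operator\<close> in which the unknown occurs on both sides;
  collected, it says \<open>3 ?a = (3/2) ?c\<close>.\<close>

lemma half_cube: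
  assumes "p \<odot> v = (1 / 2) *\<^sub>R v"
  shows "v \<odot> (p \<odot> (v \<odot> v)) = (1 / 2) *\<^sub>R (v \<odot> (v \<odot> v))"
proof -
  let ?a = "v \<odot> (p \<odot> (v \<odot> v))" and ?c = "v \<odot> (v \<odot> v)"
  have "?a = (1 / 2) *\<^sub>R ?c + (1 / 2) *\<^sub>R ?c + (1 / 2) *\<^sub>R ?c - ?a - ?a"
    using jordan_operator[of p v v v] assms
    by (simp add: jdistrib jprod_commute[of v p] jprod_commute[of "v \<odot> v" v]
        jprod_commute[of "p \<odot> (v \<odot> v)" v])
  then have "?a + ?a + ?a = (1 / 2) *\<^sub>R ?c + (1 / 2) *\<^sub>R ?c + (1 / 2) *\<^sub>R ?c"
    by (simp add: algebra_simps)
  then have "3 *\<^sub>R ?a = 3 *\<^sub>R ((1 / 2) *\<^sub>R ?c)"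
    by (simp only: scaleR_3)
  then show ?thesis by (rule scaleR_left_imp_eq[rotated]) simp
qed

lemma half_eq_zero:
  assumes "p \<odot> v = (1 / 2) *\<^sub>R v" "p \<odot> (v \<odot> v) = 0"
  shows "v = 0"
proof -
  have "v \<odot> (v \<odot> v) = 0" using half_cube[OF assms(1)] assms(2) by simp
  moreover have "(v \<odot> v) \<odot> (v \<odot> v) = v \<odot> (v \<odot> (v \<odot> v))"
    by (rule gen_assoc[of _ v]) (auto intro: gen_self gen_prod)
  ultimately have "norm ((v \<odot> v) \<odot> (v \<odot> v)) = 0" by simp
  then show ?thesis by (simp add: norm_square)
qed

lemma quad_one: "p \<odot> x = x \<Longrightarrow> quad p x = x"
  and quad_zero: "p \<odot> x = 0 \<Longrightarrow> quad p x = 0"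
  and quad_half: "p \<odot> x = (1 / 2) *\<^sub>R x \<Longrightarrow> quad p x = 0"
  using p by (simp_all add: quad_def jdistrib) (simp flip: scaleR_left_distrib)

lemma jprod_quad_projection: "p \<odot> quad p x = quad p x"
  using jordan_operator_same[OF p, of x] p by (simp add: quad_def jdistrib algebra_simps)

lemma quad_of_even: "p \<odot> (p \<odot> x) = p \<odot> x \<Longrightarrow> quad p x = p \<odot> x"
  using p by (simp add: quad_def)

text \<open>The Peirce component for the eigenvalue 1/2: \<open>4 L (1 - L)\<close> equals 1 at 1/2
  and 0 at 0 and 1.\<close>

definition half :: "'a \<Rightarrow> 'a" where
  "half x = 4 *\<^sub>R (p \<odot> x - p \<odot> (p \<odot> x))"

lemma jprod_half: "p \<odot> half x = (1 / 2) *\<^sub>R half x"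
  and even_minus_half: "p \<odot> (p \<odot> (x - half x)) = p \<odot> (x - half x)"
proof -
  define d where "d = p \<odot> x - p \<odot> (p \<odot> x)"
  have "p \<odot> d + p \<odot> d = d"
    using jordan_operator_same[OF p, of x] by (simp add: d_def jdistrib algebra_simps)
  then have d: "2 *\<^sub>R (p \<odot> d) = d" by (simp add: scaleR_2)
  have "(1 / 2) *\<^sub>R 2 *\<^sub>R (p \<odot> d) = (1 / 2) *\<^sub>R d" unfolding d ..
  then have pd: "p \<odot> d = (1 / 2) *\<^sub>R d" by simp
  have h: "half x = 4 *\<^sub>R d" by (simp add: half_def d_def)
  show "p \<odot> half x = (1 / 2) *\<^sub>R half x" by (simp add: h jdistrib pd)
  have 1: "p \<odot> half x = d + d" by (simp add: h jdistrib pd scaleR_2)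
  have 2: "p \<odot> (d + d) = d" by (simp only: jadd_right pd scaleR_half_sum)
  have "p \<odot> (x - half x) = p \<odot> x - (d + d)" "p \<odot> (p \<odot> (x - half x)) = p \<odot> (p \<odot> x) - d"
    by (simp_all only: jdiff_right 1 2)
  then show "p \<odot> (p \<odot> (x - half x)) = p \<odot> (x - half x)" by (simp add: d_def)
qed

lemma half_zero_even: "p \<odot> (p \<odot> x) = p \<odot> x \<Longrightarrow> half x = 0"
  by (simp add: half_def)

lemma half_of_half: "p \<odot> x = (1 / 2) *\<^sub>R x \<Longrightarrow> half x = x"
  by (simp add: half_def jdistrib flip: scaleR_left_diff_distrib)

lemma quad_minus_half: "quad p (x - half x) = quad p x"
  using quad_half[OF jprod_half, of x] by (simp add: quad_diff_right)

text \<open>The Peirce symmetry \<open>quad (2 p - e)\<close>: a change of sign on the 1/2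
  component.\<close>

definition reflect :: "'a \<Rightarrow> 'a" where
  "reflect x = x - half x - half x"

lemma half_add: "half (x + y) = half x + half y"
  and half_diff: "half (x - y) = half x - half y"
  and half_scale: "half (c *\<^sub>R x) = c *\<^sub>R half x"
  by (simp_all add: half_def jdistrib algebra_simps)

lemma reflect_add: "reflect (x + y) = reflect x + reflect y"
  and reflect_scale: "reflect (c *\<^sub>R x) = c *\<^sub>R reflect x"
  by (simp_all add: reflect_def half_add half_scale algebra_simps)

lemma even_prod_odd:
  assumes "p \<odot> (p \<odot> s) = p \<odot> s" "p \<odot> v = (1 / 2) *\<^sub>R v"
  shows "p \<odot> (s \<odot> v) = (1 / 2) *\<^sub>R (s \<odot> v)"
proof -
  have "p \<odot> ((p \<odot> s) \<odot> v) = (p \<odot> s) \<odot> (p \<odot> v)" using assms by (intro jprod_commute_one)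
  moreover have "p \<odot> ((s - p \<odot> s) \<odot> v) = (s - p \<odot> s) \<odot> (p \<odot> v)"
    using assms by (intro jprod_commute_zero) (simp add: jdistrib)
  ultimately show ?thesis using assms(2) by (simp add: jdistrib scaleR_right_diff_distrib)
qed

lemma even_prod_even:
  assumes "p \<odot> (p \<odot> s) = p \<odot> s" "p \<odot> (p \<odot> t) = p \<odot> t"
  shows "p \<odot> (p \<odot> (s \<odot> t)) = p \<odot> (s \<odot> t)"
proof -
  have 1: "p \<odot> ((p \<odot> s) \<odot> w) = (p \<odot> s) \<odot> (p \<odot> w)" for w using assms by (intro jprod_commute_one)
  have 2: "p \<odot> ((s - p \<odot> s) \<odot> w) = (s - p \<odot> s) \<odot> (p \<odot> w)" for w
    using assms by (intro jprod_commute_zero) (simp add: jdistrib)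
  have "p \<odot> (s \<odot> w) = s \<odot> (p \<odot> w)" for w
    using 1[of w] 2[of w] by (simp add: jdistrib)
  then show ?thesis using assms by simp
qed

text \<open>The components for 0 and 1 form the even part, and the 1/2 component the odd part, of a
  grading by the group of order two; the change of sign on the odd part is therefore an
  automorphism.\<close>

lemma reflect_prod: "reflect (x \<odot> y) = reflect x \<odot> reflect y"
proof -
  define s t where "s = x - half x" "t = y - half y"
  have st: "p \<odot> (p \<odot> s) = p \<odot> s" "p \<odot> (p \<odot> t) = p \<odot> t"
    by (simp_all add: s_t_def even_minus_half)
  have "x \<odot> y = (s + half x) \<odot> (t + half y)" by (simp add: s_t_def)
  also have "\<dots> = (s \<odot> t + half x \<odot> half y) + (s \<odot> half y + t \<odot> half x)"
    by (simp add: jdistrib jprod_commute[of "half x" t] algebra_simps)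
  finally have xy: "x \<odot> y = (s \<odot> t + half x \<odot> half y) + (s \<odot> half y + t \<odot> half x)" .
  have "half (s \<odot> t) = 0" "half (half x \<odot> half y) = 0"
    by (rule half_zero_even[OF even_prod_even[OF st]],
        rule half_zero_even[OF half_prod_half[OF jprod_half jprod_half]])
  moreover have "half (s \<odot> half y) = s \<odot> half y" "half (t \<odot> half x) = t \<odot> half x"
    by (rule half_of_half[OF even_prod_odd[OF st(1) jprod_half]],
        rule half_of_half[OF even_prod_odd[OF st(2) jprod_half]])
  ultimately have "half (x \<odot> y) = s \<odot> half y + t \<odot> half x"
    unfolding xy by (simp add: half_add)
  then have "reflect (x \<odot> y) = (s \<odot> t + half x \<odot> half y) - (s \<odot> half y + t \<odot> half x)"
    unfolding reflect_def using xy by simp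
  also have "\<dots> = (s - half x) \<odot> (t - half y)"
    by (simp add: jdistrib jprod_commute[of "half x" t] algebra_simps)
  finally show ?thesis by (simp add: reflect_def s_t_def)
qed

lemma reflect_pos: "pos x \<Longrightarrow> pos (reflect x)"
  using pos_sqrt reflect_prod pos_square by metis

lemma reflect_reflect: "reflect (reflect x) = x"
  using half_of_half[OF jprod_half, of x] by (simp add: reflect_def half_diff)

lemma quad_compl: "quad (e - p) y = y - half y - quad p y"
proof -
  have "quad (e - p) y = y - (p \<odot> y + p \<odot> y + p \<odot> y) + (p \<odot> (p \<odot> y) + p \<odot> (p \<odot> y))"
    using p by (simp add: quad_def vec_simps)
  then show ?thesis
    using p by (simp add: half_def quad_def scaleR_4 algebra_simps)
qed

text \<open>The three Peirce components are scaled by \<open>a\<^sup>2\<close>, \<open>a b\<close>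
  and \<open>b\<^sup>2\<close>. As \<open>quad\<close> is positive for \<open>a, b \<ge> 0\<close>,
  weight can be shifted between the diagonal parts without touching the 1/2 component when
  \<open>a b = 1\<close>.\<close>

lemma quad_mix:
  "quad (a *\<^sub>R p + b *\<^sub>R (e - p)) y = (a * a) *\<^sub>R quad p y + (a * b) *\<^sub>R half y + (b * b) *\<^sub>R quad (e - p) y"
proof -
  have h: "p \<odot> half y = (1 / 2) *\<^sub>R half y" by (rule jprod_half)
  have 1: "p \<odot> quad p y = quad p y" by (rule jprod_quad_projection)
  have y: "y = quad p y + half y + quad (e - p) y" by (simp add: quad_compl)
  have "p \<odot> (quad p y + half y + quad (e - p) y) = quad p y + (1 / 2) *\<^sub>R half y + p \<odot> quad (e - p) y"
    by (simp add: jdistrib 1 h)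
  moreover have "p \<odot> quad (e - p) y = 0"
    using even_minus_half[of y] p quad_of_even[OF even_minus_half, of y]
    by (simp add: quad_compl jdistrib quad_minus_half jprod_quad_projection)
  ultimately have 0: "p \<odot> quad (e - p) y = 0" by simp
  define x where "x = a *\<^sub>R p + b *\<^sub>R (e - p)"
  have xx: "x \<odot> x = (a * a) *\<^sub>R p + (b * b) *\<^sub>R (e - p)"
    using p by (simp add: x_def jdistrib algebra_simps)
  have q1: "quad x (quad p y) = (a * a) *\<^sub>R quad p y"
    unfolding quad_def[of x] xx by (simp add: x_def jdistrib 1)
  have q0: "quad x (quad (e - p) y) = (b * b) *\<^sub>R quad (e - p) y"
    unfolding quad_def[of x] xx by (simp add: x_def jdistrib 0)
  have qh: "quad x (half y) = (a * b) *\<^sub>R half y"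
  proof -
    have hm: "(e - p) \<odot> half y = (1 / 2) *\<^sub>R half y"
      unfolding jdiff_left unit_left h by (metis add_diff_cancel_left' scaleR_half_sum)
    have "x \<odot> half y = ((a + b) / 2) *\<^sub>R half y"
      by (simp add: x_def jadd_left jscale_left h hm add_divide_distrib scaleR_left_distrib)
    moreover have "(x \<odot> x) \<odot> half y = ((a * a + b * b) / 2) *\<^sub>R half y"
      unfolding xx by (simp add: jadd_left jscale_left h hm add_divide_distrib scaleR_left_distrib)
    ultimately show ?thesis
      by (simp add: quad_def jdistrib flip: scaleR_left_distrib scaleR_left_diff_distrib)
        (simp add: field_simps)
  qed
  have "quad x y = quad x (quad p y) + quad x (half y) + quad x (quad (e - p) y)"
    by (subst y) (simp add: quad_add_right)
  then show ?thesis unfolding x_def[symmetric] q0 q1 qh .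
qed

text \<open>The weights 1 and \<open>\<delta>\<close>, after division by \<open>\<delta>\<close>,
  show that the 1/2 component is positive. The reflected element has the opposite 1/2 component, so
  both signs occur.\<close>

lemma pos_quad_zero:
  assumes y: "pos y" "quad p y = 0"
  shows "p \<odot> y = 0"
proof -
  have *: "pos (half z)" if z: "pos z" "quad p z = 0" for z
  proof (rule pos_approx)
    fix \<delta> :: real assume \<delta>: "\<delta> > 0"
    have "pos (quad (1 *\<^sub>R p + \<delta> *\<^sub>R (e - p)) z)"
      using \<delta> p by (intro quad_pos pos_add pos_scale z projection_pos projection_compl) auto
    then have "pos (\<delta> *\<^sub>R (half z + \<delta> *\<^sub>R quad (e - p) z))"
      unfolding quad_mix z by (simp add: scaleR_right_distrib)
    then show "pos (half z + \<delta> *\<^sub>R quad (e - p) z)" using pos_scale_iff \<delta> by blast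
  qed
  have "half (reflect y) = - half y"
    using half_of_half[OF jprod_half, of y] by (simp add: reflect_def half_diff)
  moreover have "quad p (reflect y) = 0"
    using quad_half[OF jprod_half, of y] y by (simp add: reflect_def quad_diff_right)
  ultimately have "pos (- half y)"
    using *[of "reflect y"] reflect_pos[OF y(1)] by simp
  then have "half y = 0" using *[OF y] pos_antisym by blast
  then show ?thesis
    using y quad_of_even[OF even_minus_half, of y] by simp
qed

end

section \<open>Suprema and orthogonality\<close>

definition is_lub :: "'a set \<Rightarrow> 'a \<Rightarrow> bool" where
  "is_lub D p \<longleftrightarrow> (\<forall>a\<in>D. a \<preceq> p) \<and> (\<forall>b. (\<forall>a\<in>D. a \<preceq> b) \<longrightarrow> p \<preceq> b)"

lemma is_lub_least: "is_lub D p \<Longrightarrow> (\<And>a. a \<in> D \<Longrightarrow> a \<preceq> b) \<Longrightarrow> p \<preceq> b"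
  unfolding is_lub_def by blast

lemma quad_zero_mono:
  assumes "pos c" "pos x" "x \<preceq> y" "quad c y = 0"
  shows "quad c x = 0"
proof (rule pos_antisym)
  show "pos (quad c x)" using assms by (intro quad_pos)
  have "pos (quad c (y - x))" using assms by (intro quad_pos)
  then show "pos (- quad c x)" using assms by (simp add: quad_diff_right)
qed

text \<open>\<open>quad (e - p)\<close> kills \<open>c p\<close>, hence every positive element below
  it, and \<open>pos_quad_zero\<close> turns this into annihilation by \<open>e - p\<close>.\<close>

lemma below_projection:
  assumes "projection p" "pos y" "y \<preceq> c *\<^sub>R p"
  shows "p \<odot> y = y"
proof -
  have "(e - p) \<odot> (c *\<^sub>R p) = 0"
    using assms(1) by (simp add: jdistrib)
  then have "quad (e - p) (c *\<^sub>R p) = 0"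
    by (rule quad_zero[OF projection_compl[OF assms(1)]])
  then have "quad (e - p) y = 0"
    using quad_zero_mono[OF projection_pos[OF projection_compl[OF assms(1)]] assms(2,3)] by simp
  then have "(e - p) \<odot> y = 0"
    by (intro pos_quad_zero projection_compl assms)
  then show ?thesis by (simp add: jdistrib)
qed

lemma above_projection:
  assumes "projection p" "p \<preceq> y" "y \<preceq> e"
  shows "p \<odot> y = p"
proof -
  have "(e - p) \<odot> (e - y) = e - y"
    by (rule below_projection[where c = 1]) (use assms projection_compl in auto)
  then show ?thesis by (simp add: jdistrib algebra_simps)
qed

lemma projection_orth_mono:
  assumes "projection p" "p \<odot> y = 0" "pos x" "x \<preceq> c *\<^sub>R y"
  shows "p \<odot> x = 0"
proof (rule pos_quad_zero[OF assms(1,3)])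
  have "quad p (c *\<^sub>R y) = 0"
    using assms by (simp add: quad_def jdistrib)
  then show "quad p x = 0"
    by (rule quad_zero_mono[OF projection_pos[OF assms(1)] assms(3,4)])
qed

text \<open>\<open>quad a\<close> kills every \<open>x\<close> between 0 and \<open>g\<close>, so
  \<open>quad (e + t a) x = x + 2 t (a \<odot> x)\<close> is positive for all \<open>t > 0\<close>,
  and \<open>a \<odot> x \<ge> 0\<close> follows for large \<open>t\<close>. For \<open>d\<close>
  and \<open>g - d\<close> these products add up to 0.\<close>

lemma pos_orth_mono:
  assumes a: "pos a" and d: "pos d" "d \<preceq> g" and orth: "a \<odot> g = 0" "(a \<odot> a) \<odot> g = 0"
  shows "a \<odot> d = 0"
proof -
  have *: "pos (a \<odot> x)" if x: "pos x" "x \<preceq> g" for x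
  proof (rule pos_approx)
    fix \<delta> :: real assume \<delta>: "\<delta> > 0"
    have "quad a g = 0" using orth by (simp add: quad_def)
    then have q: "quad a x = 0" by (rule quad_zero_mono[OF a x])
    define t where "t = 1 / (2 * \<delta>)"
    have t: "t > 0" "t * \<delta> = 1 / 2" using \<delta> by (simp_all add: t_def)
    have "pos (quad (e + t *\<^sub>R a) x)"
      using a x t by (intro quad_pos pos_add pos_scale) auto
    then have "pos (x + (t *\<^sub>R (a \<odot> x) + t *\<^sub>R (a \<odot> x)))"
      unfolding quad_unit_add q by simp
    also have "x + (t *\<^sub>R (a \<odot> x) + t *\<^sub>R (a \<odot> x)) = (2 * t) *\<^sub>R (a \<odot> x + \<delta> *\<^sub>R x)"
    proof -
      have "t *\<^sub>R (a \<odot> x) + t *\<^sub>R (a \<odot> x) = (2 * t) *\<^sub>R (a \<odot> x)"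
        by (simp only: mult_2 scaleR_left_distrib)
      moreover have "2 * t * \<delta> = 1" using t by simp
      ultimately show ?thesis by (simp add: scaleR_right_distrib add.commute)
    qed
    finally show "pos (a \<odot> x + \<delta> *\<^sub>R x)" using pos_scale_iff[of "2 * t"] t by simp
  qed
  have "pos (a \<odot> d)" using d by (intro *)
  moreover have "pos (a \<odot> (g - d))" using d by (intro *) auto
  ultimately show ?thesis using orth by (intro pos_antisym) (auto simp: jdistrib)
qed

text \<open>The annihilator of \<open>b\<close> is closed under multiplication by \<open>d\<^sup>2\<close> as soon as it contains \<open>d\<close>,
  so it contains all \<open>d q(d\<^sup>2)\<close>, and \<open>t q(t\<^sup>2)\<close> approximates \<open>t\<^sup>2\<close> on \<open>[0, \<infinity>)\<close>.\<close>

lemma pos_square_orth: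
  assumes d: "pos d" "d \<odot> b = 0"
  shows "(d \<odot> d) \<odot> b = 0"
proof -
  have mult: "(z \<odot> (d \<odot> d)) \<odot> b = 0" if "z \<odot> b = 0" for z
    using jordan_operator[of z d d b] d that by simp
  define Q where "Q q = [:0, 1:] * pcompose q [:0, 0, 1 :: real:]" for q
  have Q: "peval d (Q q) \<odot> b = 0" for q
  proof (induction q)
    case (pCons a q)
    have "Q (pCons a q) = smult a [:0, 1:] + [:0, 0, 1:] * Q q"
      by (simp add: Q_def pcompose_pCons algebra_simps)
    then have "peval d (Q (pCons a q)) = a *\<^sub>R d + (d \<odot> d) \<odot> peval d (Q q)"
      by (simp only: peval_add peval_smult peval_mult) simp
    then show ?case
      using mult[OF pCons(2)] d by (simp add: jdistrib jprod_commute[of "d \<odot> d"])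
  qed (simp add: Q_def)
  have c: "continuous_on UNIV (\<lambda>t::real. sqrt \<bar>t\<bar>)" "continuous_on UNIV (\<lambda>t::real. t * \<bar>t\<bar>)"
    by (intro continuous_intros)+
  let ?r = "norm d"
  let ?q = "approx_poly (\<lambda>t. sqrt \<bar>t\<bar>)"
  have "uniform_limit {- ?r..?r} (\<lambda>n. poly (Q (?q n))) (\<lambda>t. t * \<bar>t\<bar>) sequentially"
  proof (rule uniform_limitI)
    fix \<epsilon> :: real assume \<epsilon>: "\<epsilon> > 0"
    have "\<forall>\<^sub>F n in sequentially. \<forall>s\<in>{- ?r\<^sup>2..?r\<^sup>2}. dist (poly (?q n) s) (sqrt \<bar>s\<bar>) < \<epsilon> / (?r + 1)"
      using \<epsilon> by (intro uniform_limitD uniform_limit_approx_poly c) (simp add: add_nonneg_pos)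
    then show "\<forall>\<^sub>F n in sequentially. \<forall>t\<in>{- ?r..?r}. dist (poly (Q (?q n)) t) (t * \<bar>t\<bar>) < \<epsilon>"
    proof eventually_elim
      case (elim n)
      show ?case
      proof
        fix t assume t: "t \<in> {- ?r..?r}"
        then have "\<bar>t\<bar> \<le> ?r" by auto
        then have "t\<^sup>2 \<le> ?r\<^sup>2" using power_mono[of "\<bar>t\<bar>" ?r 2] by simp
        then have mem: "t\<^sup>2 \<in> {- ?r\<^sup>2..?r\<^sup>2}" by (simp add: order_trans[of _ 0])
        then have *: "\<bar>poly (?q n) (t\<^sup>2) - \<bar>t\<bar>\<bar> < \<epsilon> / (?r + 1)"
          using bspec[OF elim mem] by (simp add: dist_real_def)
        have "dist (poly (Q (?q n)) t) (t * \<bar>t\<bar>) = \<bar>t\<bar> * \<bar>poly (?q n) (t\<^sup>2) - \<bar>t\<bar>\<bar>"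
          by (simp add: Q_def dist_real_def poly_pcompose power2_eq_square
              flip: right_diff_distrib abs_mult)
        also have "\<dots> \<le> ?r * (\<epsilon> / (?r + 1))"
          using * \<open>\<bar>t\<bar> \<le> ?r\<close> by (intro mult_mono) auto
        also have "\<dots> < \<epsilon>"
        proof -
          have "?r + 1 > 0" by (simp add: add_nonneg_pos)
          moreover have "?r * \<epsilon> < \<epsilon> * (?r + 1)" using \<epsilon> by (simp add: algebra_simps)
          ultimately show ?thesis by (simp add: pos_divide_less_eq)
        qed
        finally show "dist (poly (Q (?q n)) t) (t * \<bar>t\<bar>) < \<epsilon>" .
      qed
    qed
  qed
  then have "(\<lambda>n. peval d (Q (?q n)) \<odot> b) \<longlonglongrightarrow> fc d (\<lambda>t. t * \<bar>t\<bar>) \<odot> b"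
    by (intro tendsto_intros peval_tendsto_fc c)
  then have "fc d (\<lambda>t. t * \<bar>t\<bar>) \<odot> b = 0"
    unfolding Q using LIMSEQ_unique tendsto_const by blast
  moreover have "fc d (\<lambda>t. t * \<bar>t\<bar>) = fc d (\<lambda>t. t * t)"
    by (rule fc_cong[OF pos_interval[OF d(1)]]) (auto intro!: continuous_intros)
  moreover have "fc d (\<lambda>t. t * t) = d \<odot> d"
    using fc_mult[of "\<lambda>t. t" "\<lambda>t. t" d] by (simp add: fc_id)
  ultimately show ?thesis by simp
qed

lemma effect_of_square_le:
  assumes "pos u" "u \<odot> u \<preceq> u"
  shows "u \<preceq> e"
proof -
  have "(norm u)\<^sup>2 \<le> norm u"
    using norm_mono[OF pos_square assms(2)] by (simp add: norm_square)
  have "norm u \<le> 1"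
  proof (rule ccontr)
    assume "\<not> norm u \<le> 1"
    then have "norm u * 1 < norm u * norm u" by (intro mult_strict_left_mono) auto
    then show False using \<open>(norm u)\<^sup>2 \<le> norm u\<close> by (simp add: power2_eq_square)
  qed
  then show ?thesis using le_norm_unit[of u 1] by simp
qed

lemma square_le_self:
  assumes "pos u" "u \<preceq> e"
  shows "u \<odot> u \<preceq> u"
proof -
  have "pos (u \<odot> (e - u))"
    by (rule pos_prod[of _ u]) (auto intro: assms gen_self gen_diff gen_unit)
  then show ?thesis by (simp add: jdistrib)
qed

text \<open>Orthogonality removes the cross term: \<open>u = a + r\<close> satisfies
  \<open>u \<odot> u \<le> u\<close>, which forces \<open>norm u \<le> 1\<close>.\<close>

lemma orth_sum_le:
  assumes a: "pos a" "a \<preceq> e" and r: "pos r" "r \<preceq> e" and "a \<odot> r = 0"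
  shows "a + r \<preceq> e"
proof (rule effect_of_square_le)
  show "pos (a + r)" using a r by (intro pos_add)
  have "(a + r) \<odot> (a + r) = a \<odot> a + r \<odot> r"
    using assms(5) by (simp add: jdistrib jprod_commute[of r a])
  moreover have "pos (a - a \<odot> a + (r - r \<odot> r))"
    using a r by (intro pos_add square_le_self)
  ultimately show "(a + r) \<odot> (a + r) \<preceq> a + r" by (simp add: algebra_simps)
qed

text \<open>\<open>w = 2d - d\<^sup>2\<close> is orthogonal to \<open>D\<close>, hence \<open>D \<le> e - w\<close> and \<open>p \<le> e - w\<close>, i.e. \<open>d \<le> d\<^sup>2\<close>.\<close>

lemma projection_of_lub:
  assumes D: "D \<noteq> {}" "\<And>a. a \<in> D \<Longrightarrow> pos a \<and> a \<preceq> e" and p: "is_lub D p"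
    and orth: "\<And>a. a \<in> D \<Longrightarrow> a \<odot> (e - p) = 0"
  shows "projection p"
proof -
  define d where "d = e - p"
  have "p \<preceq> e" using D p by (auto simp: is_lub_def)
  then have d0: "pos d" by (simp add: d_def)
  obtain a0 where "a0 \<in> D" using D by blast
  then have "pos a0" "a0 \<preceq> p" using D p by (auto simp: is_lub_def)
  then have "pos p" by (rule pos_trans)
  then have d1: "d \<preceq> e" by (simp add: d_def)
  define w where "w = d + d - d \<odot> d"
  have "pos (d + (d - d \<odot> d))" using d0 d1 by (intro pos_add square_le_self)
  then have w0: "pos w" by (simp add: w_def algebra_simps)
  have "e - w = (e - d) \<odot> (e - d)" by (simp add: w_def jdistrib)
  then have w1: "w \<preceq> e" using pos_square by metis
  have "a \<preceq> e - w" if a: "a \<in> D" for a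
  proof -
    have "d \<odot> a = 0" using orth[OF a] by (simp add: d_def jprod_commute)
    then have "a \<odot> w = 0"
      using pos_square_orth[OF d0] by (simp add: w_def jdistrib jprod_commute[of a])
    then have "a + w \<preceq> e" using D a w0 w1 by (intro orth_sum_le) auto
    then show ?thesis by (simp add: algebra_simps)
  qed
  then have "p \<preceq> e - w" using p by (simp add: is_lub_def)
  then have "d \<preceq> d \<odot> d" by (simp add: d_def w_def algebra_simps)
  then have "d \<odot> d = d" using square_le_self[OF d0 d1] by (intro le_antisym)
  then show ?thesis unfolding d_def by (simp add: jdistrib)
qed

end

text \<open>Order completeness is the only trace of the predual in the later arguments, so it is
  isolated in a locale.\<close>

locale jb_complete = jb_unital jprod e
  for jprod :: "'a::banach \<Rightarrow> 'a \<Rightarrow> 'a" (infixl "\<odot>" 70) and e +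
  assumes directed_lub: "\<lbrakk>D \<noteq> {}; \<And>a. a \<in> D \<Longrightarrow> pos a \<and> a \<preceq> e;
    \<And>a b. a \<in> D \<Longrightarrow> b \<in> D \<Longrightarrow> \<exists>c\<in>D. a \<preceq> c \<and> b \<preceq> c\<rbrakk> \<Longrightarrow> \<exists>p. is_lub D p"
begin

lemma increasing_lub:
  assumes "\<And>n. pos (a n) \<and> a n \<preceq> e" "\<And>n. a n \<preceq> a (Suc n)"
  obtains p where "is_lub (range a) p"
proof -
  have mono: "a m \<preceq> a n" if "m \<le> n" for m n :: nat
    using that
  proof (induction n rule: dec_induct)
    case (step n) then show ?case using assms(2) le_trans by blast
  qed simp
  have "\<exists>p. is_lub (range a) p"
  proof (rule directed_lub)
    fix x y assume "x \<in> range a" "y \<in> range a"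
    then obtain m n where "x = a m" "y = a n" by blast
    then show "\<exists>c\<in>range a. x \<preceq> c \<and> y \<preceq> c"
      using mono[of m "max m n"] mono[of n "max m n"] by auto
  qed (use assms in auto)
  then show ?thesis using that by blast
qed

section \<open>Positive and negative parts, spectral projections, maximal orthogonal
  projections\<close>

abbreviation pos_part :: "'a \<Rightarrow> 'a" where "pos_part y \<equiv> fc y (\<lambda>t. max 0 t)"
abbreviation neg_part :: "'a \<Rightarrow> 'a" where "neg_part y \<equiv> fc y (\<lambda>t. max 0 (- t))"

lemma pos_part_pos: "pos (pos_part y)" and neg_part_pos: "pos (neg_part y)"
  by (rule fc_pos[OF norm_interval]; auto intro!: continuous_intros)+

lemma pos_part_minus_neg_part: "pos_part y - neg_part y = y"
proof -
  have "pos_part y - neg_part y = fc y (\<lambda>t. max 0 t - max 0 (- t))"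
    by (intro fc_diff[symmetric] continuous_intros)
  also have "(\<lambda>t::real. max 0 t - max 0 (- t)) = (\<lambda>t. t)" by (auto simp: max_def)
  finally show ?thesis by (simp add: fc_id)
qed

text \<open>\<open>p\<close> is the range projection of the positive part of \<open>y\<close>,
  obtained as a supremum of continuous functions of \<open>y\<close>. The approximants are part of
  the statement because centrality of \<open>p\<close> is later inferred from theirs.\<close>

lemma spectral_projection:
  "\<exists>p a. projection p \<and> p \<odot> pos_part y = pos_part y \<and> p \<odot> neg_part y = 0 \<and> is_lub (range a) p
    \<and> (\<forall>n::nat. a n \<in> gen y \<and> pos (a n) \<and> a n \<preceq> e \<and> p \<odot> a n = a n)"
proof -
  \<comment> \<open>\<open>f n\<close> rises from 0 to 1 between \<open>1 / 2^n\<close> and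
    \<open>2 / 2^n\<close>, so \<open>f (Suc n)\<close> equals 1 wherever \<open>f n\<close> is
    non-zero.\<close>
  define f :: "nat \<Rightarrow> real \<Rightarrow> real" where "f n t = max 0 (min 1 (2 ^ n * t - 1))" for n t
  define a where "a n = fc y (f n)" for n
  have cf: "continuous_on UNIV (f n)" for n
    unfolding f_def by (intro continuous_intros)
  note int = norm_interval[of y]
  have n0: "- norm y \<le> norm y" by simp
  have a0: "pos (a n)" for n
    unfolding a_def by (rule fc_pos[OF int n0 cf]) (simp add: f_def)
  have a1: "a n \<preceq> e" for n
    using fc_le[OF int n0 cf[of n], of "\<lambda>t. 1"] by (simp add: fc_const a_def f_def)
  have f_step: "f n t * f (Suc n) t = f n t" for n t
    by (cases "2 ^ n * t > 1") (auto simp: f_def)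
  have amono: "a n \<preceq> a (Suc n)" for n
    unfolding a_def
  proof (rule fc_le[OF int n0 cf cf])
    fix t
    have "f n t * f (Suc n) t \<le> 1 * f (Suc n) t" by (intro mult_right_mono) (auto simp: f_def)
    then show "f n t \<le> f (Suc n) t" by (simp add: f_step)
  qed
  have astep: "a n \<odot> a (Suc n) = a n" for n
    using fc_mult[OF cf cf, of y n "Suc n", symmetric] by (simp add: f_step a_def)
  obtain p where p: "is_lub (range a) p"
    using increasing_lub[of a] a0 a1 amono by blast
  have ap: "a n \<preceq> p" for n using p by (simp add: is_lub_def)
  have p1: "p \<preceq> e" using p a1 by (auto simp: is_lub_def)
  have ad: "a n \<odot> (e - p) = 0" for n
  proof (rule pos_orth_mono[OF a0])
    show "e - p \<preceq> e - a (Suc n)" using ap by simp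
    show 1: "a n \<odot> (e - a (Suc n)) = 0" by (simp add: jdistrib astep)
    have "(a n \<odot> a n) \<odot> (e - a (Suc n)) = a n \<odot> (a n \<odot> (e - a (Suc n)))"
      by (rule gen_assoc[of _ y]) (auto simp: a_def intro: fc_gen cf gen_diff gen_unit)
    then show "(a n \<odot> a n) \<odot> (e - a (Suc n)) = 0" by (simp add: 1)
  qed (use p1 in simp)
  have proj: "projection p"
    by (rule projection_of_lub[OF _ _ p]) (use a0 a1 ad in auto)
  have pa: "p \<odot> a n = a n" for n
    using ad[of n] by (simp add: jdistrib jprod_commute[of p])
  have "p \<odot> pos_part y = pos_part y"
  proof -
    \<comment> \<open>The positive part exceeds \<open>norm y\<close> times \<open>a n\<close> by at
      most \<open>2 / 2^n\<close>, and \<open>quad (e - p)\<close> kills \<open>a n\<close>.\<close>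
    have "norm (quad (e - p) (pos_part y)) \<le> 2 / 2 ^ n" for n
    proof -
      have "fc y (\<lambda>t. max 0 t) \<preceq> fc y (\<lambda>t. norm y * f n t + 2 / 2 ^ n)"
      proof (rule fc_le[OF int n0])
        fix t assume t: "- norm y \<le> t" "t \<le> norm y"
        show "max 0 t \<le> norm y * f n t + 2 / 2 ^ n"
        proof (cases "2 ^ n * t \<ge> 2")
          case True
          then have "f n t = 1" by (simp add: f_def)
          then show ?thesis using t by (simp add: add_increasing2)
        next
          case False
          then have "t \<le> 2 / 2 ^ n" by (simp add: field_simps)
          moreover have "0 \<le> norm y * f n t" by (simp add: f_def)
          ultimately show ?thesis by (simp add: add_increasing)
        qed
      qed (auto intro!: continuous_intros cf)
      also have "fc y (\<lambda>t. norm y * f n t + 2 / 2 ^ n) = norm y *\<^sub>R a n + (2 / 2 ^ n) *\<^sub>R e"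
        unfolding a_def
        by (subst fc_add) (auto intro!: continuous_intros cf simp: fc_scale[OF cf] fc_const)
      finally have "quad (e - p) (pos_part y) \<preceq> quad (e - p) (norm y *\<^sub>R a n + (2 / 2 ^ n) *\<^sub>R e)"
        by (rule quad_mono[OF projection_pos[OF projection_compl[OF proj]]])
      moreover have "(e - p) \<odot> a n = 0" using pa by (simp add: jdistrib)
      then have "quad (e - p) (norm y *\<^sub>R a n + (2 / 2 ^ n) *\<^sub>R e) = (2 / 2 ^ n) *\<^sub>R (e - p)"
        using quad_zero[OF projection_compl[OF proj]] projection_compl[OF proj]
        by (simp add: quad_add_right quad_scale_right quad_unit_right)
      ultimately have "norm (quad (e - p) (pos_part y)) \<le> norm ((2 / 2 ^ n) *\<^sub>R (e - p))"
        by (intro norm_mono quad_pos projection_pos[OF projection_compl[OF proj]] pos_part_pos) auto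
      also have "\<dots> \<le> 2 / 2 ^ n"
        using norm_projection_le[OF projection_compl[OF proj]] by (simp add: divide_right_mono)
      finally show ?thesis .
    qed
    moreover have "(\<lambda>n. 2 / 2 ^ n :: real) \<longlonglongrightarrow> 0"
      using tendsto_mult_right_zero[OF LIMSEQ_inverse_realpow_zero[of 2], of 2]
      by (simp add: divide_inverse power_inverse)
    ultimately have "norm (quad (e - p) (pos_part y)) \<le> 0"
      by (intro LIMSEQ_le_const) auto
    then have "(e - p) \<odot> pos_part y = 0"
      by (intro pos_quad_zero projection_compl proj pos_part_pos) auto
    then show ?thesis by (simp add: jdistrib)
  qed
  moreover have "p \<odot> neg_part y = 0"
  proof -
    \<comment> \<open>The negative part is rescaled to an effect orthogonal to all
      \<open>a n\<close>; then \<open>a n + c \<le> e\<close>, so \<open>e - c\<close> is an upper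
      bound.\<close>
    define c where "c = (1 / (norm y + 1)) *\<^sub>R neg_part y"
    have ny: "norm y + 1 > 0" by (simp add: add_nonneg_pos)
    have c0: "pos c" unfolding c_def using ny by (intro pos_scale neg_part_pos) auto
    have "neg_part y \<preceq> fc y (\<lambda>t. norm y + 1)"
      by (rule fc_le[OF int n0]) (auto intro!: continuous_intros)
    then have "pos ((1 / (norm y + 1)) *\<^sub>R ((norm y + 1) *\<^sub>R e - neg_part y))"
      using ny by (intro pos_scale) (auto simp: fc_const)
    then have c1: "c \<preceq> e" using ny by (simp add: c_def scaleR_right_diff_distrib)
    have "a n \<preceq> e - c" for n
    proof -
      have "f n t * max 0 (- t) = 0" for t
      proof (cases "t \<ge> 0")
        case False
        then have "2 ^ n * t \<le> 0" by (simp add: mult_nonneg_nonpos)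
        then show ?thesis by (simp add: f_def)
      qed simp
      then have z: "(\<lambda>t. f n t * max 0 (- t)) = (\<lambda>t. 0)" by (rule ext)
      have "continuous_on UNIV (\<lambda>t::real. max 0 (- t))" by (intro continuous_intros)
      from fc_mult[OF cf this, of y n] have "a n \<odot> neg_part y = 0"
        unfolding z a_def by (simp add: fc_const)
      then have "a n + c \<preceq> e"
        using a0 a1 c0 c1 by (intro orth_sum_le) (auto simp: c_def jdistrib)
      then show ?thesis by (simp add: algebra_simps)
    qed
    then have "p \<preceq> e - c" using p by (simp add: is_lub_def)
    then have "(e - p) \<odot> c = c"
      using below_projection[OF projection_compl[OF proj] c0, of 1] by (simp add: algebra_simps)
    then have "p \<odot> c = 0" by (simp add: jdistrib)
    then show ?thesis using ny by (simp add: c_def jdistrib)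
  qed
  moreover have "a n \<in> gen y" for n unfolding a_def by (intro fc_gen cf)
  ultimately show ?thesis
    using proj a0 a1 p pa by (intro exI[of _ p] exI[of _ a] conjI allI)
qed

text \<open>\<open>s\<close> is the range projection of the positive part of
  \<open>y - \<delta> e\<close>, non-zero because \<open>\<delta>\<close> is below the norm of
  \<open>y\<close>. On \<open>s\<close> the element is at least \<open>\<delta> s\<close>, and off
  \<open>s\<close> it stays positive.\<close>

lemma projection_below:
  assumes "pos y" "y \<noteq> 0"
  obtains s \<delta> where "projection s" "s \<noteq> 0" "\<delta> > 0" "\<delta> *\<^sub>R s \<preceq> y"
proof -
  define \<delta> where "\<delta> = norm y / 2"
  define Y where "Y = y - \<delta> *\<^sub>R e"
  have \<delta>: "\<delta> > 0" using assms by (simp add: \<delta>_def)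
  obtain s where s: "projection s" "s \<odot> pos_part Y = pos_part Y" "s \<odot> neg_part Y = 0"
    using spectral_projection[of Y] by (elim exE conjE) (rule that)
  have "pos_part Y \<noteq> 0"
  proof
    assume "pos_part Y = 0"
    then have "neg_part Y = - Y" using pos_part_minus_neg_part[of Y] by (metis diff_0 minus_minus)
    then have "pos (- Y)" using neg_part_pos[of Y] by simp
    then have "y \<preceq> \<delta> *\<^sub>R e" by (simp add: Y_def)
    then have "norm y \<le> norm (\<delta> *\<^sub>R e)" by (intro norm_mono assms)
    also have "\<dots> \<le> \<delta>" using \<delta> norm_unit_le by (simp add: mult_left_le)
    finally show False using \<delta> by (simp add: \<delta>_def)
  qed
  then have s0: "s \<noteq> 0" using s by auto
  have "s \<odot> Y = pos_part Y"
    using arg_cong[OF pos_part_minus_neg_part[of Y], of "(\<odot>) s"] by (simp add: jdiff_right s)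
  then have sy: "s \<odot> y = \<delta> *\<^sub>R s + pos_part Y" by (simp add: Y_def jdistrib algebra_simps)
  then have "(e - s) \<odot> ((e - s) \<odot> y) = (e - s) \<odot> y"
    using s by (simp add: jdistrib)
  then have "quad (e - s) y = (e - s) \<odot> y"
    by (intro quad_of_even projection_compl s)
  then have "pos ((e - s) \<odot> y)"
    by (metis assms(1) quad_pos projection_pos projection_compl s(1))
  then have "pos ((e - s) \<odot> y + pos_part Y)"
    by (intro pos_add pos_part_pos)
  then have "\<delta> *\<^sub>R s \<preceq> y" by (simp add: jdistrib sy algebra_simps)
  then show ?thesis using that s s0 \<delta> by blast
qed

text \<open>By Zorn's lemma, with suprema of chains from \<open>directed_lub\<close>. The complement
  \<open>e - q\<close> plays the role of the supremum of \<open>W\<close>.\<close>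

lemma maximal_orthogonal_projection:
  assumes W: "\<And>w. w \<in> W \<Longrightarrow> projection w"
  shows "\<exists>q. projection q \<and> (\<forall>w\<in>W. q \<odot> w = 0)
    \<and> (\<forall>s. projection s \<longrightarrow> s \<odot> q = 0 \<longrightarrow> (\<forall>w\<in>W. s \<odot> w = 0) \<longrightarrow> s = 0)"
proof -
  define A where "A = {q. projection q \<and> (\<forall>w\<in>W. q \<odot> w = 0)}"
  have "\<exists>m\<in>A. \<forall>a\<in>A. m \<preceq> a \<longrightarrow> a = m"
  proof (rule predicate_Zorn)
    show "partial_order_on A (relation_of (\<preceq>) A)"
      unfolding partial_order_on_def preorder_on_def refl_on_def trans_def antisym_def relation_of_def
      using le_trans le_antisym by auto
    fix C assume C: "C \<in> Chains (relation_of (\<preceq>) A)"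
    then have CA: "C \<subseteq> A" and ch: "\<And>a b. a \<in> C \<Longrightarrow> b \<in> C \<Longrightarrow> a \<preceq> b \<or> b \<preceq> a"
      by (auto simp: Chains_def relation_of_def)
    show "\<exists>u\<in>A. \<forall>a\<in>C. a \<preceq> u"
    proof (cases "C = {}")
      case True
      have "0 \<in> A" by (simp add: A_def)
      then show ?thesis using True by blast
    next
      case False
      have C01: "pos a \<and> a \<preceq> e" if "a \<in> C" for a
        using that CA projection_pos projection_le_unit by (auto simp: A_def)
      have "\<exists>u. is_lub C u"
      proof (rule directed_lub[OF False])
        show "\<exists>c\<in>C. a \<preceq> c \<and> b \<preceq> c" if "a \<in> C" "b \<in> C" for a b
          using ch[OF that] that by (metis diff_self pos_zero)
      qed (use C01 in auto)
      then obtain u where u: "is_lub C u" by blast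
      have u1: "u \<preceq> e" using u C01 by (auto simp: is_lub_def)
      have pu: "projection u"
      proof (rule projection_of_lub[OF False _ u])
        fix a assume a: "a \<in> C"
        then have "projection a" "a \<preceq> u" using u CA by (auto simp: A_def is_lub_def)
        then have "a \<odot> u = a" using u1 by (rule above_projection)
        then show "a \<odot> (e - u) = 0" by (simp add: jdistrib)
      qed (use C01 in auto)
      moreover have "u \<odot> w = 0" if w: "w \<in> W" for w
      proof -
        have "a \<preceq> e - w" if a: "a \<in> C" for a
        proof -
          have "a + w \<preceq> e"
            using a w C01 CA projection_pos[OF W[OF w]] projection_le_unit[OF W[OF w]]
            by (intro orth_sum_le) (auto simp: A_def)
          then show ?thesis by (simp add: algebra_simps)
        qed
        then have "u \<preceq> e - w" using u by (simp add: is_lub_def)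
        then have "(e - u) \<odot> w = w"
          using below_projection[OF projection_compl[OF pu] projection_pos[OF W[OF w]], of 1]
          by (simp add: algebra_simps)
        then show ?thesis by (simp add: jdistrib)
      qed
      ultimately have "u \<in> A" by (simp add: A_def)
      then show ?thesis using u by (auto simp: is_lub_def)
    qed
  qed
  then obtain q where q: "q \<in> A" "\<And>a. a \<in> A \<Longrightarrow> q \<preceq> a \<Longrightarrow> a = q" by blast
  have "s = 0" if s: "projection s" "s \<odot> q = 0" "\<forall>w\<in>W. s \<odot> w = 0" for s
  proof -
    have "q + s \<in> A"
      using q s projection_add[of q s] by (auto simp: A_def jdistrib jprod_commute[of q s])
    moreover have "q \<preceq> q + s" using projection_pos[OF s(1)] by simp
    ultimately show "s = 0" using q(2) by fastforce
  qed
  then show ?thesis using q(1) by (auto simp: A_def)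
qed

end

subsection \<open>Order completeness of dual spaces\<close>

text \<open>Closed balls of a dual space are compact for the topology of pointwise convergence.\<close>

lemma dual_balls_fip:
  fixes I :: "('a::real_normed_vector \<times> real) set" and predual :: "'p::banach itself"
  assumes dual: "isometric_to_dual TYPE('a) predual"
    and fin: "\<And>J. finite J \<Longrightarrow> J \<subseteq> I \<Longrightarrow> \<exists>x. \<forall>i\<in>J. norm (x - fst i) \<le> snd i"
  shows "\<exists>x. \<forall>i\<in>I. norm (x - fst i) \<le> snd i"
proof (cases "I = {}")
  case False
  then obtain i0 where i0: "i0 \<in> I" by blast
  obtain T :: "'a \<Rightarrow> ('p \<Rightarrow>\<^sub>L real)" where T: "linear T" "surj T" "\<And>x. norm (T x) = norm x"
    using dual unfolding isometric_to_dual_def by blast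
  \<comment> \<open>One ball of the family bounds the norm of all candidates, which places them in
    the compact product \<open>C\<close>.\<close>
  define R where "R = norm (fst i0) + snd i0"
  define C :: "('p \<Rightarrow> real) set" where "C = PiE UNIV (\<lambda>\<pi>. {- (R * norm \<pi>)..R * norm \<pi>})"
  define K where "K i = {g :: 'p \<Rightarrow> real. linear g \<and> (\<forall>\<pi>. \<bar>g \<pi> - T (fst i) \<pi>\<bar> \<le> snd i * norm \<pi>)}" for i
  have "compactin euclidean C"
    unfolding C_def euclidean_product_topology[symmetric] compactin_PiE by auto
  then have compact_C: "compact C" by simp
  have closed_K: "closed (K i)" for i
  proof -
    have eval: "continuous_on UNIV (\<lambda>g :: 'p \<Rightarrow> real. g \<pi>)" for \<pi> by simp
    have "K i = (\<Inter>x. \<Inter>y. {g. g (x + y) = g x + g y}) \<inter> (\<Inter>c. \<Inter>x. {g. g (c *\<^sub>R x) = c *\<^sub>R g x})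
        \<inter> (\<Inter>\<pi>. {g. \<bar>g \<pi> - T (fst i) \<pi>\<bar> \<le> snd i * norm \<pi>})"
      unfolding K_def linear_iff by auto
    moreover have "closed {g :: 'p \<Rightarrow> real. g (x + y) = g x + g y}" for x y
      by (intro closed_Collect_eq continuous_intros eval)
    moreover have "closed {g :: 'p \<Rightarrow> real. g (c *\<^sub>R x) = c *\<^sub>R g x}" for c x
      by (intro closed_Collect_eq continuous_intros eval)
    moreover have "closed {g. \<bar>g \<pi> - T (fst i) \<pi>\<bar> \<le> snd i * norm \<pi>}" for \<pi>
      by (intro closed_Collect_le continuous_intros eval)
    ultimately show ?thesis by (auto intro!: closed_Int closed_INT)
  qed
  have "C \<inter> (\<Inter>i\<in>J. K i) \<noteq> {}" if J: "finite J" "J \<subseteq> I" for J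
  proof -
    obtain x where x: "\<forall>i\<in>insert i0 J. norm (x - fst i) \<le> snd i"
      using fin[of "insert i0 J"] J i0 by auto
    have "norm x \<le> R"
      using x norm_triangle_ineq2[of x "fst i0"] by (simp add: R_def)
    have "T x \<pi> \<in> {- (R * norm \<pi>)..R * norm \<pi>}" for \<pi>
    proof -
      have "\<bar>T x \<pi>\<bar> \<le> norm (T x) * norm \<pi>" using norm_blinfun[of "T x" \<pi>] by simp
      also have "\<dots> \<le> R * norm \<pi>" using \<open>norm x \<le> R\<close> by (intro mult_right_mono) (auto simp: T)
      finally show ?thesis by auto
    qed
    then have "blinfun_apply (T x) \<in> C" by (simp add: C_def PiE_UNIV_domain)
    moreover have "blinfun_apply (T x) \<in> K i" if "i \<in> J" for i
    proof -
      have "\<bar>T x \<pi> - T (fst i) \<pi>\<bar> \<le> snd i * norm \<pi>" for \<pi>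
      proof -
        have "T x \<pi> - T (fst i) \<pi> = T (x - fst i) \<pi>"
          by (simp add: linear_diff[OF T(1)] minus_blinfun.rep_eq)
        moreover have "\<bar>T (x - fst i) \<pi>\<bar> \<le> norm (T (x - fst i)) * norm \<pi>"
          using norm_blinfun[of "T (x - fst i)" \<pi>] by simp
        moreover have "norm (T (x - fst i)) * norm \<pi> \<le> snd i * norm \<pi>"
          using x that by (intro mult_right_mono) (auto simp: T)
        ultimately show ?thesis by linarith
      qed
      moreover have "linear (blinfun_apply (T x))"
        by (simp add: blinfun.bounded_linear_right bounded_linear.linear)
      ultimately show ?thesis by (simp add: K_def)
    qed
    ultimately show ?thesis by blast
  qed
  then have "C \<inter> (\<Inter>i\<in>I. K i) \<noteq> {}"
    by (rule compact_imp_fip_image[OF compact_C closed_K])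
  then obtain g where g: "g \<in> C" "\<And>i. i \<in> I \<Longrightarrow> g \<in> K i" by blast
  have "bounded_linear g"
  proof (rule bounded_linear_intro[where K = R])
    show "g (x + y) = g x + g y" "g (r *\<^sub>R x) = r *\<^sub>R g x" for r x y
      using g(2)[OF i0] by (auto simp: K_def linear_iff)
    show "norm (g x) \<le> norm x * R" for x
      using g(1) by (auto simp: C_def abs_le_iff mult.commute PiE_iff dest!: spec[of _ x])
  qed
  then have Bg: "blinfun_apply (Blinfun g) = g" by (rule bounded_linear_Blinfun_apply)
  obtain x where x: "T x = Blinfun g" using T(2) by (metis surj_def)
  have "norm (x - fst i) \<le> snd i" if "i \<in> I" for i
  proof -
    have "norm (T (x - fst i)) \<le> snd i"
    proof (rule norm_blinfun_bound)
      show "0 \<le> snd i" using fin[of "{i}"] that by (auto intro: order_trans[OF norm_ge_zero])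
      show "norm (T (x - fst i) \<pi>) \<le> snd i * norm \<pi>" for \<pi>
        using g(2)[OF that] by (simp add: linear_diff[OF T(1)] minus_blinfun.rep_eq x Bg K_def)
    qed
    then show ?thesis by (simp add: T)
  qed
  then show ?thesis by blast
qed simp

context jb_unital
begin

lemma norm_ball_iff:
  assumes "r \<ge> 0"
  shows "norm (x - c) \<le> r \<longleftrightarrow> c - r *\<^sub>R e \<preceq> x \<and> x \<preceq> c + r *\<^sub>R e"
  using le_norm_unit[of "x - c" r] neg_norm_unit_le[of "x - c" r] norm_le_of_unit_bounds[of r "x - c"] assms
  by (auto simp: algebra_simps)

text \<open>Balls of the order unit norm are order intervals: \<open>L a\<close> reaches from
  \<open>a\<close> to \<open>a + 2 e\<close>, and \<open>H b\<close> from a negative element up to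
  \<open>b\<close>. A common point of all of them is a supremum, and by directedness finitely many
  of them share an element of \<open>D\<close>.\<close>

lemma directed_lub_of_fip:
  assumes fip: "\<And>I :: ('a \<times> real) set.
      (\<And>J. finite J \<Longrightarrow> J \<subseteq> I \<Longrightarrow> \<exists>x. \<forall>i\<in>J. norm (x - fst i) \<le> snd i)
      \<Longrightarrow> \<exists>x. \<forall>i\<in>I. norm (x - fst i) \<le> snd i"
    and D: "D \<noteq> {}" "\<And>a. a \<in> D \<Longrightarrow> pos a \<and> a \<preceq> e"
    and dir: "\<And>a b. a \<in> D \<Longrightarrow> b \<in> D \<Longrightarrow> \<exists>c\<in>D. a \<preceq> c \<and> b \<preceq> c"
  shows "\<exists>p. is_lub D p"
proof -
  define U where "U = {b. \<forall>a\<in>D. a \<preceq> b}"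
  define L where "L a = (a + e, 1 :: real)" for a
  define H where "H b = (b - (norm b + 1) *\<^sub>R e, norm b + 1)" for b
  have L: "norm (x - fst (L a)) \<le> snd (L a) \<longleftrightarrow> a \<preceq> x \<and> x \<preceq> a + e + e" for x a
    unfolding L_def by (simp add: norm_ball_iff)
  have H: "norm (x - fst (H b)) \<le> snd (H b)
      \<longleftrightarrow> b - (norm b + 1) *\<^sub>R e - (norm b + 1) *\<^sub>R e \<preceq> x \<and> x \<preceq> b" for x b
    unfolding H_def by (simp add: norm_ball_iff)
  have fin_dir: "\<exists>c\<in>D. \<forall>a\<in>A. a \<preceq> c" if "finite A" "A \<subseteq> D" for A
    using that
  proof (induction rule: finite_induct)
    case empty then show ?case using D by auto
  next
    case (insert a A)
    then obtain c where c: "c \<in> D" "\<And>b. b \<in> A \<Longrightarrow> b \<preceq> c" by auto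
    obtain d where d: "d \<in> D" "a \<preceq> d" "c \<preceq> d" using dir[of a c] insert c by auto
    then show ?case using c le_trans by (intro bexI[of _ d]) auto
  qed
  have "\<exists>x. \<forall>i\<in>L ` D \<union> H ` U. norm (x - fst i) \<le> snd i"
  proof (rule fip)
    fix J assume J: "finite J" "J \<subseteq> L ` D \<union> H ` U"
    have "finite (J \<inter> L ` D)" using J by simp
    then obtain A where A: "finite A" "A \<subseteq> D" "J \<inter> L ` D = L ` A"
      by (metis finite_subset_image inf_le2)
    obtain c where c: "c \<in> D" "\<And>a. a \<in> A \<Longrightarrow> a \<preceq> c" using fin_dir[OF A(1,2)] by blast
    have "norm (c - fst i) \<le> snd i" if i: "i \<in> J" for i
    proof -
      consider a where "a \<in> A" "i = L a" | b where "b \<in> U" "i = H b"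
        using i J A by blast
      then show ?thesis
      proof cases
        case 1
        have "pos (e - c + a + e)" using D c A 1 by (intro pos_add) auto
        then show ?thesis unfolding 1 L using c 1 by (simp add: algebra_simps)
      next
        case 2
        have "pos (c + (norm b *\<^sub>R e - b) + (norm b *\<^sub>R e + e + e))"
          using D c by (intro pos_add le_norm_unit) auto
        then show ?thesis unfolding 2 H using c 2 by (simp add: U_def algebra_simps)
      qed
    qed
    then show "\<exists>x. \<forall>i\<in>J. norm (x - fst i) \<le> snd i" by blast
  qed
  then obtain x where x: "\<And>i. i \<in> L ` D \<union> H ` U \<Longrightarrow> norm (x - fst i) \<le> snd i" by blast
  have "a \<preceq> x" if "a \<in> D" for a using x[of "L a"] L that by blast
  moreover have "x \<preceq> b" if "b \<in> U" for b using x[of "H b"] H that by blast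
  ultimately show ?thesis unfolding is_lub_def U_def by blast
qed

end

sublocale jbw_algebra \<subseteq> jb_complete jprod e
proof -
  interpret jb_unital jprod e by unfold_locales (rule unit)
  show "jb_complete jprod e"
    by unfold_locales (rule directed_lub_of_fip, rule dual_balls_fip[OF dual_space], blast+)
qed

subsection \<open>Atoms\<close>

context jb_complete
begin

text \<open>\<open>quad q\<close> applied to the square of \<open>u - \<delta> e\<close> gives
  \<open>\<delta>\<^sup>2 q - 2 \<delta> quad q u \<ge> 0\<close>; division by
  \<open>\<delta>\<close> and a limit leave \<open>quad q u \<le> 0\<close>.\<close>

lemma pos_orth_sqrt:
  assumes "pos u" "projection q" "q \<odot> (u \<odot> u) = 0"
  shows "q \<odot> u = 0"
proof (rule pos_quad_zero[OF assms(2,1)])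
  have "pos (- quad q u)"
  proof (rule pos_approx[where y = q])
    fix \<delta> :: real assume \<delta>: "\<delta> > 0"
    have "pos ((u - \<delta> *\<^sub>R e) \<odot> (u - \<delta> *\<^sub>R e))" by (rule pos_square)
    then have "pos (quad q (u \<odot> u - \<delta> *\<^sub>R u - \<delta> *\<^sub>R u + (\<delta> * \<delta>) *\<^sub>R e))"
      using quad_pos[OF projection_pos[OF assms(2)]] by (simp add: jdistrib algebra_simps)
    moreover have "quad q (u \<odot> u) = 0" using assms by (simp add: quad_zero)
    moreover have "quad q e = q" using assms by (simp add: quad_unit_right)
    ultimately have "pos (- (\<delta> *\<^sub>R quad q u + \<delta> *\<^sub>R quad q u) + (\<delta> * \<delta>) *\<^sub>R q)"
      by (simp add: quad_add_right quad_diff_right quad_scale_right algebra_simps)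
    then have "pos (\<delta> *\<^sub>R (- (quad q u + quad q u) + \<delta> *\<^sub>R q))"
      by (simp add: algebra_simps)
    then have "pos (- (quad q u + quad q u) + \<delta> *\<^sub>R q)" using \<delta> pos_scale_iff by blast
    then have "pos (- (quad q u + quad q u) + \<delta> *\<^sub>R q + quad q u)"
      by (rule pos_add[OF _ quad_pos[OF projection_pos[OF assms(2)] assms(1)]])
    then show "pos (- quad q u + \<delta> *\<^sub>R q)" by (simp add: algebra_simps)
  qed
  then show "quad q u = 0"
    using quad_pos[OF projection_pos[OF assms(2)] assms(1)] by (intro pos_antisym)
qed

lemma one_prod_one: "projection p \<Longrightarrow> p \<odot> a = a \<Longrightarrow> p \<odot> b = b \<Longrightarrow> p \<odot> (a \<odot> b) = a \<odot> b"
  using jprod_commute_one[of p a b] by simp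

text \<open>Functional calculus involves \<open>e\<close>, so a function of \<open>y\<close> may
  leave the corner of \<open>p\<close>. Here its square is dominated by \<open>y \<odot> y\<close>,
  and \<open>pos_orth_sqrt\<close> returns to the function itself.\<close>

lemma parts_in_corner:
  assumes "projection p" "p \<odot> y = y"
  shows "p \<odot> pos_part y = pos_part y" "p \<odot> neg_part y = neg_part y"
proof -
  have *: "p \<odot> fc y g = fc y g"
    if g: "continuous_on UNIV g" "\<And>t. g t \<ge> 0" "\<And>t. g t * g t \<le> t * t" for g
  proof -
    have "fc y (\<lambda>t. g t * g t) \<preceq> fc y (\<lambda>t. t * t)"
      by (rule fc_le[OF norm_interval]) (auto intro!: continuous_intros g)
    moreover have "fc y (\<lambda>t. t * t) = y \<odot> y"
      using fc_mult[of "\<lambda>t. t" "\<lambda>t. t" y] by (simp add: fc_id)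
    ultimately have "fc y g \<odot> fc y g \<preceq> 1 *\<^sub>R (y \<odot> y)"
      by (simp add: fc_mult[OF g(1,1)])
    moreover have "(e - p) \<odot> (y \<odot> y) = 0"
      using one_prod_one[OF assms(1,2,2)] by (simp add: jdistrib)
    ultimately have "(e - p) \<odot> (fc y g \<odot> fc y g) = 0"
      using projection_orth_mono[OF projection_compl[OF assms(1)] _ pos_square] by blast
    moreover have "pos (fc y g)"
      by (rule fc_pos[OF norm_interval]) (auto intro: g)
    ultimately have "(e - p) \<odot> fc y g = 0"
      using pos_orth_sqrt[OF _ projection_compl[OF assms(1)]] by blast
    then show ?thesis by (simp add: jdistrib)
  qed
  show "p \<odot> pos_part y = pos_part y"
    by (rule *, intro continuous_intros) (auto simp: max_def)
  show "p \<odot> neg_part y = neg_part y"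
    by (rule *, intro continuous_intros) (auto simp: max_def)
qed

lemma corner_le:
  assumes "projection p" "p \<odot> y = y"
  shows "y \<preceq> norm y *\<^sub>R p"
proof -
  have "quad p y \<preceq> quad p (norm y *\<^sub>R e)"
    by (rule quad_mono[OF projection_pos[OF assms(1)] norm_interval(2)])
  then show ?thesis using assms by (simp add: quad_one quad_scale_right quad_unit_right)
qed

lemma pos_scale_projection:
  assumes "projection p" "p \<noteq> 0" "pos (t *\<^sub>R p)"
  shows "t \<ge> 0"
proof (rule ccontr)
  assume "\<not> t \<ge> 0"
  then have "pos ((- t) *\<^sub>R p)" using assms by (intro pos_scale projection_pos) auto
  then have "t *\<^sub>R p = 0" using assms(3) by (intro pos_antisym) auto
  then show False using assms \<open>\<not> t \<ge> 0\<close> by simp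
qed

text \<open>Comparability makes the scalars a Dedekind cut; \<open>\<beta>\<close> is the infimum of
  the \<open>t\<close> with \<open>y \<le> t p\<close>.\<close>

lemma multiple_of_comparable:
  assumes p: "projection p" "p \<odot> y = y"
    and comparable: "\<And>t. y \<preceq> t *\<^sub>R p \<or> t *\<^sub>R p \<preceq> y"
  shows "\<exists>t. y = t *\<^sub>R p"
proof (cases "p = 0")
  case False
  define S where "S = {t. y \<preceq> t *\<^sub>R p}"
  have "norm y \<in> S" using corner_le[OF p] by (simp add: S_def)
  then have ne: "S \<noteq> {}" by blast
  have lower: "- norm y \<le> t" if "t \<in> S" for t
  proof -
    have "- y \<preceq> norm (- y) *\<^sub>R p" using p by (intro corner_le) (simp_all add: jdistrib)
    then have "pos (t *\<^sub>R p - y + (norm y *\<^sub>R p + y))"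
      using that by (simp only: S_def mem_Collect_eq) (rule pos_add, simp_all)
    then have "pos ((t + norm y) *\<^sub>R p)" by (simp add: algebra_simps)
    then show ?thesis using pos_scale_projection[OF p(1) False] by fastforce
  qed
  then have bdd: "bdd_below S" by (intro bdd_belowI)
  define \<beta> where "\<beta> = Inf S"
  have "y \<preceq> \<beta> *\<^sub>R p"
  proof (rule pos_approx)
    fix \<delta> :: real assume "\<delta> > 0"
    then obtain t where t: "t \<in> S" "t < \<beta> + \<delta>"
      using cInf_lessD[OF ne, of "\<beta> + \<delta>"] by (auto simp: \<beta>_def)
    then have "pos (t *\<^sub>R p - y)" "pos ((\<beta> + \<delta> - t) *\<^sub>R p)"
      using pos_scale[OF projection_pos[OF p(1)]] by (auto simp: S_def)
    then have "pos (t *\<^sub>R p - y + (\<beta> + \<delta> - t) *\<^sub>R p)" by (rule pos_add)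
    then show "pos (\<beta> *\<^sub>R p - y + \<delta> *\<^sub>R p)" by (simp add: algebra_simps)
  qed
  moreover have "\<beta> *\<^sub>R p \<preceq> y"
  proof (rule pos_approx)
    fix \<delta> :: real assume "\<delta> > 0"
    then have "\<beta> - \<delta> \<notin> S" using cInf_lower[OF _ bdd, of "\<beta> - \<delta>"] by (auto simp: \<beta>_def)
    then have "(\<beta> - \<delta>) *\<^sub>R p \<preceq> y" using comparable by (auto simp: S_def)
    then show "pos (y - \<beta> *\<^sub>R p + \<delta> *\<^sub>R p)" by (simp add: algebra_simps)
  qed
  ultimately show ?thesis using le_antisym by blast
qed (use p in auto)

lemma pos_part_neg_part_orth: "neg_part y \<odot> pos_part y = 0"
proof -
  have c: "continuous_on UNIV (\<lambda>t::real. max 0 (- t))" "continuous_on UNIV (\<lambda>t::real. max 0 t)"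
    by (intro continuous_intros)+
  have "(\<lambda>t::real. max 0 (- t) * max 0 t) = (\<lambda>t. 0)" by (auto simp: max_def)
  then show ?thesis using fc_mult[OF c, of y] by (simp add: fc_const)
qed

text \<open>The Peirce corner of \<open>p\<close> is one-dimensional. Unlike minimality in the
  order, this form visibly survives norm limits and automorphisms.\<close>

definition minimal :: "'a \<Rightarrow> bool" where
  "minimal p \<longleftrightarrow> projection p \<and> p \<noteq> 0 \<and> (\<forall>y. \<exists>t. quad p y = t *\<^sub>R p)"

text \<open>If both parts of \<open>quad p y - t p\<close> were non-zero, a projection with a
  multiple below the positive part would lie under \<open>p\<close>, hence equal \<open>p\<close>,
  and orthogonality of the parts would make the negative part vanish.\<close>

lemma minimal_of_atom:
  assumes "jb_atom (\<odot>) p"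
  shows "minimal p"
proof -
  have p: "projection p" "p \<noteq> 0"
    and atom: "\<And>q. projection q \<Longrightarrow> q \<noteq> 0 \<Longrightarrow> q \<preceq> p \<Longrightarrow> q = p"
    using assms unfolding jb_atom_def jb_projection_def jb_le_iff by auto
  have "\<exists>t. quad p y = t *\<^sub>R p" for y
  proof (rule multiple_of_comparable[OF p(1)])
    show py: "p \<odot> quad p y = quad p y" by (rule jprod_quad_projection[OF p(1)])
    fix t
    define Y where "Y = quad p y - t *\<^sub>R p"
    have "p \<odot> Y = Y" using p py by (simp add: Y_def jdistrib)
    note parts = parts_in_corner[OF p(1) this]
    have "pos_part Y = 0 \<or> neg_part Y = 0"
    proof (rule disjCI)
      assume "neg_part Y \<noteq> 0"
      show "pos_part Y = 0"
      proof (rule ccontr)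
        assume "pos_part Y \<noteq> 0"
        then obtain s \<delta> where s: "projection s" "s \<noteq> 0" "\<delta> > 0" "\<delta> *\<^sub>R s \<preceq> pos_part Y"
          using projection_below[OF pos_part_pos] by blast
        have "\<delta> *\<^sub>R s \<preceq> norm (pos_part Y) *\<^sub>R p"
          using le_trans[OF s(4) corner_le[OF p(1) parts(1)]] .
        then have "p \<odot> (\<delta> *\<^sub>R s) = \<delta> *\<^sub>R s"
          using s by (rule_tac below_projection[OF p(1) pos_scale[OF projection_pos[OF s(1)]]]) auto
        then have "p \<odot> s = s" using s by (simp add: jdistrib)
        then have "s = p" using atom s projection_diff[OF p(1) s(1)] by blast
        then have "quad (neg_part Y) (\<delta> *\<^sub>R p) \<preceq> quad (neg_part Y) (pos_part Y)"
          using s by (intro quad_mono neg_part_pos) simp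
        moreover have "quad (neg_part Y) (pos_part Y) = 0"
        proof -
          have "(neg_part Y \<odot> neg_part Y) \<odot> pos_part Y = neg_part Y \<odot> (neg_part Y \<odot> pos_part Y)"
            by (rule gen_assoc[of _ Y]) (auto intro!: fc_gen continuous_intros)
          then show ?thesis by (simp add: quad_def pos_part_neg_part_orth)
        qed
        moreover have "quad (neg_part Y) (\<delta> *\<^sub>R p) = \<delta> *\<^sub>R (neg_part Y \<odot> neg_part Y)"
          using parts(2) one_prod_one[OF p(1) parts(2,2)]
          by (simp add: quad_def jdistrib jprod_commute[of _ p])
        ultimately have "pos (- (\<delta> *\<^sub>R (neg_part Y \<odot> neg_part Y)))" by simp
        moreover have "pos (\<delta> *\<^sub>R (neg_part Y \<odot> neg_part Y))"
          using s by (intro pos_scale pos_square) auto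
        ultimately have "neg_part Y \<odot> neg_part Y = 0"
          using pos_antisym s by fastforce
        then show False
          using \<open>neg_part Y \<noteq> 0\<close> norm_square[of "neg_part Y"] by simp
      qed
    qed
    then show "quad p y \<preceq> t *\<^sub>R p \<or> t *\<^sub>R p \<preceq> quad p y"
    proof
      assume "pos_part Y = 0"
      then have "neg_part Y = - Y" using pos_part_minus_neg_part[of Y] by (metis diff_0 minus_minus)
      then show ?thesis using neg_part_pos[of Y] by (simp add: Y_def)
    next
      assume "neg_part Y = 0"
      then have "pos_part Y = Y" using pos_part_minus_neg_part[of Y] by simp
      then show ?thesis using pos_part_pos[of Y] by (simp add: Y_def)
    qed
  qed
  then show ?thesis using p by (simp add: minimal_def)
qed

lemma minimal_below:
  assumes "minimal p" "pos a" "a \<preceq> p"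
  obtains t where "t \<ge> 0" "a = t *\<^sub>R p"
proof -
  have p: "projection p" "p \<noteq> 0" using assms by (auto simp: minimal_def)
  have "p \<odot> a = a" by (rule below_projection[where c = 1]) (use assms p in auto)
  then have "quad p a = a" by (rule quad_one[OF p(1)])
  then obtain t where "a = t *\<^sub>R p" using assms by (metis minimal_def)
  then show ?thesis using that pos_scale_projection[OF p] assms by blast
qed

text \<open>This closedness is what Baire's theorem needs. The scalars \<open>t n\<close> are
  bounded because each \<open>P n\<close> has norm 1, so replacing \<open>P n\<close> by
  \<open>p\<close> costs a null sequence, and \<open>t\<close> is Cauchy along with
  \<open>t n p\<close>.\<close>

lemma minimal_limit:
  assumes P: "\<And>n. minimal (P n)" and lim: "P \<longlonglongrightarrow> p"
  shows "minimal p"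
proof -
  have Pn: "projection (P n)" "norm (P n) = 1" for n
    using P[of n] norm_projection[of "P n"] by (auto simp: minimal_def)
  have "(\<lambda>n. P n \<odot> P n) \<longlonglongrightarrow> p \<odot> p" by (intro tendsto_intros lim)
  then have proj: "projection p" using lim Pn LIMSEQ_unique by (simp add: Pn(1))
  have "(\<lambda>n. norm (P n)) \<longlonglongrightarrow> norm p" by (intro tendsto_intros lim)
  then have "norm p = 1" using Pn LIMSEQ_unique[of "\<lambda>n. 1::real"] by auto
  then have p0: "p \<noteq> 0" by auto
  have "\<exists>t. quad p y = t *\<^sub>R p" for y
  proof -
    have "\<forall>n. \<exists>t. quad (P n) y = t *\<^sub>R P n" using P by (auto simp: minimal_def)
    then obtain t where t: "\<And>n. quad (P n) y = t n *\<^sub>R P n" by metis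
    have q: "(\<lambda>n. quad (P n) y) \<longlonglongrightarrow> quad p y"
      unfolding quad_def by (intro tendsto_intros lim)
    then have "Bseq (\<lambda>n. quad (P n) y)" using convergentI convergent_imp_Bseq by blast
    then have "Bseq t" unfolding Bseq_def t by (simp add: Pn)
    moreover have "(\<lambda>n. P n - p) \<longlonglongrightarrow> 0" using lim by (simp add: LIM_zero)
    ultimately have "(\<lambda>n. t n *\<^sub>R (P n - p)) \<longlonglongrightarrow> 0"
      using bounded_bilinear.Bfun_prod_Zfun[OF bounded_bilinear_scaleR, of t sequentially "\<lambda>n. P n - p"]
      by (simp add: tendsto_Zfun_iff)
    from tendsto_diff[OF q this] have tp: "(\<lambda>n. t n *\<^sub>R p) \<longlonglongrightarrow> quad p y"
      by (simp add: t scaleR_right_diff_distrib)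
    have "dist (t m *\<^sub>R p) (t n *\<^sub>R p) = dist (t m) (t n)" for m n
      by (simp add: dist_norm \<open>norm p = 1\<close> flip: scaleR_left_diff_distrib)
    then have "Cauchy t"
      using LIMSEQ_imp_Cauchy[OF tp] unfolding Cauchy_def by simp
    then obtain \<tau> where "t \<longlonglongrightarrow> \<tau>" using Cauchy_convergent_iff convergent_def by blast
    then have "(\<lambda>n. t n *\<^sub>R p) \<longlonglongrightarrow> \<tau> *\<^sub>R p" by (intro tendsto_intros)
    then show ?thesis using tp LIMSEQ_unique by blast
  qed
  then show ?thesis using proj p0 by (simp add: minimal_def)
qed

lemma minimal_reflect:
  assumes r: "projection r" and p: "minimal p"
  shows "minimal (reflect r p)"
proof -
  have q: "quad (reflect r p) y = reflect r (quad p (reflect r y))" for y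
  proof -
    have "reflect r (quad p (reflect r y))
        = reflect r (p \<odot> (p \<odot> reflect r y)) + reflect r (p \<odot> (p \<odot> reflect r y))
          + (-1) *\<^sub>R reflect r ((p \<odot> p) \<odot> reflect r y)"
      by (simp only: reflect_add[OF r, symmetric] reflect_scale[OF r, symmetric])
        (simp add: quad_def)
    then show ?thesis
      by (simp add: quad_def reflect_prod[OF r] reflect_reflect[OF r])
  qed
  have "reflect r p \<noteq> 0"
  proof
    assume "reflect r p = 0"
    then have "p = reflect r (0 *\<^sub>R p)" using reflect_reflect[OF r, of p] by simp
    then have "p = 0" unfolding reflect_scale[OF r] by simp
    then show False using p by (simp add: minimal_def)
  qed
  moreover have "projection (reflect r p)"
    using p reflect_prod[OF r, of p p] by (simp add: minimal_def)
  moreover have "\<exists>t. quad (reflect r p) y = t *\<^sub>R reflect r p" for y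
    using p unfolding q minimal_def by (metis reflect_scale[OF r])
  ultimately show ?thesis by (simp add: minimal_def)
qed

text \<open>With \<open>quad p (v \<odot> v) = t p\<close>, \<open>half_cube\<close> gives
  \<open>v\<^sup>3 = t v\<close>; norms in \<open>v\<^sup>4 = t v\<^sup>2\<close> give
  \<open>\<bar>t\<bar> = 1\<close>, and positivity gives \<open>t = 1\<close>.\<close>

lemma half_of_minimal:
  assumes p: "minimal p" and v: "p \<odot> v = (1 / 2) *\<^sub>R v" "norm v = 1"
  shows "p \<odot> (v \<odot> v) = p" "v \<odot> (v \<odot> v) = v" "projection (v \<odot> v - p)"
    "p \<odot> (v \<odot> v - p) = 0" "(v \<odot> v - p) \<odot> v = (1 / 2) *\<^sub>R v"
proof -
  have proj: "projection p" and p0: "p \<noteq> 0" using p by (auto simp: minimal_def)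
  obtain t where t: "quad p (v \<odot> v) = t *\<^sub>R p" using p by (auto simp: minimal_def)
  have even: "quad p (v \<odot> v) = p \<odot> (v \<odot> v)"
    by (rule quad_of_even[OF proj half_prod_half[OF proj v(1,1)]])
  have "(1 / 2) *\<^sub>R (v \<odot> (v \<odot> v)) = v \<odot> (t *\<^sub>R p)"
    using half_cube[OF proj v(1)] t even by simp
  also have "\<dots> = (1 / 2) *\<^sub>R (t *\<^sub>R v)"
    using v by (simp add: jdistrib jprod_commute[of v p])
  finally have cube: "v \<odot> (v \<odot> v) = t *\<^sub>R v" by (rule scaleR_left_imp_eq[rotated]) simp
  have fourth: "(v \<odot> v) \<odot> (v \<odot> v) = v \<odot> (v \<odot> (v \<odot> v))"
    by (rule gen_assoc[of _ v]) (auto intro: gen_self gen_prod)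
  then have "norm ((v \<odot> v) \<odot> (v \<odot> v)) = \<bar>t\<bar> * norm (v \<odot> v)"
    by (simp add: cube jdistrib)
  then have "\<bar>t\<bar> = 1" using v by (simp add: norm_square)
  moreover have "t \<ge> 0"
    using pos_scale_projection[OF proj p0] quad_pos[OF projection_pos[OF proj] pos_square[of v]] t by simp
  ultimately have "t = 1" by simp
  then show pv: "p \<odot> (v \<odot> v) = p" and vvv: "v \<odot> (v \<odot> v) = v"
    using t even cube by simp_all
  show "projection (v \<odot> v - p)"
    using pv proj fourth vvv by (simp add: jdistrib jprod_commute[of "v \<odot> v" p])
  show "p \<odot> (v \<odot> v - p) = 0" using pv proj by (simp add: jdistrib)
  have "(v \<odot> v - p) \<odot> v = v - (1 / 2) *\<^sub>R v"
    using vvv v by (simp add: jdistrib jprod_commute[of "v \<odot> v" v])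
  also have "\<dots> = (1 / 2) *\<^sub>R v" by (metis add_diff_cancel_left' scaleR_half_sum)
  finally show "(v \<odot> v - p) \<odot> v = (1 / 2) *\<^sub>R v" .
qed

text \<open>The span of \<open>p\<close>, \<open>w\<close>, \<open>v\<close> is a copy of the symmetric real two by two matrices, and
  \<open>rot c s\<close> is the projection onto the line spanned by \<open>(c, s)\<close>.\<close>

context
  fixes p w v :: 'a
  assumes mult: "p \<odot> p = p" "w \<odot> w = w" "p \<odot> w = 0" "v \<odot> v = p + w"
    "p \<odot> v = (1 / 2) *\<^sub>R v" "w \<odot> v = (1 / 2) *\<^sub>R v"
begin

definition sym2 :: "real \<Rightarrow> real \<Rightarrow> real \<Rightarrow> 'a" where
  "sym2 a b d = a *\<^sub>R p + b *\<^sub>R w + d *\<^sub>R v"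

lemma sym2_diff: "sym2 a b d - sym2 a' b' d' = sym2 (a - a') (b - b') (d - d')"
  and sym2_scale: "c *\<^sub>R sym2 a b d = sym2 (c * a) (c * b) (c * d)"
  by (simp_all add: sym2_def algebra_simps)

lemma sym2_prod:
  "sym2 a b d \<odot> sym2 a' b' d'
    = sym2 (a * a' + d * d') (b * b' + d * d') ((a + b) / 2 * d' + (a' + b') / 2 * d)"
proof -
  have mult': "w \<odot> p = 0" "v \<odot> p = (1 / 2) *\<^sub>R v" "v \<odot> w = (1 / 2) *\<^sub>R v"
    using mult by (simp_all add: jprod_commute[of w p] jprod_commute[of v p] jprod_commute[of v w])
  have "(a *\<^sub>R p + b *\<^sub>R w) \<odot> (a' *\<^sub>R p + b' *\<^sub>R w) = (a * a') *\<^sub>R p + (b * b') *\<^sub>R w"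
    by (simp add: jdistrib mult mult' mult.commute)
  moreover have "(a *\<^sub>R p + b *\<^sub>R w) \<odot> (d' *\<^sub>R v) = ((a + b) / 2 * d') *\<^sub>R v"
    by (simp add: jdistrib mult add_divide_distrib distrib_left distrib_right scaleR_left_distrib scaleR_right_distrib
        mult.commute)
  moreover have "(d *\<^sub>R v) \<odot> (a' *\<^sub>R p + b' *\<^sub>R w) = ((a' + b') / 2 * d) *\<^sub>R v"
    by (simp add: jdistrib mult' add_divide_distrib distrib_left distrib_right scaleR_left_distrib scaleR_right_distrib
        mult.commute)
  moreover have "(d *\<^sub>R v) \<odot> (d' *\<^sub>R v) = (d * d') *\<^sub>R p + (d * d') *\<^sub>R w"
    by (simp add: jdistrib mult scaleR_right_distrib mult.commute)
  moreover have "sym2 a b d \<odot> sym2 a' b' d'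
      = (a *\<^sub>R p + b *\<^sub>R w) \<odot> (a' *\<^sub>R p + b' *\<^sub>R w) + (a *\<^sub>R p + b *\<^sub>R w) \<odot> (d' *\<^sub>R v)
        + (d *\<^sub>R v) \<odot> (a' *\<^sub>R p + b' *\<^sub>R w) + (d *\<^sub>R v) \<odot> (d' *\<^sub>R v)"
    unfolding sym2_def by (simp only: jadd_left jadd_right ac_simps)
  ultimately show ?thesis by (simp add: sym2_def algebra_simps)
qed

definition rot :: "real \<Rightarrow> real \<Rightarrow> 'a" where
  "rot c s = sym2 (c * c) (s * s) (c * s)"

lemma projection_rot:
  assumes "c * c + s * s = 1"
  shows "projection (rot c s)"
proof -
  have "c * c * (c * c) + c * s * (c * s) = (c * c + s * s) * (c * c)"
    "s * s * (s * s) + c * s * (c * s) = (c * c + s * s) * (s * s)" by algebra+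
  then show ?thesis unfolding rot_def sym2_prod using assms by simp
qed

text \<open>Reflecting the line at angle 0 in the line at angle \<open>\<theta>\<close> gives the
  line at angle \<open>2 \<theta>\<close>. Rotated atoms are thus images of \<open>p\<close> under
  an automorphism, hence minimal again.\<close>

lemma reflect_rot:
  assumes cs: "c * c + s * s = 1"
  shows "reflect (rot c s) p = rot (c * c - s * s) (2 * c * s)"
proof -
  have p: "p = sym2 1 0 0" by (simp add: sym2_def)
  have 1: "rot c s \<odot> p = sym2 (c * c) 0 (c * s / 2)"
    by (subst p) (simp add: rot_def sym2_prod)
  have 2: "rot c s \<odot> (rot c s \<odot> p)
      = sym2 (c * c * (c * c) + c * s * (c * s / 2)) (c * s * (c * s / 2))
          (1 / 2 * (c * s / 2) + c * c / 2 * (c * s))"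
    unfolding 1 unfolding rot_def sym2_prod cs by simp
  define h where "h = half (rot c s) p"
  have h: "h = 4 *\<^sub>R (sym2 (c * c) 0 (c * s / 2) - sym2 (c * c * (c * c) + c * s * (c * s / 2)) (c * s * (c * s / 2))
          (1 / 2 * (c * s / 2) + c * c / 2 * (c * s)))"
    unfolding h_def half_def[OF projection_rot[OF cs]] 2 unfolding 1 ..
  have "reflect (rot c s) p = sym2 1 0 0 - h - h"
    unfolding h_def reflect_def[OF projection_rot[OF cs]] p[symmetric] ..
  also have "\<dots> = sym2 ((c * c - s * s) * (c * c - s * s)) (2 * c * s * (2 * c * s)) ((c * c - s * s) * (2 * c * s))"
  proof -
    let ?x = "c * c - (c * c * (c * c) + c * s * (c * s / 2))" and ?y = "0 - c * s * (c * s / 2)"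
    let ?z = "c * s / 2 - (1 / 2 * (c * s / 2) + c * c / 2 * (c * s))"
    have "2 * ?x = 2 * (c * c) - 2 * (c * c * (c * c)) - c * s * (c * s)"
      "2 * ?y = - (c * s * (c * s))" "4 * ?z = c * s - 2 * (c * c * (c * s))"
      by (simp_all add: field_simps)
    moreover have "1 - 4 * x - 4 * x = (c * c - s * s) * (c * c - s * s)"
      if "2 * x = 2 * (c * c) - 2 * (c * c * (c * c)) - c * s * (c * s)" for x
      using that cs by algebra
    moreover have "0 - 4 * y - 4 * y = 2 * c * s * (2 * c * s)" if "2 * y = - (c * s * (c * s))" for y
      using that by algebra
    moreover have "0 - 4 * z - 4 * z = (c * c - s * s) * (2 * c * s)"
      if "4 * z = c * s - 2 * (c * c * (c * s))" for z
      using that cs by algebra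
    ultimately have "1 - 4 * ?x - 4 * ?x = (c * c - s * s) * (c * c - s * s)"
      "0 - 4 * ?y - 4 * ?y = 2 * c * s * (2 * c * s)"
      "0 - 4 * ?z - 4 * ?z = (c * c - s * s) * (2 * c * s)" by blast+
    then show ?thesis unfolding h sym2_diff sym2_scale by (simp only:)
  qed
  finally show ?thesis by (simp add: rot_def)
qed

end

end

subsection \<open>The centre\<close>

context jb_unital
begin

abbreviation centre :: "'a set" where "centre \<equiv> jb_centre (\<odot>)"

lemma centre_iff: "z \<in> centre \<longleftrightarrow> (\<forall>x w. z \<odot> (x \<odot> w) = x \<odot> (z \<odot> w))"
  by (simp add: jb_centre_def operator_commute_def)

lemma centre_commute: "z \<in> centre \<Longrightarrow> z \<odot> (x \<odot> w) = x \<odot> (z \<odot> w)"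
  by (simp add: centre_iff)

lemma centre_assoc: "z \<in> centre \<Longrightarrow> (z \<odot> x) \<odot> w = z \<odot> (x \<odot> w)"
  using centre_commute[of z w x] by (simp add: jprod_commute)

lemma
  shows centre_unit: "e \<in> centre"
    and centre_zero: "0 \<in> centre"
    and centre_add: "a \<in> centre \<Longrightarrow> b \<in> centre \<Longrightarrow> a + b \<in> centre"
    and centre_diff: "a \<in> centre \<Longrightarrow> b \<in> centre \<Longrightarrow> a - b \<in> centre"
    and centre_scale: "a \<in> centre \<Longrightarrow> c *\<^sub>R a \<in> centre"
  by (simp_all add: centre_iff jdistrib)

lemma centre_prod: "a \<in> centre \<Longrightarrow> b \<in> centre \<Longrightarrow> a \<odot> b \<in> centre"
  unfolding centre_iff[of "a \<odot> b"] by (simp add: centre_assoc centre_commute)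

lemma centre_sum: "(\<And>i. i \<in> I \<Longrightarrow> f i \<in> centre) \<Longrightarrow> sum f I \<in> centre"
  by (induction I rule: infinite_finite_induct) (auto intro: centre_zero centre_add)

lemma subspace_centre: "subspace centre"
  by (auto intro!: subspaceI centre_zero centre_add centre_scale)

lemma closed_centre: "closed centre"
proof -
  have "centre = (\<Inter>x. \<Inter>w. {z. z \<odot> (x \<odot> w) = x \<odot> (z \<odot> w)})"
    by (auto simp: centre_iff)
  moreover have "closed {z. z \<odot> (x \<odot> w) = x \<odot> (z \<odot> w)}" for x w
    by (intro closed_Collect_eq continuous_intros)
  ultimately show ?thesis by (auto intro!: closed_INT)
qed

lemma gen_subset_centre: "z \<in> centre \<Longrightarrow> gen z \<subseteq> centre"
  by (rule gen_least) (auto simp: jb_subalgebra_def subspace_centre closed_centre centre_prod centre_unit)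

lemma quad_central: "projection z \<Longrightarrow> z \<in> centre \<Longrightarrow> quad z x = z \<odot> x"
  by (rule quad_of_even) (simp_all flip: centre_assoc)

lemma pos_central_prod: "projection z \<Longrightarrow> z \<in> centre \<Longrightarrow> pos x \<Longrightarrow> pos (z \<odot> x)"
  using quad_pos[of z x] projection_pos[of z] by (simp add: quad_central)

lemma central_prod_mono: "projection z \<Longrightarrow> z \<in> centre \<Longrightarrow> x \<preceq> y \<Longrightarrow> z \<odot> x \<preceq> z \<odot> y"
  using pos_central_prod[of z "y - x"] by (simp add: jdistrib)

lemma central_prod_le: "projection z \<Longrightarrow> z \<in> centre \<Longrightarrow> pos x \<Longrightarrow> z \<odot> x \<preceq> x"
  using pos_central_prod[of "e - z" x] projection_compl[of z] centre_diff[OF centre_unit, of z]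
  by (simp add: jdistrib)

text \<open>Without 1/2 components every \<open>x\<close> is a sum of elements with eigenvalues 1
  and 0 under \<open>z\<close>, and both kinds operator commute with \<open>z\<close>.\<close>

lemma central_of_no_half:
  assumes z: "projection z" and no_half: "\<And>u. z \<odot> u = (1 / 2) *\<^sub>R u \<Longrightarrow> u = 0"
  shows "z \<in> centre"
  unfolding centre_iff
proof (intro allI)
  fix x w
  have "half z x = 0" by (rule no_half[OF jprod_half[OF z]])
  then have "z \<odot> (z \<odot> x) = z \<odot> x" using even_minus_half[OF z, of x] by simp
  then have "z \<odot> ((z \<odot> x) \<odot> w) = (z \<odot> x) \<odot> (z \<odot> w)"
    and "z \<odot> ((x - z \<odot> x) \<odot> w) = (x - z \<odot> x) \<odot> (z \<odot> w)"
    using jprod_commute_one[OF z, of "z \<odot> x"] jprod_commute_zero[OF z, of "x - z \<odot> x"]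
    by (simp_all add: jdiff_right)
  then show "z \<odot> (x \<odot> w) = x \<odot> (z \<odot> w)" by (simp add: jdistrib)
qed

end

context jb_complete
begin

text \<open>Failure of the lower bound makes the positive part of \<open>c g - y\<close> non-zero. A
  projection \<open>s\<close> with a multiple below it is orthogonal to the negative part, so
  compression by \<open>s\<close> sees the positive part only.\<close>

lemma corner_projection_where_small:
  assumes g: "projection g" "g \<odot> y = y" and "\<not> (c *\<^sub>R g \<preceq> y)"
  obtains s where "projection s" "s \<noteq> 0" "g \<odot> s = s" "quad s y \<preceq> c *\<^sub>R s"
proof -
  define Y where "Y = c *\<^sub>R g - y"
  have "g \<odot> Y = Y" using g by (simp add: Y_def jdistrib)
  note parts = parts_in_corner[OF g(1) this]
  have "pos_part Y \<noteq> 0"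
  proof
    assume "pos_part Y = 0"
    then have "neg_part Y = - Y" using pos_part_minus_neg_part[of Y] by (metis diff_0 minus_minus)
    then have "pos (- Y)" using neg_part_pos[of Y] by simp
    with assms(3) show False by (simp add: Y_def)
  qed
  then obtain s \<delta> where s: "projection s" "s \<noteq> 0" "\<delta> > 0" "\<delta> *\<^sub>R s \<preceq> pos_part Y"
    using projection_below[OF pos_part_pos] by blast
  have ds: "pos (\<delta> *\<^sub>R s)" using s by (intro pos_scale[OF projection_pos]) auto
  have "g \<odot> (\<delta> *\<^sub>R s) = \<delta> *\<^sub>R s"
    using below_projection[OF g(1) ds le_trans[OF s(4) corner_le[OF g(1) parts(1)]]] .
  then have gs: "g \<odot> s = s" using s by (simp add: jdistrib)
  have "neg_part Y \<odot> (\<delta> *\<^sub>R s) = 0"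
  proof (rule pos_orth_mono[OF neg_part_pos ds s(4) pos_part_neg_part_orth])
    have "(neg_part Y \<odot> neg_part Y) \<odot> pos_part Y = neg_part Y \<odot> (neg_part Y \<odot> pos_part Y)"
      by (rule gen_assoc[of _ Y]) (auto intro!: fc_gen continuous_intros)
    then show "(neg_part Y \<odot> neg_part Y) \<odot> pos_part Y = 0" by (simp add: pos_part_neg_part_orth)
  qed
  then have "s \<odot> neg_part Y = 0" using s by (simp add: jdistrib jprod_commute[of s "neg_part Y"])
  then have "quad s (neg_part Y) = 0" by (rule quad_zero[OF s(1)])
  then have "quad s Y = quad s (pos_part Y)"
    using arg_cong[OF pos_part_minus_neg_part[of Y], of "quad s"] by (simp add: quad_diff_right)
  moreover have "pos (quad s (pos_part Y))" by (rule quad_pos[OF projection_pos[OF s(1)] pos_part_pos])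
  moreover have "quad s Y = c *\<^sub>R s - quad s y"
  proof -
    have "quad s g = s" using gs s by (simp add: quad_def jprod_commute[of s g])
    then show ?thesis by (simp add: Y_def quad_diff_right quad_scale_right)
  qed
  ultimately have "quad s y \<preceq> c *\<^sub>R s" by simp
  then show ?thesis using that s gs by blast
qed

text \<open>For minimal \<open>p\<close> these are projections orthogonal to \<open>p\<close>, by
  \<open>half_of_minimal\<close>; \<open>p\<close>, \<open>w\<close> and \<open>v\<close> span a
  copy of the symmetric two by two matrices, in which \<open>w\<close> is \<open>p\<close> rotated
  by a right angle.\<close>

definition linked :: "'a \<Rightarrow> 'a set" where
  "linked p = {v \<odot> v - p | v. p \<odot> v = (1 / 2) *\<^sub>R v \<and> norm v = 1}"

lemma linkedE:
  assumes "w \<in> linked p"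
  obtains v where "w = v \<odot> v - p" "p \<odot> v = (1 / 2) *\<^sub>R v" "norm v = 1"
proof -
  have "\<exists>v. w = v \<odot> v - p \<and> p \<odot> v = (1 / 2) *\<^sub>R v \<and> norm v = 1"
    using assms by (simp add: linked_def)
  then show ?thesis by (elim exE conjE) (rule that)
qed

lemma linked_projection:
  assumes "minimal p" "w \<in> linked p"
  shows "projection w" "p \<odot> w = 0"
  using assms half_of_minimal[OF assms(1)] by (auto simp: linked_def)

lemma linked_normalize:
  assumes "p \<odot> v = (1 / 2) *\<^sub>R v" "v \<noteq> 0"
  obtains u c where "p \<odot> u = (1 / 2) *\<^sub>R u" "norm u = 1" "u = c *\<^sub>R v" "c \<noteq> 0" "u \<odot> u - p \<in> linked p"
proof (rule that[of "inverse (norm v) *\<^sub>R v" "inverse (norm v)"])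
  show "p \<odot> (inverse (norm v) *\<^sub>R v) = (1 / 2) *\<^sub>R (inverse (norm v) *\<^sub>R v)"
    using assms by (simp add: jdistrib)
  then show "(inverse (norm v) *\<^sub>R v) \<odot> (inverse (norm v) *\<^sub>R v) - p \<in> linked p"
    unfolding linked_def using assms by force
qed (use assms in auto)

lemma orth_commute: "projection p \<Longrightarrow> p \<odot> q = 0 \<Longrightarrow> p \<odot> (q \<odot> w) = q \<odot> (p \<odot> w)"
  by (rule jprod_commute_zero)

text \<open>\<open>z\<close> is the complement of a maximal projection \<open>q\<close> orthogonal
  to \<open>p\<close> and to all that is linked to it. It is central because \<open>q\<close> has no
  1/2 component. The last clause, faithfulness below \<open>z\<close>, is what the lower bound on
  \<open>z\<close> rests on.\<close>

lemma minimal_central_cover: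
  assumes p: "minimal p"
  shows "\<exists>z. projection z \<and> z \<in> centre \<and> z \<odot> p = p \<and> (\<forall>w\<in>linked p. z \<odot> w = w)
    \<and> (\<forall>s. projection s \<longrightarrow> z \<odot> s = s \<longrightarrow> s \<odot> p = 0 \<longrightarrow> (\<forall>w\<in>linked p. s \<odot> w = 0) \<longrightarrow> s = 0)"
proof -
  have pp: "projection p" "p \<noteq> 0" using p by (auto simp: minimal_def)
  have W: "projection w" if "w \<in> insert p (linked p)" for w
    using that pp(1) linked_projection(1)[OF p] by (elim insertE) simp_all
  obtain q where q: "projection q" "\<forall>w\<in>insert p (linked p). q \<odot> w = 0"
    and q_max: "\<forall>s. projection s \<longrightarrow> s \<odot> q = 0 \<longrightarrow> (\<forall>w\<in>insert p (linked p). s \<odot> w = 0) \<longrightarrow> s = 0"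
    by (rule exE[OF maximal_orthogonal_projection[of "insert p (linked p)"]], erule W, elim conjE)
  have qp: "q \<odot> p = 0" and qw: "\<And>w. w \<in> linked p \<Longrightarrow> q \<odot> w = 0" using q by auto
  define z where "z = e - q"
  have z: "projection z" "z \<odot> p = p" "\<And>w. w \<in> linked p \<Longrightarrow> z \<odot> w = w"
    using projection_compl[OF q(1)] qp qw by (auto simp: z_def jdistrib)
  have qpc: "q \<odot> (p \<odot> x) = p \<odot> (q \<odot> x)" for x by (rule orth_commute[OF q(1) qp])
  \<comment> \<open>A normalized common 1/2 vector \<open>v\<close> of \<open>p\<close> and
    \<open>q\<close> is annihilated by \<open>z - p\<close>, whereas its linked \<open>w\<close>
    lies under \<open>z - p\<close>; Peirce orthogonality then contradicts
    \<open>w \<odot> v = (1/2) v\<close>.\<close>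
  have A: "u = 0" if u: "q \<odot> u = (1 / 2) *\<^sub>R u" "p \<odot> u = (1 / 2) *\<^sub>R u" for u
  proof (rule ccontr)
    assume "u \<noteq> 0"
    then obtain v c where v: "p \<odot> v = (1 / 2) *\<^sub>R v" "norm v = 1" and vc: "v = c *\<^sub>R u"
      and link: "v \<odot> v - p \<in> linked p"
      by (rule linked_normalize[OF u(2)])
    define w where "w = v \<odot> v - p"
    have w: "w \<in> linked p" "w \<odot> v = (1 / 2) *\<^sub>R v"
      unfolding w_def by (rule link, rule half_of_minimal(5)[OF p v])
    have "q \<odot> v = (1 / 2) *\<^sub>R v" unfolding vc using u by (simp add: jdistrib)
    then have "(z - p) \<odot> v = v - ((1 / 2) *\<^sub>R v + (1 / 2) *\<^sub>R v)"
      using v(1) by (simp add: z_def jdistrib)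
    then have "(z - p) \<odot> v = 0" unfolding scaleR_half_sum by simp
    moreover have "(z - p) \<odot> w = w"
      using z(3)[OF w(1)] linked_projection(2)[OF p w(1)] by (simp add: jdistrib)
    ultimately have "w \<odot> v = 0"
      by (rule one_prod_zero[OF projection_diff(1)[OF z(1) pp(1) z(2)], rotated])
    then show False using w(2) v(2) by auto
  qed
  \<comment> \<open>By \<open>A\<close> only the component \<open>q \<odot> v\<close> in the corner
    of \<open>q\<close> can survive; it is orthogonal to \<open>p\<close> and yet has eigenvalue 1/2
    under \<open>p\<close>.\<close>
  have B: "q \<odot> v = 0" if v: "p \<odot> v = (1 / 2) *\<^sub>R v" for v
  proof -
    have "p \<odot> half q v = (1 / 2) *\<^sub>R half q v"
      unfolding half_def[OF q(1)] by (simp add: jdistrib v scaleR_right_diff_distrib flip: qpc)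
    then have "half q v = 0" using A[OF jprod_half[OF q(1)]] by blast
    then have "q \<odot> (q \<odot> v) = q \<odot> v" using even_minus_half[OF q(1), of v] by simp
    then have "(q \<odot> v) \<odot> p = 0" by (rule one_prod_zero[OF q(1) _ qp])
    moreover have "p \<odot> (q \<odot> v) = (1 / 2) *\<^sub>R (q \<odot> v)" using v by (simp add: jdistrib flip: qpc)
    ultimately show ?thesis by (simp add: jprod_commute[of p])
  qed
  have "z \<in> centre"
  proof (rule central_of_no_half[OF z(1)])
    fix u assume zu: "z \<odot> u = (1 / 2) *\<^sub>R u"
    have "u - q \<odot> u = (1 / 2) *\<^sub>R u"
      using zu unfolding z_def jdiff_left unit_left .
    then have "q \<odot> u = u - (1 / 2) *\<^sub>R u" by (metis diff_diff_eq2 add_diff_cancel_left')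
    also have "\<dots> = (1 / 2) *\<^sub>R u" by (metis add_diff_cancel_left' scaleR_half_sum)
    finally have qu: "q \<odot> u = (1 / 2) *\<^sub>R u" .
    have pu: "p \<odot> u = 0"
    proof -
      have "p \<odot> half p u = (1 / 2) *\<^sub>R half p u" by (rule jprod_half[OF pp(1)])
      moreover have "q \<odot> half p u = (1 / 2) *\<^sub>R half p u"
        unfolding half_def[OF pp(1)] by (simp add: jdistrib qu qpc scaleR_right_diff_distrib)
      ultimately have "half p u = 0" using A by blast
      then have even: "p \<odot> (p \<odot> u) = p \<odot> u" using even_minus_half[OF pp(1), of u] by simp
      obtain t where t: "quad p u = t *\<^sub>R p" using p by (auto simp: minimal_def)
      then have "p \<odot> u = t *\<^sub>R p" using quad_of_even[OF pp(1) even] by simp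
      moreover have "q \<odot> (p \<odot> u) = (1 / 2) *\<^sub>R (p \<odot> u)" by (simp add: qpc qu jdistrib)
      ultimately show ?thesis by (simp add: jdistrib qp)
    qed
    \<comment> \<open>\<open>v \<odot> u\<close> is again a common 1/2 vector of \<open>p\<close>
      and \<open>q\<close>.\<close>
    have vu: "v \<odot> u = 0" if v: "p \<odot> v = (1 / 2) *\<^sub>R v" for v
    proof -
      have "p \<odot> (u \<odot> v) = (1 / 2) *\<^sub>R (u \<odot> v)"
        by (rule even_prod_odd[OF pp(1) _ v]) (simp add: pu)
      moreover have "q \<odot> (v \<odot> u) = (1 / 2) *\<^sub>R (v \<odot> u)"
        by (rule even_prod_odd[OF q(1) _ qu]) (simp add: B[OF v])
      ultimately show ?thesis using A by (simp add: jprod_commute[of u v])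
    qed
    have wu: "w \<odot> u = 0" if wl: "w \<in> linked p" for w
    proof -
      obtain v where v: "w = v \<odot> v - p" "p \<odot> v = (1 / 2) *\<^sub>R v" "norm v = 1"
        by (rule linkedE[OF wl])
      note w = linked_projection[OF p wl]
      have vv: "v \<odot> v = p + w" using v by simp
      have 1: "u \<odot> ((p + w) \<odot> w) = (p + w) \<odot> (u \<odot> w)"
        using jordan_commutator[of u v w] vu[OF v(2)] by (simp add: vv)
      have 2: "(p + w) \<odot> w = w" using w by (simp add: jdistrib)
      have 3: "p \<odot> (u \<odot> w) = 0"
        using jprod_commute_zero[OF pp(1) pu, of w] w by simp
      have "w \<odot> (w \<odot> u) = w \<odot> u"
        using 1 3 unfolding 2 by (simp add: jadd_left jprod_commute[of u w])
      moreover have "w \<odot> q = 0" using qw[OF wl] by (simp add: jprod_commute[of w q])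
      ultimately have "(w \<odot> u) \<odot> q = 0" by (rule one_prod_zero[OF w(1)])
      moreover have "q \<odot> (w \<odot> u) = (1 / 2) *\<^sub>R (w \<odot> u)"
        using orth_commute[OF q(1) qw[OF wl], of u] by (simp add: qu jdistrib)
      ultimately show ?thesis by (simp add: jprod_commute[of q])
    qed
    \<comment> \<open>The part of \<open>u \<odot> u\<close> under \<open>z\<close> is orthogonal to
      \<open>q\<close>, \<open>p\<close> and all linked projections, so maximality of
      \<open>q\<close> makes it vanish; \<open>half_eq_zero\<close> then gives
      \<open>u = 0\<close>.\<close>
    define b where "b = z \<odot> (u \<odot> u)"
    have "z \<odot> b = b" unfolding b_def by (rule half_prod_half[OF z(1) zu zu])
    then have "quad z (u \<odot> u) = b"
      unfolding b_def by (intro quad_of_even[OF z(1)])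
    then have b0: "pos b" using quad_pos[OF projection_pos[OF z(1)] pos_square] by metis
    have orth: "x \<odot> b = 0" if x: "projection x" "z \<odot> x = x" "x \<odot> u = 0" for x
    proof -
      have "x \<odot> (u \<odot> u) = 0" using jprod_commute_zero[OF x(1,3), of u] x by simp
      then show ?thesis using jprod_commute_one[OF z(1) x(2), of "u \<odot> u"] by (simp add: b_def)
    qed
    have "b = 0"
    proof (rule ccontr)
      assume "b \<noteq> 0"
      then obtain s \<delta> where s: "projection s" "s \<noteq> 0" "\<delta> > 0" "\<delta> *\<^sub>R s \<preceq> b"
        by (rule projection_below[OF b0])
      have "pos (inverse \<delta> *\<^sub>R (b - \<delta> *\<^sub>R s))" using s by (intro pos_scale) auto
      then have sb: "s \<preceq> inverse \<delta> *\<^sub>R b" using s by (simp add: scaleR_right_diff_distrib)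
      have s_orth: "s \<odot> x = 0" if "projection x" "x \<odot> b = 0" for x
        using projection_orth_mono[OF that projection_pos[OF s(1)] sb] by (simp add: jprod_commute)
      have "q \<odot> b = 0" using \<open>z \<odot> b = b\<close> by (simp add: z_def jdistrib)
      then have "s \<odot> q = 0" by (rule s_orth[OF q(1)])
      moreover have "s \<odot> w = 0" if "w \<in> insert p (linked p)" for w
      proof (cases "w = p")
        case True
        then show ?thesis using s_orth[OF pp(1) orth[OF pp(1) z(2) pu]] by simp
      next
        case False
        then have w: "w \<in> linked p" using that by simp
        show ?thesis
          by (rule s_orth[OF linked_projection(1)[OF p w] orth[OF linked_projection(1)[OF p w] z(3)[OF w] wu[OF w]]])
      qed
      ultimately have "s = 0" by (intro q_max[rule_format, OF s(1)])
      then show False using s by simp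
    qed
    then show "u = 0" using half_eq_zero[OF z(1) zu] by (simp add: b_def)
  qed
  moreover have "s = 0"
    if s: "projection s" "z \<odot> s = s" "s \<odot> p = 0" "\<forall>w\<in>linked p. s \<odot> w = 0" for s
  proof (rule q_max[rule_format, OF s(1)])
    show "s \<odot> q = 0" using s(2) by (simp add: z_def jdistrib jprod_commute[of s q])
    show "s \<odot> w = 0" if "w \<in> insert p (linked p)" for w
      using that s(3,4) by (elim insertE) simp_all
  qed
  ultimately show ?thesis
    using z by (intro exI[of _ z] conjI ballI allI impI)
qed

subsection \<open>Lower bounds on central summands\<close>

lemma centre_quad: "z \<in> centre \<Longrightarrow> z \<odot> quad a x = quad a (z \<odot> x)"
  by (simp add: quad_def jdistrib centre_commute[of z a] centre_commute[of z "a \<odot> a"])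

text \<open>The element is cut into Peirce blocks relative to \<open>p\<close>. The bound at
  \<open>p\<close> is assumed, the opposite block \<open>Y0\<close> is controlled through the linked
  projections, and \<open>quad_mix\<close> handles the 1/2 block that couples them.\<close>

lemma bounded_below_on_cover:
  assumes p: "minimal p"
    and z: "projection z" "z \<in> centre" "z \<odot> p = p" "\<forall>w\<in>linked p. z \<odot> w = w"
    and cover: "\<forall>s. projection s \<longrightarrow> z \<odot> s = s \<longrightarrow> s \<odot> p = 0 \<longrightarrow> (\<forall>w\<in>linked p. s \<odot> w = 0) \<longrightarrow> s = 0"
    and x: "pos x" "x \<preceq> e" and K: "K > 0" "p \<preceq> K *\<^sub>R x" "\<And>w. w \<in> linked p \<Longrightarrow> w \<preceq> K *\<^sub>R x"
  obtains c where "c > 0" "c *\<^sub>R z \<preceq> x"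
proof -
  have pp: "projection p" using p by (simp add: minimal_def)
  define X where "X = z \<odot> x"
  have zX: "z \<odot> X = X" unfolding X_def using z(1) by (simp flip: centre_assoc[OF z(2)])
  have X0: "pos X" "X \<preceq> x" unfolding X_def
    by (rule pos_central_prod[OF z(1,2) x(1)], rule central_prod_le[OF z(1,2) x(1)])
  have X1: "X \<preceq> e" using X0 x le_trans by blast
  have KX: "y \<preceq> K *\<^sub>R X" if "z \<odot> y = y" "y \<preceq> K *\<^sub>R x" for y
    using central_prod_mono[OF z(1,2) that(2)] that(1) by (simp add: X_def jdistrib)
  define z1 where "z1 = z - p"
  have z1: "projection z1" unfolding z1_def by (rule projection_diff[OF z(1) pp z(3)])
  have z1p: "z1 \<odot> p = 0" using z(3) pp by (simp add: z1_def jdistrib)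
  have zz1: "z \<odot> z1 = z1" using z(1,3) by (simp add: z1_def jdistrib)
  have ep: "projection (e - p)" by (rule projection_compl[OF pp])
  define Y0 where "Y0 = quad (e - p) X"
  have "p \<odot> Y0 = 0"
    using jprod_quad_projection[OF ep, of X] by (simp add: Y0_def jdistrib)
  moreover have "z \<odot> Y0 = Y0" unfolding Y0_def centre_quad[OF z(2)] zX ..
  ultimately have z1Y0: "z1 \<odot> Y0 = Y0" by (simp add: z1_def jdistrib)
  \<comment> \<open>The factor 4 leaves room for a contradiction: a projection on which
    \<open>Y0\<close> is below \<open>c1\<close> would force an element of norm at most
    \<open>K c1 = 1/4\<close> to have norm at least 1/2.\<close>
  define c1 where "c1 = 1 / (4 * K)"
  have c1: "c1 > 0" "K * c1 = 1 / 4" using K by (simp_all add: c1_def)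
  have lower: "c1 *\<^sub>R z1 \<preceq> Y0"
  proof (rule ccontr)
    assume "\<not> c1 *\<^sub>R z1 \<preceq> Y0"
    then obtain s where s: "projection s" "s \<noteq> 0" "z1 \<odot> s = s" "quad s Y0 \<preceq> c1 *\<^sub>R s"
      by (rule corner_projection_where_small[OF z1 z1Y0])
    have sz: "z \<odot> s = s" using s(3) zz1 centre_assoc[OF z(2), of z1 s] by simp
    have sp: "s \<odot> p = 0" by (rule one_prod_zero[OF z1 s(3) z1p])
    have spc: "s \<odot> (p \<odot> y) = p \<odot> (s \<odot> y)" for y by (rule orth_commute[OF s(1) sp])
    \<comment> \<open>A common unit 1/2 vector \<open>u\<close> of \<open>s\<close> and
      \<open>p\<close> gives \<open>b = s \<odot> (u \<odot> u)\<close> with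
      \<open>u \<odot> b = (1/2) u\<close>, so \<open>norm b \<ge> 1/2\<close>; but the bound on the
      linked projection of \<open>u\<close> yields \<open>b \<le> s / 4\<close>.\<close>
    have sv: "s \<odot> v = 0" if v: "p \<odot> v = (1 / 2) *\<^sub>R v" for v
    proof -
      have "half s v = 0"
      proof (rule ccontr)
        assume "half s v \<noteq> 0"
        moreover have "p \<odot> half s v = (1 / 2) *\<^sub>R half s v"
          unfolding half_def[OF s(1)] by (simp add: jdistrib v scaleR_right_diff_distrib flip: spc)
        ultimately obtain u c where u: "p \<odot> u = (1 / 2) *\<^sub>R u" "norm u = 1"
          and uc: "u = c *\<^sub>R half s v" and w: "u \<odot> u - p \<in> linked p"
          by (rule_tac linked_normalize[of p "half s v"])
        have su: "s \<odot> u = (1 / 2) *\<^sub>R u"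
          unfolding uc using jprod_half[OF s(1), of v] by (simp add: jdistrib)
        define b where "b = s \<odot> (u \<odot> u)"
        have qb: "quad s (u \<odot> u) = b"
          unfolding b_def by (rule quad_of_even[OF s(1) half_prod_half[OF s(1) su su]])
        have b0: "pos b" using quad_pos[OF projection_pos[OF s(1)] pos_square[of u]] qb by simp
        have "(e - p) \<odot> (u \<odot> u - p) = u \<odot> u - p"
          using linked_projection(2)[OF p w] by (simp add: jdiff_left)
        then have "quad (e - p) (u \<odot> u - p) = u \<odot> u - p" by (rule quad_one[OF ep])
        moreover have "u \<odot> u - p \<preceq> K *\<^sub>R X" by (rule KX[OF bspec[OF z(4) w] K(3)[OF w]])
        then have "quad (e - p) (u \<odot> u - p) \<preceq> quad (e - p) (K *\<^sub>R X)"
          by (rule quad_mono[OF projection_pos[OF ep]])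
        ultimately have "u \<odot> u - p \<preceq> K *\<^sub>R Y0" by (simp add: Y0_def quad_scale_right)
        then have "quad s (u \<odot> u - p) \<preceq> quad s (K *\<^sub>R Y0)"
          by (rule quad_mono[OF projection_pos[OF s(1)]])
        moreover have "quad s (u \<odot> u - p) = b"
          using qb quad_zero[OF s(1) sp] by (simp add: quad_diff_right)
        ultimately have "b \<preceq> K *\<^sub>R quad s Y0" by (simp add: quad_scale_right)
        moreover have "pos (K *\<^sub>R (c1 *\<^sub>R s - quad s Y0))" using K s(4) by (intro pos_scale) auto
        ultimately have "pos (K *\<^sub>R quad s Y0 - b + K *\<^sub>R (c1 *\<^sub>R s - quad s Y0))" by (rule pos_add)
        then have "b \<preceq> (1 / 4) *\<^sub>R s" by (simp add: scaleR_right_diff_distrib c1)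
        then have "norm b \<le> norm ((1 / 4) *\<^sub>R s)" by (rule norm_mono[OF b0])
        then have "norm b \<le> 1 / 4" using norm_projection_le[OF s(1)] by simp
        moreover have "u \<odot> b = (1 / 2) *\<^sub>R u"
          unfolding b_def half_cube[OF s(1) su] half_of_minimal(2)[OF p u] ..
        then have "1 / 2 \<le> norm u * norm b"
          using norm_jprod_le[of u b] u(2) by simp
        ultimately show False using u(2) by simp
      qed
      then have "s \<odot> (s \<odot> v) = s \<odot> v" using even_minus_half[OF s(1), of v] by simp
      then have "(s \<odot> v) \<odot> p = 0" by (rule one_prod_zero[OF s(1) _ sp])
      moreover have "p \<odot> (s \<odot> v) = (1 / 2) *\<^sub>R (s \<odot> v)" using v by (simp add: jdistrib flip: spc)
      ultimately show ?thesis by (simp add: jprod_commute[of p "s \<odot> v"])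
    qed
    have "s \<odot> w = 0" if wl: "w \<in> linked p" for w
    proof -
      obtain v where v: "w = v \<odot> v - p" "p \<odot> v = (1 / 2) *\<^sub>R v" "norm v = 1"
        by (rule linkedE[OF wl])
      have "s \<odot> (v \<odot> v) = 0"
        using jprod_commute_zero[OF s(1) sv[OF v(2)], of v] sv[OF v(2)] by simp
      then show ?thesis using v(1) sp by (simp add: jdistrib)
    qed
    then have "s = 0" by (rule cover[rule_format, OF s(1) sz sp])
    then show False using s(2) by simp
  qed
  \<comment> \<open>\<open>X\<close> dominates \<open>p / K = 2 a p\<close>, which is set aside: one
    \<open>a p\<close> pays for the enlarged weight of the block at \<open>p\<close>, the other
    becomes the lower bound there.\<close>
  define a where "a = 1 / (2 * K)"
  have a: "a > 0" "a + a = 1 / K" using K by (simp_all add: a_def)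
  define y where "y = X - (a *\<^sub>R p + a *\<^sub>R p)"
  have "pos ((1 / K) *\<^sub>R (K *\<^sub>R X - p))"
    using K KX[OF z(3) K(2)] by (intro pos_scale) auto
  moreover have "(1 / K) *\<^sub>R (K *\<^sub>R X - p) = y"
    using K unfolding y_def scaleR_left_distrib[symmetric] a(2) by (simp add: scaleR_right_diff_distrib)
  ultimately have y0: "pos y" by simp
  have "pos (a *\<^sub>R p + a *\<^sub>R p + (e - X))"
    using a(1) X1 pp by (intro pos_add pos_scale[OF projection_pos]) auto
  then have y1: "y \<preceq> e" by (simp add: y_def algebra_simps)
  have "quad p y \<preceq> quad p e" by (rule quad_mono[OF projection_pos[OF pp] y1])
  then have qpy: "quad p y \<preceq> p" using pp by (simp add: quad_unit_right)
  have qepy: "quad (e - p) y = Y0"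
    using quad_zero[OF ep, of p] pp by (simp add: y_def Y0_def quad_diff_right quad_add_right quad_scale_right jdistrib)
  have ysum: "y = quad p y + half p y + Y0"
    using quad_compl[OF pp, of y] qepy by (simp add: algebra_simps)
  define A where "A = 1 + a"
  define B where "B = 1 / A"
  have A: "A > 0" "B > 0" "B < 1" using a by (simp_all add: A_def B_def)
  \<comment> \<open>Weights with product 1 leave the 1/2 block untouched. Raising the weight at
    \<open>p\<close> to \<open>1 + a\<close> lowers that of \<open>Y0\<close> to
    \<open>B < 1\<close>, and the freed \<open>(1 - B) Y0\<close> supplies the bound on
    \<open>z1\<close>.\<close>
  have "pos (quad (sqrt A *\<^sub>R p + sqrt B *\<^sub>R (e - p)) y)"
    using A by (intro quad_pos pos_add pos_scale projection_pos[OF pp] projection_pos[OF ep] y0) auto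
  moreover have "sqrt A * sqrt A = A" "sqrt A * sqrt B = 1" "sqrt B * sqrt B = B"
    using A by (simp_all add: B_def real_sqrt_divide)
  ultimately have mix: "pos (A *\<^sub>R quad p y + half p y + B *\<^sub>R Y0)"
    unfolding quad_mix[OF pp] qepy by simp
  define c where "c = min a ((1 - B) * c1)"
  have c: "c > 0" "c \<le> a" "c \<le> (1 - B) * c1" using a A c1 by (auto simp: c_def)
  have "X - c *\<^sub>R z = (A *\<^sub>R quad p y + half p y + B *\<^sub>R Y0) + (1 - B) *\<^sub>R (Y0 - c1 *\<^sub>R z1)
      + a *\<^sub>R (p - quad p y) + (a - c) *\<^sub>R p + ((1 - B) * c1 - c) *\<^sub>R z1"
  proof -
    have "X = quad p y + half p y + Y0 + (a *\<^sub>R p + a *\<^sub>R p)"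
      using ysum by (metis y_def diff_add_cancel)
    moreover have "z = p + z1" by (simp add: z1_def)
    ultimately show ?thesis by (simp add: A_def algebra_simps)
  qed
  moreover have "pos ((1 - B) *\<^sub>R (Y0 - c1 *\<^sub>R z1))" using A lower by (intro pos_scale) auto
  moreover have "pos (a *\<^sub>R (p - quad p y))" using a qpy by (intro pos_scale) auto
  moreover have "pos ((a - c) *\<^sub>R p)" "pos (((1 - B) * c1 - c) *\<^sub>R z1)"
    using c by (intro pos_scale projection_pos[OF pp] projection_pos[OF z1]; simp)+
  ultimately have "c *\<^sub>R z \<preceq> X"
    using mix by (metis pos_add)
  then show ?thesis using that[OF c(1)] X0 le_trans by blast
qed

text \<open>Small rotations of \<open>p\<close> towards \<open>w\<close> and towards its mirror image average to a combination of
  \<open>p\<close> and \<open>w\<close>, with a coefficient of \<open>w\<close> that does not depend on \<open>w\<close>.\<close>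

lemma linked_bounded:
  assumes p: "minimal p" and g: "g \<in> centre" "g \<odot> p = 0" and \<delta>: "\<delta> > 0" and K: "K > 0"
    and near: "\<forall>r. minimal r \<longrightarrow> g \<odot> r = 0 \<longrightarrow> norm (r - p) < \<delta> \<longrightarrow> r \<preceq> K *\<^sub>R x"
  shows "\<exists>K'>0. \<forall>w\<in>linked p. w \<preceq> K' *\<^sub>R x"
proof -
  have pp: "projection p" "p \<noteq> 0" using p by (simp_all add: minimal_def)
  \<comment> \<open>\<open>C\<close> and \<open>S\<close> are cosine and sine of the doubled angle.
    Since \<open>S \<le> 2 s\<close>, a rotated atom differs from \<open>p\<close> by at most
    \<open>3 S \<le> \<delta> / 2\<close>; the bound \<open>1 / 2\<close> keeps \<open>c\<close>
    positive.\<close>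
  define s where "s = min (1 / 2) (\<delta> / 12)"
  define c where "c = sqrt (1 - s * s)"
  define S where "S = 2 * c * s"
  define C where "C = c * c - s * s"
  have s: "0 < s" "s \<le> 1 / 2" "12 * s \<le> \<delta>" using \<delta> by (auto simp: s_def)
  have "s * s \<le> 1 / 2 * (1 / 2)" using s by (intro mult_mono) auto
  then have c: "c * c + s * s = 1" "c > 0" by (simp_all add: c_def)
  have "c \<le> 1" by (simp add: c_def)
  then have S: "0 < S" "S \<le> 2 * s" using c s by (simp_all add: S_def)
  have CS: "C * C + S * S = 1" unfolding C_def S_def using c(1) by algebra
  have "S * S \<le> S * 1" using S s by (intro mult_left_mono) auto
  have "C * C \<le> 1" using CS zero_le_square[of S] by linarith
  then have absC: "\<bar>C\<bar> \<le> 1" by (simp add: abs_square_le_1 flip: power2_eq_square)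
  have "w \<preceq> (K / (S * S)) *\<^sub>R x" if wl: "w \<in> linked p" for w
  proof -
    obtain v where v: "w = v \<odot> v - p" "p \<odot> v = (1 / 2) *\<^sub>R v" "norm v = 1"
      by (rule linkedE[OF wl])
    note hm = half_of_minimal[OF p v(2,3), folded v(1)]
    have ww: "projection w" "p \<odot> w = 0" "w \<odot> v = (1 / 2) *\<^sub>R v" by (fact hm)+
    have vv: "v \<odot> v = p + w" using v(1) by simp
    note mult = pp(1) ww(1,2) vv v(2) ww(3)
    have "(1 / 2) *\<^sub>R (g \<odot> v) = 0"
      using centre_commute[OF g(1), of v p] g(2) v(2) by (simp add: jdistrib jprod_commute[of v p])
    then have gv: "g \<odot> v = 0" by simp
    then have gw: "g \<odot> w = 0"
      using centre_commute[OF g(1), of v v] g(2) unfolding v(1) by (simp add: jdiff_right)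
    have bound: "rot p w v C t \<preceq> K *\<^sub>R x" if t: "rot p w v C t = reflect (rot p w v c t') p"
      "c * c + t' * t' = 1" "\<bar>t\<bar> = S" for t t'
    proof (rule near[rule_format])
      show "minimal (rot p w v C t)"
        unfolding t(1) by (rule minimal_reflect[OF projection_rot[OF mult t(2)] p])
      show "g \<odot> rot p w v C t = 0"
        by (simp add: rot_def[OF mult] sym2_def[OF mult] jdistrib g gv gw)
      have tt: "t * t = S * S" using t(3) by (metis abs_mult_self_eq)
      have "rot p w v C t - p = - ((S * S) *\<^sub>R p) + (S * S) *\<^sub>R w + (C * t) *\<^sub>R v"
      proof -
        have "C * C = 1 - S * S" using CS by simp
        then show ?thesis
          by (simp add: rot_def[OF mult] sym2_def[OF mult] tt scaleR_left_diff_distrib)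
      qed
      then have "norm (rot p w v C t - p) \<le> norm ((S * S) *\<^sub>R p) + norm ((S * S) *\<^sub>R w) + norm ((C * t) *\<^sub>R v)"
        using norm_triangle_ineq[of "- ((S * S) *\<^sub>R p) + (S * S) *\<^sub>R w" "(C * t) *\<^sub>R v"]
          norm_triangle_ineq[of "- ((S * S) *\<^sub>R p)" "(S * S) *\<^sub>R w"] by simp
      also have "\<dots> \<le> S + S + S"
      proof (intro add_mono)
        show "norm ((S * S) *\<^sub>R p) \<le> S" "norm ((S * S) *\<^sub>R w) \<le> S"
          using norm_projection_le[OF pp(1)] norm_projection_le[OF ww(1)] \<open>S * S \<le> S * 1\<close>
            mult_left_le[of _ "S * S"] by (force intro: order_trans)+
        show "norm ((C * t) *\<^sub>R v) \<le> S"
          using absC S t(3) v(3) mult_right_mono[of "\<bar>C\<bar>" 1 S] by (simp add: abs_mult)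
      qed
      also have "\<dots> < \<delta>" using S s by simp
      finally show "norm (rot p w v C t - p) < \<delta>" .
    qed
    have 1: "rot p w v C S \<preceq> K *\<^sub>R x"
      by (rule bound[of S s]) (use reflect_rot[OF mult c(1)] c S in \<open>simp_all add: C_def S_def\<close>)
    have 2: "rot p w v C (- S) \<preceq> K *\<^sub>R x"
      by (rule bound[of "- S" "- s"]) (use reflect_rot[OF mult, of c "- s"] c S in \<open>simp_all add: C_def S_def\<close>)
    have "pos ((C * C) *\<^sub>R p)" by (rule pos_scale[OF projection_pos[OF pp(1)]]) simp
    \<comment> \<open>The \<open>v\<close> terms of the two rotations cancel and their
      \<open>p\<close> terms are given back, so \<open>2 S\<^sup>2 w\<close> remains against
      \<open>2 K x\<close>.\<close>
    then have "pos (((K *\<^sub>R x - rot p w v C S) + (K *\<^sub>R x - rot p w v C (- S))) + ((C * C) *\<^sub>R p + (C * C) *\<^sub>R p))"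
      using 1 2 by (intro pos_add)
    also have "((K *\<^sub>R x - rot p w v C S) + (K *\<^sub>R x - rot p w v C (- S))) + ((C * C) *\<^sub>R p + (C * C) *\<^sub>R p)
        = 2 *\<^sub>R (K *\<^sub>R x - (S * S) *\<^sub>R w)"
      by (simp add: rot_def[OF mult] sym2_def[OF mult] scaleR_2)
    finally have "pos (K *\<^sub>R x - (S * S) *\<^sub>R w)" using pos_scale_iff[of 2] by simp
    then have "pos ((1 / (S * S)) *\<^sub>R (K *\<^sub>R x - (S * S) *\<^sub>R w))" by (intro pos_scale) auto
    then show ?thesis using S by (simp add: scaleR_right_diff_distrib)
  qed
  moreover have "K / (S * S) > 0" using K S by simp
  ultimately show ?thesis by blast
qed

text \<open>Only atoms annihilated by \<open>g\<close> are considered, so that the argument can be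
  repeated in the complement of the summands already treated.\<close>

lemma minimal_ball_bound:
  assumes atomic: "\<And>g. projection g \<Longrightarrow> g \<noteq> 0 \<Longrightarrow> \<exists>a. minimal a \<and> g \<odot> a = a"
    and g: "projection g" "g \<noteq> e" and x: "pos x"
    and ptw: "\<And>p. minimal p \<Longrightarrow> \<exists>t>0. t *\<^sub>R p \<preceq> x"
  shows "\<exists>p \<delta> K. minimal p \<and> g \<odot> p = 0 \<and> \<delta> > 0 \<and> K > 0
    \<and> (\<forall>r. minimal r \<longrightarrow> g \<odot> r = 0 \<longrightarrow> norm (r - p) < \<delta> \<longrightarrow> r \<preceq> K *\<^sub>R x)"
proof -
  define M where "M = {p. minimal p \<and> g \<odot> p = 0}"
  define F where "F n = {p \<in> M. p \<preceq> real (Suc n) *\<^sub>R x}" for n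
  have M_limit: "p \<in> M" if "\<And>n. f n \<in> M" "f \<longlonglongrightarrow> p" for f p
  proof -
    have "minimal p" by (rule minimal_limit[OF _ that(2)]) (use that(1) in \<open>simp add: M_def\<close>)
    moreover have "(\<lambda>n. g \<odot> f n) \<longlonglongrightarrow> g \<odot> p" by (intro tendsto_intros that)
    then have "g \<odot> p = 0"
      using that(1) LIMSEQ_unique[of "\<lambda>n. g \<odot> f n" 0 "g \<odot> p"] by (simp add: M_def)
    ultimately show ?thesis by (simp add: M_def)
  qed
  then have closed_M: "closed M" unfolding closed_sequential_limits by blast
  have closed_F: "closed (F n)" for n
    unfolding closed_sequential_limits
  proof (intro allI impI, elim conjE)
    fix f p assume f: "\<forall>k. f k \<in> F n" "f \<longlonglongrightarrow> p"
    have "p \<in> M" by (rule M_limit[OF _ f(2)]) (use f(1) in \<open>simp add: F_def\<close>)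
    moreover have "p \<preceq> real (Suc n) *\<^sub>R x"
    proof (rule pos_limit)
      show "(\<lambda>k. real (Suc n) *\<^sub>R x - f k) \<longlonglongrightarrow> real (Suc n) *\<^sub>R x - p"
        by (intro tendsto_intros f)
    qed (use f(1) in \<open>simp add: F_def\<close>)
    ultimately show "p \<in> F n" by (simp add: F_def)
  qed
  have M_cover: "M = (\<Union>n. F n)"
  proof -
    have "\<exists>n. p \<in> F n" if p: "p \<in> M" for p
    proof -
      obtain t where t: "t > 0" "t *\<^sub>R p \<preceq> x" using ptw p by (auto simp: M_def)
      obtain n where n: "1 / t \<le> real n" using real_arch_simple by blast
      have "pos ((1 / t) *\<^sub>R (x - t *\<^sub>R p) + (real (Suc n) - 1 / t) *\<^sub>R x)"
        using t n x by (intro pos_add pos_scale) auto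
      then have "p \<preceq> real (Suc n) *\<^sub>R x"
        using t by (simp add: scaleR_right_diff_distrib scaleR_left_diff_distrib)
      then show ?thesis using p by (auto simp: F_def)
    qed
    then show ?thesis by (auto simp: F_def)
  qed
  have "\<exists>n. (top_of_set M) interior_of (F n) \<noteq> {}"
  proof (rule ccontr)
    assume none: "\<not> ?thesis"
    have "(top_of_set M) interior_of (\<Union>(range F)) = {}"
    proof (intro Baire_category_alt disjI1)
      show "completely_metrizable_space (top_of_set M)"
        using closed_M closed_closedin completely_metrizable_space_closedin
          completely_metrizable_space_euclidean by blast
      fix T assume "T \<in> range F"
      then show "closedin (top_of_set M) T \<and> top_of_set M interior_of T = {}"
        using none closed_F by (auto intro!: closed_subset simp: F_def)
    qed auto
    moreover have "(top_of_set M) interior_of M = M"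
      by (metis interior_of_topspace topspace_euclidean_subtopology)
    ultimately have "M = {}" using M_cover by simp
    moreover have eg: "projection (e - g)" "e - g \<noteq> 0"
      using projection_compl[OF g(1)] g(2) by simp_all
    obtain a where "minimal a" "(e - g) \<odot> a = a"
      using atomic[OF eg] by (elim exE conjE) (rule that)
    then have "a \<in> M" by (simp add: M_def jdistrib)
    ultimately show False by simp
  qed
  then obtain n p where p: "p \<in> (top_of_set M) interior_of (F n)" by blast
  have "openin (top_of_set M) ((top_of_set M) interior_of (F n))" by (rule openin_interior_of)
  then obtain \<delta> where \<delta>: "\<delta> > 0" "ball p \<delta> \<inter> M \<subseteq> (top_of_set M) interior_of (F n)"
    using p unfolding openin_contains_ball by blast
  have sub: "ball p \<delta> \<inter> M \<subseteq> F n" by (rule subset_trans[OF \<delta>(2) interior_of_subset])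
  have "p \<in> M" using p interior_of_subset[of "top_of_set M" "F n"] by (auto simp: F_def)
  moreover have "r \<preceq> real (Suc n) *\<^sub>R x" if "minimal r" "g \<odot> r = 0" "norm (r - p) < \<delta>" for r
  proof -
    have "r \<in> ball p \<delta> \<inter> M" using that by (simp add: M_def dist_norm norm_minus_commute)
    then show ?thesis using sub by (auto simp: F_def)
  qed
  ultimately show ?thesis
    using \<delta>(1) by (intro exI[of _ p] exI[of _ \<delta>] exI[of _ "real (Suc n)"]) (simp add: M_def)
qed

lemma bounded_below_on_summand:
  assumes atomic: "\<And>g. projection g \<Longrightarrow> g \<noteq> 0 \<Longrightarrow> \<exists>a. minimal a \<and> g \<odot> a = a"
    and g: "projection g" "g \<in> centre" "g \<noteq> e" and x: "pos x" "x \<preceq> e"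
    and ptw: "\<And>p. minimal p \<Longrightarrow> \<exists>t>0. t *\<^sub>R p \<preceq> x"
  obtains z c where "projection z" "z \<in> centre" "z \<noteq> 0" "z \<odot> g = 0" "c > 0" "c *\<^sub>R z \<preceq> x"
proof -
  have "\<exists>p \<delta> K. minimal p \<and> g \<odot> p = 0 \<and> \<delta> > 0 \<and> K > 0
      \<and> (\<forall>r. minimal r \<longrightarrow> g \<odot> r = 0 \<longrightarrow> norm (r - p) < \<delta> \<longrightarrow> r \<preceq> K *\<^sub>R x)"
    by (rule minimal_ball_bound[OF atomic g(1,3) x(1) ptw])
  then obtain p \<delta> K where p: "minimal p" "g \<odot> p = 0" and \<delta>: "\<delta> > 0" and K: "K > 0"
    and near: "\<forall>r. minimal r \<longrightarrow> g \<odot> r = 0 \<longrightarrow> norm (r - p) < \<delta> \<longrightarrow> r \<preceq> K *\<^sub>R x"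
    by (elim exE conjE)
  obtain K1 where K1: "K1 > 0" "\<forall>w\<in>linked p. w \<preceq> K1 *\<^sub>R x"
    using linked_bounded[OF p(1) g(2) p(2) \<delta> K near] by (elim exE conjE) (rule that)
  have pK: "p \<preceq> K *\<^sub>R x" using near p \<delta> by simp
  have mono: "y \<preceq> max K K1 *\<^sub>R x" if "y \<preceq> k *\<^sub>R x" "k \<le> max K K1" for y k
  proof -
    have "pos (k *\<^sub>R x - y + (max K K1 - k) *\<^sub>R x)" using that x by (intro pos_add pos_scale) auto
    then show ?thesis by (simp add: algebra_simps)
  qed
  obtain z where z: "projection z" "z \<in> centre" "z \<odot> p = p" "\<forall>w\<in>linked p. z \<odot> w = w"
    and cover: "\<forall>s. projection s \<longrightarrow> z \<odot> s = s \<longrightarrow> s \<odot> p = 0 \<longrightarrow> (\<forall>w\<in>linked p. s \<odot> w = 0) \<longrightarrow> s = 0"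
    by (rule exE[OF minimal_central_cover[OF p(1)]]) (elim conjE, rule that)
  have "max K K1 > 0" using K by simp
  then obtain c where c: "c > 0" "c *\<^sub>R z \<preceq> x"
  proof (rule bounded_below_on_cover[OF p(1) z cover x])
    show "p \<preceq> max K K1 *\<^sub>R x" by (rule mono[OF pK]) simp
    show "w \<preceq> max K K1 *\<^sub>R x" if "w \<in> linked p" for w by (rule mono[OF bspec[OF K1(2) that]]) simp
  qed
  \<comment> \<open>The cover of \<open>p\<close> may overlap \<open>g\<close>; its part outside
    \<open>g\<close> is still non-zero because it contains \<open>p\<close>.\<close>
  define z' where "z' = z \<odot> (e - g)"
  have z'_alt: "z' = z - z \<odot> g" by (simp add: z'_def jdistrib)
  have gc: "e - g \<in> centre" by (intro centre_diff centre_unit g)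
  have z'c: "z' \<in> centre" unfolding z'_def by (rule centre_prod[OF z(2) gc])
  have zz': "z \<odot> z' = z'" unfolding z'_def using z(1) by (simp flip: centre_assoc[OF z(2)])
  have gz': "(e - g) \<odot> z' = z'"
    unfolding z'_def centre_commute[OF gc] projection_compl[OF g(1)] ..
  have z'z': "projection z'"
    using centre_assoc[OF z(2), of "e - g" z'] gz' zz' by (simp add: z'_def)
  have "z' \<preceq> z" by (rule projection_diff(2)[OF z(1) z'z' zz'])
  then have "pos (c *\<^sub>R (z - z') + (x - c *\<^sub>R z))" using c by (intro pos_add pos_scale) auto
  then have "c *\<^sub>R z' \<preceq> x" by (simp add: algebra_simps)
  moreover have "z' \<odot> g = 0" using gz' by (simp add: jdistrib jprod_commute[of z' g])
  moreover have "z' \<odot> p = p" using centre_assoc[OF z(2), of "e - g" p] p(2) z(3) by (simp add: z'_def jdistrib)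
  then have "z' \<noteq> 0" using p(1) by (auto simp: minimal_def)
  ultimately show ?thesis using that[OF z'z' z'c] c(1) by simp
qed

lemma orthogonal_projections_independent:
  assumes Z: "\<And>z. z \<in> Z \<Longrightarrow> projection z \<and> z \<noteq> 0"
    and orth: "\<And>z z'. z \<in> Z \<Longrightarrow> z' \<in> Z \<Longrightarrow> z \<noteq> z' \<Longrightarrow> z \<odot> z' = 0"
  shows "independent Z"
  unfolding dependent_explicit
proof clarify
  fix t u v assume t: "finite t" "t \<subseteq> Z" "(\<Sum>z\<in>t. u z *\<^sub>R z) = 0" and v: "v \<in> t" "u v \<noteq> 0"
  have "v \<odot> (\<Sum>z\<in>t. u z *\<^sub>R z) = (\<Sum>z\<in>t. v \<odot> (u z *\<^sub>R z))"
    by (rule linear_sum[OF bounded_linear.linear[OF bounded_linear_jprod]])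
  also have "\<dots> = (\<Sum>z\<in>t. if z = v then u v *\<^sub>R v else 0)"
  proof (rule sum.cong)
    fix z assume "z \<in> t"
    then show "v \<odot> (u z *\<^sub>R z) = (if z = v then u v *\<^sub>R v else 0)"
      using Z[of v] orth[of v z] t(2) v(1) by (cases "z = v") (auto simp: jdistrib)
  qed simp
  also have "\<dots> = u v *\<^sub>R v" using t v by simp
  finally have "u v *\<^sub>R v = 0" using t by simp
  then show False using v Z[of v] t(2) by auto
qed

text \<open>Orthogonal non-zero central projections are linearly independent, so a family with a
  common lower bound has at most \<open>card B\<close> members. One of maximal size sums to
  \<open>e\<close>: otherwise the complement yields a further summand, and the smaller of the two
  constants serves both.\<close>

theorem invertible_of_pointwise_bound:
  assumes atomic: "\<And>g. projection g \<Longrightarrow> g \<noteq> 0 \<Longrightarrow> \<exists>a. minimal a \<and> g \<odot> a = a"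
    and fin: "finite_dimensional centre" and x: "pos x" "x \<preceq> e"
    and ptw: "\<And>p. minimal p \<Longrightarrow> \<exists>t>0. t *\<^sub>R p \<preceq> x"
  shows "\<exists>c>0. c *\<^sub>R e \<preceq> x"
proof -
  obtain B where B: "finite B" "span B = centre" using fin by (auto simp: finite_dimensional_def)
  define good where "good Z \<longleftrightarrow> finite Z \<and> (\<forall>z\<in>Z. projection z \<and> z \<in> centre \<and> z \<noteq> 0)
    \<and> (\<forall>z\<in>Z. \<forall>z'\<in>Z. z \<noteq> z' \<longrightarrow> z \<odot> z' = 0) \<and> (\<exists>c>0. c *\<^sub>R \<Sum>Z \<preceq> x)" for Z
  have card_le: "card Z \<le> card B" if "good Z" for Z
  proof -
    have "independent Z"
      by (rule orthogonal_projections_independent) (use that in \<open>simp_all add: good_def\<close>)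
    moreover have "Z \<subseteq> span B" using that B by (auto simp: good_def)
    ultimately show ?thesis using independent_span_bound[OF B(1)] by blast
  qed
  have "good {}" using x by (auto simp: good_def intro!: exI[of _ 1])
  then have "\<exists>Z. good Z \<and> (\<forall>Z'. good Z' \<longrightarrow> card Z' \<le> card Z)"
    by (rule ex_has_greatest_nat[where b = "Suc (card B)"]) (simp add: card_le less_Suc_eq_le)
  then obtain Z where Z: "good Z" and max: "\<And>Z'. good Z' \<Longrightarrow> card Z' \<le> card Z" by blast
  define g where "g = \<Sum>Z"
  obtain c where c: "c > 0" "c *\<^sub>R g \<preceq> x" using Z by (auto simp: good_def g_def)
  have gc: "g \<in> centre" unfolding g_def using Z by (intro centre_sum) (simp add: good_def)
  have zg: "z \<odot> g = z" if z: "z \<in> Z" for z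
  proof -
    have "z \<odot> g = (\<Sum>z'\<in>Z. z \<odot> z')"
      unfolding g_def by (rule linear_sum[OF bounded_linear.linear[OF bounded_linear_jprod]])
    also have "\<dots> = (\<Sum>z'\<in>Z. if z' = z then z else 0)"
      by (rule sum.cong) (use Z z in \<open>auto simp: good_def\<close>)
    also have "\<dots> = z" using Z z by (simp add: good_def)
    finally show ?thesis .
  qed
  have "g \<odot> g = (\<Sum>z\<in>Z. g \<odot> z)"
    by (subst (2) g_def) (rule linear_sum[OF bounded_linear.linear[OF bounded_linear_jprod]])
  also have "\<dots> = g" using zg by (simp add: g_def jprod_commute cong: sum.cong)
  finally have gg: "projection g" .
  have "g = e"
  proof (rule ccontr)
    assume "g \<noteq> e"
    then obtain z d where z: "projection z" "z \<in> centre" "z \<noteq> 0" "z \<odot> g = 0" "d > 0" "d *\<^sub>R z \<preceq> x"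
      using bounded_below_on_summand[OF atomic gg gc _ x ptw] by metis
    have orth: "z \<odot> y = 0" if "y \<in> Z" for y
      using zg[OF that] centre_commute[OF z(2), of y g] z(4) by (simp add: jprod_commute)
    have "z \<notin> Z" using orth z by auto
    have "(min c d) *\<^sub>R (\<Sum>(insert z Z)) \<preceq> x"
    proof -
      have "\<Sum>(insert z Z) = z + g" using Z \<open>z \<notin> Z\<close> by (simp add: good_def g_def)
      moreover have "g \<odot> (c *\<^sub>R g) \<preceq> g \<odot> x" by (rule central_prod_mono[OF gg gc c(2)])
      then have 1: "pos (g \<odot> x - c *\<^sub>R g)" using gg by (simp add: jdistrib)
      have gc': "e - g \<in> centre" by (intro centre_diff centre_unit gc)
      have "(e - g) \<odot> (d *\<^sub>R z) \<preceq> (e - g) \<odot> x"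
        by (rule central_prod_mono[OF projection_compl[OF gg] gc' z(6)])
      then have 2: "pos (x - g \<odot> x - d *\<^sub>R z)" using z(4) by (simp add: jdistrib jprod_commute[of g z])
      have "pos ((c - min c d) *\<^sub>R g)" "pos ((d - min c d) *\<^sub>R z)"
        by (intro pos_scale projection_pos[OF gg] projection_pos[OF z(1)]; simp)+
      from pos_add[OF pos_add[OF 1 2] pos_add[OF this]]
      have "pos (x - (min c d *\<^sub>R z + min c d *\<^sub>R g))" by (simp add: algebra_simps)
      ultimately show ?thesis by (simp add: scaleR_right_distrib)
    qed
    moreover have "min c d > 0" using c z by simp
    ultimately have low: "\<exists>c>0. c *\<^sub>R \<Sum>(insert z Z) \<preceq> x" by blast
    have "y \<odot> y' = 0" if yy: "y \<in> insert z Z" "y' \<in> insert z Z" "y \<noteq> y'" for y y'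
    proof -
      consider "y = z" "y' \<in> Z" | "y \<in> Z" "y' = z" | "y \<in> Z" "y' \<in> Z" using yy by blast
      then show ?thesis
      proof cases
        case 2 then show ?thesis using orth[of y] by (simp add: jprod_commute[of y z])
      qed (use Z orth yy in \<open>simp_all add: good_def\<close>)
    qed
    moreover have "projection y \<and> y \<in> centre \<and> y \<noteq> 0" if "y \<in> insert z Z" for y
      using that Z z(1-3) by (elim insertE) (simp_all add: good_def)
    ultimately have "good (insert z Z)"
      using Z low unfolding good_def by (intro conjI ballI impI) simp_all
    then have "card (insert z Z) \<le> card Z" by (rule max)
    then show False using Z \<open>z \<notin> Z\<close> by (simp add: good_def)
  qed
  then show ?thesis using c by blast
qed

subsection \<open>Infinite-dimensional centres\<close>

text \<open>The square root \<open>r\<close> of \<open>a\<close> is again central, and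
  \<open>quad r y = a \<odot> y\<close>.\<close>

lemma pos_centre_prod:
  assumes "a \<in> centre" "pos a" "pos y"
  shows "pos (a \<odot> y)"
proof -
  define r where "r = fc a (\<lambda>t. sqrt \<bar>t\<bar>)"
  have c: "continuous_on UNIV (\<lambda>t::real. sqrt \<bar>t\<bar>)" by (intro continuous_intros)
  have rr: "r \<odot> r = a" unfolding r_def by (rule pos_sqrt[OF assms(2)])
  have rc: "r \<in> centre" using gen_subset_centre[OF assms(1)] fc_gen[OF c] by (auto simp: r_def)
  have "pos r" unfolding r_def by (rule fc_pos[OF norm_interval _ c]) simp_all
  then have "pos (quad r y)" using assms(3) by (rule quad_pos)
  moreover have "quad r y = a \<odot> y"
    using centre_assoc[OF rc, of r y] by (simp add: quad_def rr)
  ultimately show ?thesis by simp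
qed

lemma centre_square_zero:
  assumes "a \<in> centre" "a \<odot> (a \<odot> s) = 0"
  shows "a \<odot> s = 0"
proof -
  have "(a \<odot> s) \<odot> (a \<odot> s) = s \<odot> (a \<odot> (a \<odot> s))"
    by (simp only: centre_assoc[OF assms(1)] centre_commute[OF assms(1), of s "a \<odot> s"])
  then have "norm ((a \<odot> s) \<odot> (a \<odot> s)) = 0" using assms(2) by simp
  then show ?thesis by (simp add: norm_square)
qed

text \<open>A non-zero \<open>b\<close> would dominate a multiple of a projection \<open>s\<close>
  under \<open>p\<close> that is orthogonal to all of \<open>D\<close>; then \<open>p - s\<close>
  would be a smaller upper bound.\<close>

lemma central_lub_faithful:
  assumes D: "\<forall>a\<in>D. a \<in> centre \<and> pos a \<and> a \<preceq> e \<and> p \<odot> a = a"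
    and p: "projection p" "is_lub D p"
    and b: "pos b" "p \<odot> b = b" "\<forall>a\<in>D. a \<odot> b = 0"
  shows "b = 0"
proof (rule ccontr)
  assume "b \<noteq> 0"
  then obtain s \<delta> where s: "projection s" "s \<noteq> 0" "\<delta> > 0" "\<delta> *\<^sub>R s \<preceq> b"
    by (rule projection_below[OF b(1)])
  have ds: "pos (\<delta> *\<^sub>R s)" using s(3) by (intro pos_scale[OF projection_pos[OF s(1)]]) simp
  have "p \<odot> (\<delta> *\<^sub>R s) = \<delta> *\<^sub>R s"
    by (rule below_projection[OF p(1) ds le_trans[OF s(4) corner_le[OF p(1) b(2)]]])
  then have ps: "p \<odot> s = s" using s(3) by (simp add: jdistrib)
  have "a \<preceq> p - s" if a: "a \<in> D" for a
  proof -
    have ac: "a \<in> centre" "pos a" "a \<preceq> e" "p \<odot> a = a" using bspec[OF D a] by simp_all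
    have quad_a: "quad a y = a \<odot> (a \<odot> y)" for y
      by (simp add: quad_def centre_assoc[OF ac(1)])
    have "quad a b = 0" using bspec[OF b(3) a] by (simp add: quad_a)
    then have "quad a (\<delta> *\<^sub>R s) = 0" by (rule quad_zero_mono[OF ac(2) ds s(4)])
    then have "a \<odot> (a \<odot> s) = 0" using s(3) by (simp add: quad_a jdistrib)
    then have as: "a \<odot> s = 0" by (rule centre_square_zero[OF ac(1)])
    have "e - a \<in> centre" by (intro centre_diff centre_unit ac)
    then have "pos ((e - a) \<odot> (p - s))"
      using ac(3) projection_pos[OF projection_diff(1)[OF p(1) s(1) ps]] by (rule pos_centre_prod)
    moreover have "(e - a) \<odot> (p - s) = p - s - a"
      using ac(4) as by (simp add: jdistrib jprod_commute[of a p])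
    ultimately show ?thesis by simp
  qed
  then have "p \<preceq> p - s" by (rule is_lub_least[OF p(2)])
  then have "s = 0" using projection_pos[OF s(1)] by (intro pos_antisym) simp_all
  then show False using s(2) by simp
qed

text \<open>For a 1/2 vector \<open>u\<close> of \<open>p\<close> and \<open>a \<in> D\<close>, the
  product \<open>a \<odot> (p \<odot> u)\<close> equals both \<open>a \<odot> u\<close> and half of
  it. So \<open>D\<close> kills \<open>u\<close> and \<open>u \<odot> u\<close>, and faithfulness
  makes \<open>p \<odot> (u \<odot> u)\<close> vanish.\<close>

lemma central_of_lub:
  assumes D: "\<forall>a\<in>D. a \<in> centre \<and> pos a \<and> a \<preceq> e \<and> p \<odot> a = a"
    and p: "projection p" "is_lub D p"
  shows "p \<in> centre"
proof (rule central_of_no_half[OF p(1)])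
  fix u assume u: "p \<odot> u = (1 / 2) *\<^sub>R u"
  have au: "a \<odot> u = 0" if a: "a \<in> D" for a
  proof -
    have ac: "a \<in> centre" "p \<odot> a = a" using bspec[OF D a] by simp_all
    have "(1 / 2) *\<^sub>R (a \<odot> u) = a \<odot> (p \<odot> u)" by (simp add: u jdistrib)
    also have "\<dots> = a \<odot> u" using centre_assoc[OF ac(1), of p u] ac(2) by (simp add: jprod_commute[of a p])
    finally have "(1 / 2) *\<^sub>R (a \<odot> u) = a \<odot> u" .
    then have "(1 / 2) *\<^sub>R (a \<odot> u) + (1 / 2) *\<^sub>R (a \<odot> u) = a \<odot> u + a \<odot> u" by simp
    then show ?thesis unfolding scaleR_half_sum by simp
  qed
  define b where "b = p \<odot> (u \<odot> u)"
  have pb: "p \<odot> b = b" unfolding b_def by (rule half_prod_half[OF p(1) u u])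
  then have "quad p (u \<odot> u) = b" unfolding b_def by (intro quad_of_even[OF p(1)])
  then have b0: "pos b" using quad_pos[OF projection_pos[OF p(1)] pos_square[of u]] by simp
  have ab: "\<forall>a\<in>D. a \<odot> b = 0"
  proof
    fix a assume a: "a \<in> D"
    have ac: "a \<in> centre" using bspec[OF D a] by simp
    have "a \<odot> b = p \<odot> (a \<odot> (u \<odot> u))" unfolding b_def by (rule centre_commute[OF ac])
    also have "a \<odot> (u \<odot> u) = u \<odot> (a \<odot> u)" by (rule centre_commute[OF ac])
    finally show "a \<odot> b = 0" by (simp add: au[OF a])
  qed
  have "b = 0" by (rule central_lub_faithful[OF D p b0 pb ab])
  then show "u = 0" using half_eq_zero[OF p(1) u] by (simp add: b_def)
qed

definition centre_corner :: "'a \<Rightarrow> 'a set" where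
  "centre_corner z = {y \<in> centre. z \<odot> y = y}"

lemma subspace_centre_corner: "subspace (centre_corner z)"
  by (rule subspaceI) (auto simp: centre_corner_def jdistrib centre_zero centre_add centre_scale)

lemma finite_dimensional_centre_corner_sum:
  assumes z: "z = z1 + z2" "z1 \<in> centre" "z2 \<in> centre" "projection z1" "projection z2" "z1 \<odot> z2 = 0"
    and fin: "finite_dimensional (centre_corner z1)" "finite_dimensional (centre_corner z2)"
  shows "finite_dimensional (centre_corner z)"
proof -
  obtain B1 B2 where B: "finite B1" "span B1 = centre_corner z1" "finite B2" "span B2 = centre_corner z2"
    using fin unfolding finite_dimensional_def by blast
  have z21: "z2 \<odot> z1 = 0" using z(6) by (simp add: jprod_commute)
  have "span (B1 \<union> B2) = centre_corner z"
  proof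
    have "y \<in> centre_corner z" if "y \<in> centre_corner z1" for y
      using that centre_assoc[OF z(3), of z1 y] z21
      by (simp add: centre_corner_def z(1) jdistrib)
    moreover have "y \<in> centre_corner z" if "y \<in> centre_corner z2" for y
      using that centre_assoc[OF z(2), of z2 y] z(6)
      by (simp add: centre_corner_def z(1) jdistrib)
    ultimately have "B1 \<union> B2 \<subseteq> centre_corner z" using B span_superset by blast
    then show "span (B1 \<union> B2) \<subseteq> centre_corner z" by (rule span_minimal[OF _ subspace_centre_corner])
    show "centre_corner z \<subseteq> span (B1 \<union> B2)"
    proof
      fix y assume y: "y \<in> centre_corner z"
      have "z1 \<odot> y \<in> centre_corner z1"
        using y centre_assoc[OF z(2), of z1 y] z(4) by (simp add: centre_corner_def centre_prod[OF z(2)])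
      moreover have "z2 \<odot> y \<in> centre_corner z2"
        using y centre_assoc[OF z(3), of z2 y] z(5) by (simp add: centre_corner_def centre_prod[OF z(3)])
      moreover have "y = z1 \<odot> y + z2 \<odot> y" using y by (simp add: centre_corner_def z(1) jdistrib)
      ultimately show "y \<in> span (B1 \<union> B2)"
        using B span_mono[of B1 "B1 \<union> B2"] span_mono[of B2 "B1 \<union> B2"] span_add by (metis Un_upper1 Un_upper2 subsetD)
    qed
  qed
  then show ?thesis using B unfolding finite_dimensional_def by blast
qed

text \<open>A central element of the corner that is no multiple of \<open>z\<close> is incomparable
  with some \<open>t z\<close>. The range projection of the positive part of the difference cuts
  \<open>z\<close> into two non-zero pieces, one of which keeps infinite dimension.\<close>

lemma infinite_centre_split:
  assumes z: "projection z" "z \<in> centre" and inf: "\<not> finite_dimensional (centre_corner z)"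
  shows "\<exists>z'. projection z' \<and> z' \<in> centre \<and> \<not> finite_dimensional (centre_corner z') \<and> z \<odot> z' = z' \<and> z' \<noteq> z"
proof -
  have "\<exists>y\<in>centre_corner z. \<forall>t. y \<noteq> t *\<^sub>R z"
  proof (rule ccontr)
    assume "\<not> ?thesis"
    then have "centre_corner z \<subseteq> span {z}" by (force simp: span_singleton)
    moreover have "z \<in> centre_corner z" using z by (simp add: centre_corner_def)
    then have "span {z} \<subseteq> centre_corner z" by (intro span_minimal subspace_centre_corner) simp
    ultimately have "span {z} = centre_corner z" by simp
    then show False using inf unfolding finite_dimensional_def by blast
  qed
  then obtain y where y: "y \<in> centre" "z \<odot> y = y" "\<forall>t. y \<noteq> t *\<^sub>R z"
    by (auto simp: centre_corner_def)
  then obtain t where t: "\<not> y \<preceq> t *\<^sub>R z" "\<not> t *\<^sub>R z \<preceq> y"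
    using multiple_of_comparable[OF z(1) y(2)] by blast
  define Y where "Y = y - t *\<^sub>R z"
  have YZ: "Y \<in> centre" unfolding Y_def by (intro centre_diff centre_scale y z)
  have zY: "z \<odot> Y = Y" using y z by (simp add: Y_def jdistrib)
  have pos0: "pos_part Y \<noteq> 0"
  proof
    assume "pos_part Y = 0"
    then have "neg_part Y = - Y" using pos_part_minus_neg_part[of Y] by (metis diff_0 minus_minus)
    then show False using neg_part_pos[of Y] t(1) by (simp add: Y_def)
  qed
  have neg0: "neg_part Y \<noteq> 0"
  proof
    assume "neg_part Y = 0"
    then have "pos_part Y = Y" using pos_part_minus_neg_part[of Y] by simp
    then show False using pos_part_pos[of Y] t(2) by (simp add: Y_def)
  qed
  obtain p a where p: "projection p" "p \<odot> pos_part Y = pos_part Y" "p \<odot> neg_part Y = 0"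
    and lub: "is_lub (range a) p"
    and a: "\<forall>n::nat. a n \<in> gen Y \<and> pos (a n) \<and> a n \<preceq> e \<and> p \<odot> a n = a n"
    using spectral_projection[of Y] by (elim exE conjE) (rule that)
  have pc: "p \<in> centre"
  proof (rule central_of_lub[OF _ p(1) lub], rule ballI)
    fix x assume "x \<in> range a"
    then show "x \<in> centre \<and> pos x \<and> x \<preceq> e \<and> p \<odot> x = x"
      using a gen_subset_centre[OF YZ] by auto
  qed
  define z1 where "z1 = p \<odot> z"
  define z2 where "z2 = z - z1"
  have z1: "z1 \<in> centre" unfolding z1_def by (rule centre_prod[OF pc z(2)])
  have z2: "z2 \<in> centre" unfolding z2_def by (rule centre_diff[OF z(2) z1])
  have zz1: "z \<odot> z1 = z1" unfolding z1_def centre_commute[OF z(2)] z(1) ..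
  have pz1: "p \<odot> z1 = z1" unfolding z1_def using p(1) by (simp flip: centre_assoc[OF pc])
  have z11: "projection z1" using centre_assoc[OF pc, of z z1] zz1 pz1 by (simp add: z1_def)
  have z22: "projection z2" unfolding z2_def by (rule projection_diff(1)[OF z(1) z11 zz1])
  have z12: "z1 \<odot> z2 = 0" using zz1 z11 by (simp add: z2_def jdistrib jprod_commute[of z1 z])
  note parts = parts_in_corner[OF z(1) zY]
  have "z1 \<odot> pos_part Y = pos_part Y"
    unfolding z1_def centre_assoc[OF pc] parts(1) p(2) ..
  then have "z1 \<noteq> 0" using pos0 by auto
  have "z1 \<odot> neg_part Y = 0"
    unfolding z1_def centre_assoc[OF pc] parts(2) p(3) ..
  then have "z2 \<odot> neg_part Y = neg_part Y" unfolding z2_def jdiff_left parts(2) by simp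
  then have "z2 \<noteq> 0" using neg0 by auto
  have "z = z1 + z2" by (simp add: z2_def)
  then have "\<not> finite_dimensional (centre_corner z1) \<or> \<not> finite_dimensional (centre_corner z2)"
    using finite_dimensional_centre_corner_sum[OF _ z1 z2 z11 z22 z12] inf by blast
  moreover have "z \<odot> z2 = z2" using zz1 z(1) by (simp add: z2_def jdistrib)
  moreover have "z1 \<noteq> z" "z2 \<noteq> z" using \<open>z2 \<noteq> 0\<close> \<open>z1 \<noteq> 0\<close> by (auto simp: z2_def)
  ultimately show ?thesis using z1 z2 z11 z22 zz1 by metis
qed

text \<open>The last clause, that only 0 vanishes on every summand, expresses without infinite sums
  that the \<open>z n\<close> add up to \<open>e\<close>.\<close>

definition central_partition :: "(nat \<Rightarrow> 'a) \<Rightarrow> bool" where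
  "central_partition z \<longleftrightarrow> (\<forall>n. projection (z n) \<and> z n \<in> centre \<and> z n \<noteq> 0)
    \<and> (\<forall>m n. m \<noteq> n \<longrightarrow> z m \<odot> z n = 0) \<and> (\<forall>y. (\<forall>n. z n \<odot> y = 0) \<longrightarrow> y = 0)"

lemma decreasing_central_projections:
  assumes "\<not> finite_dimensional centre"
  shows "\<exists>q. q 0 = e \<and> (\<forall>n::nat. projection (q n) \<and> q n \<in> centre
    \<and> q n \<odot> q (Suc n) = q (Suc n) \<and> q (Suc n) \<noteq> q n)"
proof -
  define big where "big z \<longleftrightarrow> projection z \<and> z \<in> centre \<and> \<not> finite_dimensional (centre_corner z)" for z
  define R where "R z z' \<longleftrightarrow> z \<odot> z' = z' \<and> z' \<noteq> z" for z z'
  have "centre_corner e = centre" by (simp add: centre_corner_def)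
  then have big_e: "big e" using assms by (simp add: big_def centre_unit)
  have "\<exists>q. \<forall>n::nat. (big (q n) \<and> (n = 0 \<longrightarrow> q n = e)) \<and> R (q n) (q (Suc n))"
  proof (rule dependent_nat_choice)
    show "\<exists>x. big x \<and> (0 = 0 \<longrightarrow> x = e)" using big_e by auto
    fix x and n :: nat assume "big x \<and> (n = 0 \<longrightarrow> x = e)"
    then show "\<exists>y. (big y \<and> (Suc n = 0 \<longrightarrow> y = e)) \<and> R x y"
      using infinite_centre_split[of x] unfolding big_def R_def by simp
  qed
  then obtain q where q: "\<forall>n::nat. (big (q n) \<and> (n = 0 \<longrightarrow> q n = e)) \<and> R (q n) (q (Suc n))" ..
  then show ?thesis
    by (intro exI[of _ q]) (simp add: big_def R_def)
qed

text \<open>The differences of a decreasing sequence of central projections are orthogonal but may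
  fail to exhaust \<open>e\<close>. The missing part \<open>r\<close>, complement of the supremum
  \<open>g\<close> of their partial sums, is added to the initial one.\<close>

lemma central_partition_exists:
  assumes "\<not> finite_dimensional centre"
  shows "\<exists>z. central_partition z"
proof -
  obtain q where q0: "q 0 = e" and q': "\<forall>n::nat. projection (q n) \<and> q n \<in> centre
    \<and> q n \<odot> q (Suc n) = q (Suc n) \<and> q (Suc n) \<noteq> q n"
    using decreasing_central_projections[OF assms] by (elim exE conjE) (rule that)
  have q: "projection (q n)" "q n \<in> centre" "q n \<odot> q (Suc n) = q (Suc n)" "q (Suc n) \<noteq> q n" for n
    using spec[OF q', of n] by simp_all
  have qq: "q m \<odot> q n = q n" if "m \<le> n" for m n
    using that
  proof (induction n rule: dec_induct)
    case (step n)
    then show ?case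
      using centre_assoc[OF q(2), of m "q n" "q (Suc n)"] q(3)[of n] by simp
  qed (rule q(1))
  define d where "d n = q n - q (Suc n)" for n
  have d: "projection (d n)" "d n \<in> centre" "d n \<noteq> 0" for n
    unfolding d_def using projection_diff(1)[OF q(1)[of n] q(1)[of "Suc n"] q(3)[of n]] centre_diff[OF q(2) q(2)] q(4)[of n]
    by simp_all
  have dq: "d m \<odot> q n = 0" if "m < n" for m n
  proof -
    have "q m \<odot> q n = q n" "q (Suc m) \<odot> q n = q n" using that by (auto intro: qq)
    then show ?thesis by (simp add: d_def jdistrib)
  qed
  have dd: "d m \<odot> d n = 0" if "m \<noteq> n" for m n
  proof -
    have "d m \<odot> d n = 0" if "m < n" for m n
      using dq[OF that] dq[of m "Suc n"] that by (simp add: d_def[of n] jdiff_right)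
    then show ?thesis using \<open>m \<noteq> n\<close> by (metis jprod_commute linorder_neqE_nat)
  qed
  define a where "a n = e - q n" for n
  have a: "projection (a n)" "a n \<in> centre" for n
    unfolding a_def using projection_compl[OF q(1)] centre_diff[OF centre_unit q(2)] by auto
  have a_step: "a (Suc n) = a n + d n" for n by (simp add: a_def d_def)
  obtain g where g: "is_lub (range a) g"
  proof (rule increasing_lub[of a])
    show "pos (a n) \<and> a n \<preceq> e" for n using projection_pos[OF a(1)] projection_le_unit[OF a(1)] by simp
    show "a n \<preceq> a (Suc n)" for n using projection_pos[OF d(1)] by (simp add: a_step)
  qed
  have ag: "a n \<preceq> g" for n using g by (simp add: is_lub_def)
  have g1: "g \<preceq> e" using g projection_le_unit[OF a(1)] by (auto simp: is_lub_def)
  have age: "a n \<odot> g = a n" for n by (rule above_projection[OF a(1) ag g1])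
  have gg: "projection g"
  proof (rule projection_of_lub[OF _ _ g])
    show "pos x \<and> x \<preceq> e" if "x \<in> range a" for x
      using that projection_pos[OF a(1)] projection_le_unit[OF a(1)] by auto
    show "x \<odot> (e - g) = 0" if "x \<in> range a" for x using that age by (auto simp: jdistrib)
  qed simp
  have ga: "g \<odot> a n = a n" for n using age[of n] by (simp add: jprod_commute)
  have D: "\<forall>x\<in>range a. x \<in> centre \<and> pos x \<and> x \<preceq> e \<and> g \<odot> x = x"
    using a(2) ga projection_pos[OF a(1)] projection_le_unit[OF a(1)] by simp
  have gc: "g \<in> centre" by (rule central_of_lub[OF D gg g])
  have gd: "g \<odot> d n = d n" for n
    using ga[of n] ga[of "Suc n"] by (simp add: a_step jdistrib)
  define r where "r = e - g"
  have r: "projection r" "r \<in> centre" unfolding r_def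
    by (rule projection_compl[OF gg], rule centre_diff[OF centre_unit gc])
  have rd: "r \<odot> d n = 0" for n using gd by (simp add: r_def jdistrib)
  define z where "z n = (if n = 0 then d 0 + r else d n)" for n
  have dz: "d n \<odot> z n = d n" for n
    using d(1) rd by (simp add: z_def jdistrib jprod_commute[of "d 0" r])
  have "projection (z n) \<and> z n \<in> centre \<and> z n \<noteq> 0" for n
  proof (intro conjI)
    show "projection (z n)"
      using projection_add[OF d(1) r(1)] rd d(1) by (simp add: z_def jprod_commute[of "d 0" r])
    show "z n \<in> centre" using d(2) centre_add[OF d(2) r(2)] by (simp add: z_def)
    show "z n \<noteq> 0" using dz[of n] d(3)[of n] by auto
  qed
  moreover have "z m \<odot> z n = 0" if "m \<noteq> n" for m n
    using that
    by (cases "m = 0"; cases "n = 0") (simp_all add: z_def jdistrib jprod_commute[of _ r] rd dd)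
  moreover have "y = 0" if y: "\<forall>n. z n \<odot> y = 0" for y
  proof -
    have dy: "d n \<odot> y = 0" for n
      using centre_assoc[OF d(2), of n "z n" y] y by (simp add: dz)
    have "(d 0 + r) \<odot> y = 0" using spec[OF y, of 0] by (simp add: z_def)
    then have "r \<odot> y = 0" using dy[of 0] by (simp add: jadd_left)
    define b where "b = y \<odot> y"
    have db: "d n \<odot> b = 0" for n
      unfolding b_def using dy[of n] by (simp add: centre_commute[OF d(2)])
    have "r \<odot> b = 0"
      unfolding b_def using \<open>r \<odot> y = 0\<close> by (simp add: centre_commute[OF r(2)])
    then have gb: "g \<odot> b = b" by (simp add: r_def jdistrib)
    have ab: "a n \<odot> b = 0" for n
    proof (induction n)
      case 0 then show ?case by (simp add: a_def q0)
    next
      case (Suc n) then show ?case by (simp add: a_step jadd_left db)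
    qed
    have "b = 0"
    proof (rule central_lub_faithful[OF D gg g _ gb])
      show "pos b" unfolding b_def by (rule pos_square)
      show "\<forall>x\<in>range a. x \<odot> b = 0" using ab by simp
    qed
    then show "y = 0" using norm_square[of y] by (simp add: b_def)
  qed
  ultimately have "central_partition z" by (simp add: central_partition_def)
  then show ?thesis by blast
qed

section \<open>Order structure along a central partition\<close>

context
  fixes z :: "nat \<Rightarrow> 'a"
  assumes partition: "central_partition z"
begin

lemma partition_projection: "projection (z n)"
  and partition_centre: "z n \<in> centre"
  and partition_nonzero: "z n \<noteq> 0"
  and partition_orth: "m \<noteq> n \<Longrightarrow> z m \<odot> z n = 0"
  and partition_faithful: "(\<And>n. z n \<odot> y = 0) \<Longrightarrow> y = 0"
  using partition by (simp_all add: central_partition_def)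

lemma partition_corner: "pos b \<Longrightarrow> b \<preceq> z n \<Longrightarrow> z n \<odot> b = b"
  by (rule below_projection[OF partition_projection, where c = 1]) simp_all

lemma partition_eqI: "(\<And>n. z n \<odot> x = z n \<odot> y) \<Longrightarrow> x = y"
  using partition_faithful[of "x - y"] by (simp add: jdistrib)

text \<open>For the negative part \<open>m\<close> of \<open>u\<close>,
  \<open>quad m u = - m\<^sup>3\<close>. On each summand this is positive by assumption while
  \<open>m\<^sup>3 \<ge> 0\<close>, so \<open>m\<^sup>3\<close> vanishes on every summand, and
  \<open>m = 0\<close>.\<close>

lemma partition_le:
  assumes "\<And>n. z n \<odot> x \<preceq> z n \<odot> y"
  shows "x \<preceq> y"
proof -
  define u where "u = y - x"
  define m where "m = neg_part u"
  have m0: "pos m" unfolding m_def by (rule neg_part_pos)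
  have mg: "m \<in> gen u" unfolding m_def by (intro fc_gen continuous_intros)
  have cube: "quad m m = m \<odot> (m \<odot> m)" using gen_assoc[OF mg mg mg] by (simp add: quad_def)
  have "quad m (pos_part u) = 0"
  proof -
    have "(m \<odot> m) \<odot> pos_part u = m \<odot> (m \<odot> pos_part u)"
      by (rule gen_assoc[OF mg mg]) (intro fc_gen continuous_intros)
    then show ?thesis using pos_part_neg_part_orth[of u] by (simp add: quad_def m_def)
  qed
  then have qu: "quad m u = - quad m m"
    using arg_cong[OF pos_part_minus_neg_part[of u], of "quad m"] by (simp add: quad_diff_right m_def)
  have "z n \<odot> quad m m = 0" for n
  proof (rule pos_antisym)
    have qm: "pos (quad m m)" by (rule quad_pos[OF m0 m0])
    show "pos (z n \<odot> quad m m)"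
      by (rule pos_central_prod[OF partition_projection partition_centre qm])
    have "pos (z n \<odot> u)" using assms[of n] by (simp add: u_def jdistrib)
    then have "pos (quad m (z n \<odot> u))" by (rule quad_pos[OF m0])
    then show "pos (- (z n \<odot> quad m m))"
      by (simp add: qu jdistrib flip: centre_quad[OF partition_centre])
  qed
  then have "m \<odot> (m \<odot> m) = 0" using partition_faithful[of "quad m m"] by (simp add: cube)
  moreover have "(m \<odot> m) \<odot> (m \<odot> m) = m \<odot> (m \<odot> (m \<odot> m))"
    by (rule gen_assoc[OF mg mg gen_prod[OF mg mg]])
  ultimately have "norm ((m \<odot> m) \<odot> (m \<odot> m)) = 0" by simp
  then have "m = 0" by (simp add: norm_square)
  then have "u = pos_part u" using pos_part_minus_neg_part[of u] by (simp add: m_def)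
  then show ?thesis using pos_part_pos[of u] by (simp add: u_def)
qed

lemma partition_glue:
  assumes b: "\<And>n. pos (b n)" "\<And>n. b n \<preceq> z n"
  obtains y where "pos y" "y \<preceq> e" "\<And>n. z n \<odot> y = b n"
proof -
  note zp = partition_projection and zc = partition_centre
  have zb: "z n \<odot> b n = b n" for n using b by (intro partition_corner)
  have zb0: "z n \<odot> b m = 0" if "m \<noteq> n" for m n
    using centre_assoc[OF zc, of n "z m" "b m"] partition_orth[of n m] that by (simp add: zb)
  define Y where "Y n = (\<Sum>i<n. b i)" for n
  define P where "P n = (\<Sum>i<n. z i)" for n
  have zY: "z n \<odot> Y N = (if n < N then b n else 0)" for n N
  proof (induction N)
    case (Suc N)
    have "Y (Suc N) = Y N + b N" by (simp add: Y_def)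
    then show ?case using Suc by (cases "n = N") (simp_all add: jadd_right less_Suc_eq zb zb0)
  qed (simp add: Y_def)
  have zP: "z n \<odot> P N = (if n < N then z n else 0)" for n N
  proof (induction N)
    case (Suc N)
    have "P (Suc N) = P N + z N" by (simp add: P_def)
    then show ?case using Suc by (cases "n = N") (simp_all add: jadd_right less_Suc_eq zp partition_orth)
  qed (simp add: P_def)
  have P: "projection (P n)" for n
  proof (induction n)
    case (Suc n)
    have "P n \<odot> z n = 0" using zP[of n n] by (simp add: jprod_commute)
    then have "projection (P n + z n)" by (rule projection_add[OF Suc zp])
    then show ?case by (simp add: P_def)
  qed (simp add: P_def)
  have Y0: "pos (Y n)" for n
    by (induction n) (simp_all add: Y_def pos_add b(1))
  have "Y n \<preceq> P n" for n
  proof (induction n)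
    case (Suc n)
    have "pos (P n - Y n + (z n - b n))" by (rule pos_add[OF Suc b(2)])
    then show ?case by (simp add: P_def Y_def algebra_simps)
  qed (simp add: P_def Y_def)
  then have Y1: "Y n \<preceq> e" for n using projection_le_unit[OF P] le_trans by blast
  obtain y where y: "is_lub (range Y) y"
  proof (rule increasing_lub[of Y])
    show "pos (Y n) \<and> Y n \<preceq> e" for n using Y0 Y1 by simp
    show "Y n \<preceq> Y (Suc n)" for n using b(1) by (simp add: Y_def)
  qed
  have Yy: "Y n \<preceq> y" for n using y by (simp add: is_lub_def)
  have "z n \<odot> y = b n" for n
  proof (rule le_antisym)
    have "z n \<odot> Y (Suc n) \<preceq> z n \<odot> y" by (rule central_prod_mono[OF zp zc Yy])
    then show "b n \<preceq> z n \<odot> y" by (simp add: zY)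
    \<comment> \<open>An upper bound of all partial sums obtained from \<open>y\<close> by replacing
      its \<open>n\<close>-th component by \<open>b n\<close>; as \<open>y\<close> is the supremum,
      that component is at most \<open>b n\<close>.\<close>
    have "Y N \<preceq> (e - z n) \<odot> y + b n" for N
    proof -
      have "(e - z n) \<odot> Y N \<preceq> (e - z n) \<odot> y"
        by (rule central_prod_mono[OF projection_compl[OF zp] centre_diff[OF centre_unit zc] Yy])
      moreover have "z n \<odot> Y N \<preceq> b n" using b(1) by (simp add: zY)
      ultimately have "pos ((e - z n) \<odot> y - (e - z n) \<odot> Y N + (b n - z n \<odot> Y N))" by (rule pos_add)
      then show ?thesis by (simp add: jdistrib algebra_simps)
    qed
    then have "y \<preceq> (e - z n) \<odot> y + b n" using y by (auto simp: is_lub_def)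
    then have "z n \<odot> y \<preceq> z n \<odot> ((e - z n) \<odot> y + b n)" by (rule central_prod_mono[OF zp zc])
    also have "z n \<odot> ((e - z n) \<odot> y + b n) = b n"
      using centre_assoc[OF zc, of n "z n" y] zp[of n] by (simp add: jdistrib zb)
    finally show "z n \<odot> y \<preceq> b n" .
  qed
  moreover have "pos y" using pos_trans[OF Y0 Yy] .
  moreover have "y \<preceq> e" using y Y1 by (auto simp: is_lub_def)
  ultimately show ?thesis using that by blast
qed

end

end

subsection \<open>Order-theoretic invariants\<close>

text \<open>In the unit interval this means being different from 0; expressed through the order
  alone, it is invariant under order isomorphisms.\<close>

definition nonleast :: "('c \<Rightarrow> 'c \<Rightarrow> bool) \<Rightarrow> 'c set \<Rightarrow> 'c \<Rightarrow> bool" where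
  "nonleast le A x \<longleftrightarrow> (\<exists>a\<in>A. \<not> le x a)"

definition chain_element :: "('c \<Rightarrow> 'c \<Rightarrow> bool) \<Rightarrow> 'c set \<Rightarrow> 'c \<Rightarrow> bool" where
  "chain_element le A w \<longleftrightarrow> nonleast le A w \<and> (\<forall>a\<in>A. \<forall>b\<in>A. le a w \<longrightarrow> le b w \<longrightarrow> le a b \<or> le b a)"

definition meets_chains :: "('c \<Rightarrow> 'c \<Rightarrow> bool) \<Rightarrow> 'c set \<Rightarrow> 'c \<Rightarrow> bool" where
  "meets_chains le A x \<longleftrightarrow>
     (\<forall>w\<in>A. chain_element le A w \<longrightarrow> (\<exists>v\<in>A. nonleast le A v \<and> le v w \<and> le v x))"

definition countably_coinitial :: "('c \<Rightarrow> 'c \<Rightarrow> bool) \<Rightarrow> 'c set \<Rightarrow> bool" where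
  "countably_coinitial le A \<longleftrightarrow>
     (\<exists>d :: nat \<Rightarrow> 'c. (\<forall>n. d n \<in> A \<and> meets_chains le A (d n))
       \<and> (\<forall>x\<in>A. meets_chains le A x \<longrightarrow> (\<exists>n. le (d n) x)))"

context
  fixes le_A :: "'c \<Rightarrow> 'c \<Rightarrow> bool" and A le_B and B :: "'d set" and f
  assumes iso: "order_iso_betw le_A A le_B B f"
begin

lemma order_iso_image: "B = f ` A"
  and order_iso_le: "x \<in> A \<Longrightarrow> y \<in> A \<Longrightarrow> le_B (f x) (f y) \<longleftrightarrow> le_A x y"
  using iso by (auto simp: order_iso_betw_def bij_betw_def)

lemma order_iso_nonleast: "x \<in> A \<Longrightarrow> nonleast le_B B (f x) \<longleftrightarrow> nonleast le_A A x"
  by (simp add: nonleast_def order_iso_image order_iso_le)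

lemma order_iso_chain_element: "x \<in> A \<Longrightarrow> chain_element le_B B (f x) \<longleftrightarrow> chain_element le_A A x"
  unfolding chain_element_def by (simp add: order_iso_nonleast) (simp add: order_iso_image order_iso_le)

lemma order_iso_meets_chains: "x \<in> A \<Longrightarrow> meets_chains le_B B (f x) \<longleftrightarrow> meets_chains le_A A x"
  unfolding meets_chains_def
  using order_iso_nonleast order_iso_chain_element order_iso_le
  by (subst (1 2) order_iso_image) (simp add: order_iso_le cong: conj_cong)

lemma order_iso_countably_coinitial:
  assumes "countably_coinitial le_A A"
  shows "countably_coinitial le_B B"
proof -
  obtain d where d: "\<forall>n::nat. d n \<in> A \<and> meets_chains le_A A (d n)"
    "\<forall>x\<in>A. meets_chains le_A A x \<longrightarrow> (\<exists>n. le_A (d n) x)"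
    using assms unfolding countably_coinitial_def by blast
  have "f (d n) \<in> B \<and> meets_chains le_B B (f (d n))" for n
    using d(1) order_iso_meets_chains by (auto simp: order_iso_image)
  moreover have "\<exists>n. le_B (f (d n)) y" if y: "y \<in> B" "meets_chains le_B B y" for y
  proof -
    obtain x where x: "x \<in> A" "y = f x" using y(1) order_iso_image by blast
    then show ?thesis using d y(2) order_iso_meets_chains order_iso_le by metis
  qed
  ultimately show ?thesis unfolding countably_coinitial_def by (intro exI[of _ "\<lambda>n. f (d n)"]) blast
qed

end

context jb_complete
begin

subsection \<open>Invertible effects\<close>

abbreviation eff :: "'a set" where "eff \<equiv> effects (\<odot>) e"

lemma nonleast_effect_iff:
  assumes "x \<in> eff"
  shows "nonleast (jb_le (\<odot>)) eff x \<longleftrightarrow> x \<noteq> 0"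
proof -
  have zero: "0 \<in> eff" by (simp add: effects_iff)
  have "x = 0" if "x \<preceq> 0"
    using assms that by (intro pos_antisym) (simp_all add: effects_iff)
  then show ?thesis
    using bexI[of "\<lambda>a. \<not> x \<preceq> a", OF _ zero] unfolding nonleast_def jb_le_iff effects_iff
    by (auto simp: effects_iff)
qed

lemma minimal_effect: "minimal p \<Longrightarrow> p \<in> eff"
  by (simp add: minimal_def effects_iff projection_pos projection_le_unit)

lemma minimal_chain_element:
  assumes p: "minimal p"
  shows "chain_element (jb_le (\<odot>)) eff p"
proof -
  have pp: "projection p" "p \<noteq> 0" using p by (simp_all add: minimal_def)
  have "a \<preceq> b \<or> b \<preceq> a" if ab: "pos a" "pos b" "a \<preceq> p" "b \<preceq> p" for a b
  proof -
    obtain s where s: "a = s *\<^sub>R p" by (rule minimal_below[OF p ab(1,3)])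
    obtain t where t: "b = t *\<^sub>R p" by (rule minimal_below[OF p ab(2,4)])
    have "pos ((t - s) *\<^sub>R p) \<or> pos ((s - t) *\<^sub>R p)"
      using pos_scale[OF projection_pos[OF pp(1)]] by (metis diff_ge_0_iff_ge linear)
    then show ?thesis by (simp add: s t scaleR_left_diff_distrib)
  qed
  then show ?thesis
    using pp(2) nonleast_effect_iff[OF minimal_effect[OF p]]
    by (simp add: chain_element_def jb_le_iff effects_iff)
qed

lemma meets_chains_of_bound:
  assumes x: "x \<in> eff" and c: "c > 0" "c *\<^sub>R e \<preceq> x"
  shows "meets_chains (jb_le (\<odot>)) eff x"
  unfolding meets_chains_def
proof (intro ballI impI)
  fix w assume w: "w \<in> eff" "chain_element (jb_le (\<odot>)) eff w"
  have w01: "pos w" "w \<preceq> e" using w(1) by (simp_all add: effects_iff)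
  have w0: "w \<noteq> 0" using w(2) nonleast_effect_iff[OF w(1)] by (simp add: chain_element_def)
  \<comment> \<open>The minimum with 1 keeps \<open>v\<close> below \<open>w\<close>, while
    \<open>w \<le> e\<close> keeps it below \<open>c e\<close> and thus below
    \<open>x\<close>.\<close>
  define v where "v = min c 1 *\<^sub>R w"
  have v: "pos v" using w01 c by (simp add: v_def pos_scale)
  have "pos ((1 - min c 1) *\<^sub>R w)" using w01 by (intro pos_scale) auto
  then have vw: "v \<preceq> w" by (simp add: v_def scaleR_left_diff_distrib)
  have "pos (min c 1 *\<^sub>R (e - w) + (c - min c 1) *\<^sub>R e + (x - c *\<^sub>R e))"
    using w01 c by (intro pos_add pos_scale) auto
  then have vx: "v \<preceq> x" by (simp add: v_def algebra_simps)
  have "v \<preceq> e" using vw w01(2) by (rule le_trans)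
  then have "v \<in> eff" using v by (simp add: effects_iff)
  moreover have "v \<noteq> 0" using w0 c by (simp add: v_def)
  ultimately show "\<exists>v\<in>eff. nonleast (jb_le (\<odot>)) eff v \<and> jb_le (\<odot>) v w \<and> jb_le (\<odot>) v x"
    using vw vx nonleast_effect_iff by (auto simp: jb_le_iff)
qed

lemma minimal_bound_of_meets_chains:
  assumes x: "meets_chains (jb_le (\<odot>)) eff x" and p: "minimal p"
  obtains t where "t > 0" "t *\<^sub>R p \<preceq> x"
proof -
  obtain v where v: "v \<in> eff" "nonleast (jb_le (\<odot>)) eff v" "v \<preceq> p" "v \<preceq> x"
    using x minimal_chain_element[OF p] minimal_effect[OF p] by (auto simp: meets_chains_def jb_le_iff)
  have "pos v" using v by (simp add: effects_iff)
  then obtain t where t: "t \<ge> 0" "v = t *\<^sub>R p" using minimal_below[OF p _ v(3)] by blast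
  have "v \<noteq> 0" using v(2) nonleast_effect_iff[OF v(1)] by simp
  then have "t > 0" using t by (cases "t = 0") auto
  then show ?thesis using that v(4) t(2) by blast
qed

lemma bound_of_meets_chains:
  assumes atomic: "\<And>g. projection g \<Longrightarrow> g \<noteq> 0 \<Longrightarrow> \<exists>a. minimal a \<and> g \<odot> a = a"
    and fin: "finite_dimensional centre" and x: "x \<in> eff" "meets_chains (jb_le (\<odot>)) eff x"
  shows "\<exists>c>0. c *\<^sub>R e \<preceq> x"
proof (rule invertible_of_pointwise_bound[OF atomic fin])
  show "pos x" "x \<preceq> e" using x(1) by (simp_all add: effects_iff)
  show "\<exists>t>0. t *\<^sub>R p \<preceq> x" if "minimal p" for p
    using minimal_bound_of_meets_chains[OF x(2) that] by blast
qed

text \<open>An inverse \<open>y\<close> in \<open>gen x\<close> satisfies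
  \<open>y \<odot> y \<le> K e\<close>; multiplication by \<open>x \<odot> x\<close> gives
  \<open>e \<le> K (x \<odot> x)\<close>, and \<open>x \<odot> x \<le> x\<close> for
  effects.\<close>

lemma invertible_effects_iff: "x \<in> invertible_effects (\<odot>) e \<longleftrightarrow> x \<in> eff \<and> (\<exists>c>0. c *\<^sub>R e \<preceq> x)"
proof -
  have "jb_invertible (\<odot>) e x" if "c > 0" "c *\<^sub>R e \<preceq> x" for c
    using jinv(1,2)[OF that] unfolding jb_invertible_def by blast
  moreover have "\<exists>c>0. c *\<^sub>R e \<preceq> x" if x: "x \<in> eff" "jb_invertible (\<odot>) e x"
  proof -
    obtain y where y: "y \<in> gen x" "x \<odot> y = e" using x(2) unfolding jb_invertible_def by blast
    have x01: "pos x" "x \<preceq> e" using x(1) by (simp_all add: effects_iff)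
    define K where "K = norm (y \<odot> y) + 1"
    have K: "K > 0" by (simp add: K_def add_nonneg_pos)
    have "y \<odot> y \<preceq> K *\<^sub>R e" by (rule le_norm_unit) (simp add: K_def)
    then have "pos ((x \<odot> x) \<odot> (K *\<^sub>R e - y \<odot> y))"
      by (intro pos_prod[of _ x] pos_square gen_prod gen_diff gen_scale gen_unit gen_self y(1))
    moreover have "(x \<odot> x) \<odot> (y \<odot> y) = e"
    proof -
      have "(x \<odot> x) \<odot> (y \<odot> y) = x \<odot> (x \<odot> (y \<odot> y))"
        by (rule gen_assoc[OF gen_self gen_self gen_prod[OF y(1) y(1)]])
      also have "x \<odot> (y \<odot> y) = (x \<odot> y) \<odot> y" by (rule gen_assoc[OF gen_self y(1) y(1), symmetric])
      finally show ?thesis by (simp add: y(2))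
    qed
    ultimately have "pos (K *\<^sub>R (x \<odot> x) - e)" by (simp add: jdistrib)
    moreover have "pos (K *\<^sub>R (x - x \<odot> x))"
      using K square_le_self[OF x01] by (intro pos_scale) auto
    ultimately have "pos (K *\<^sub>R (x \<odot> x) - e + K *\<^sub>R (x - x \<odot> x))" by (rule pos_add)
    then have "pos ((1 / K) *\<^sub>R (K *\<^sub>R x - e))" using K by (intro pos_scale) (auto simp: algebra_simps)
    then have "(1 / K) *\<^sub>R e \<preceq> x" using K by (simp add: scaleR_right_diff_distrib)
    then show ?thesis using K by (intro exI[of _ "1 / K"]) simp
  qed
  ultimately show ?thesis unfolding invertible_effects_def by blast
qed

lemma invertible_effects_iff_meets_chains:
  assumes atomic: "\<And>g. projection g \<Longrightarrow> g \<noteq> 0 \<Longrightarrow> \<exists>a. minimal a \<and> g \<odot> a = a"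
    and fin: "finite_dimensional centre"
  shows "x \<in> invertible_effects (\<odot>) e \<longleftrightarrow> x \<in> eff \<and> meets_chains (jb_le (\<odot>)) eff x"
  using invertible_effects_iff bound_of_meets_chains[OF atomic fin] meets_chains_of_bound by blast

lemma countably_coinitial_of_finite_centre:
  assumes atomic: "\<And>g. projection g \<Longrightarrow> g \<noteq> 0 \<Longrightarrow> \<exists>a. minimal a \<and> g \<odot> a = a"
    and fin: "finite_dimensional centre"
  shows "countably_coinitial (jb_le (\<odot>)) eff"
  unfolding countably_coinitial_def
proof (intro exI[of _ "\<lambda>n. inverse (real (Suc n)) *\<^sub>R e"] conjI allI ballI impI)
  fix n
  have "pos ((1 - inverse (real (Suc n))) *\<^sub>R e)" by (rule pos_unit_scale) (simp add: inverse_le_1_iff)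
  then show eff: "inverse (real (Suc n)) *\<^sub>R e \<in> eff"
    by (simp add: effects_iff scaleR_left_diff_distrib)
  show "meets_chains (jb_le (\<odot>)) eff (inverse (real (Suc n)) *\<^sub>R e)"
    by (rule meets_chains_of_bound[OF eff, of "inverse (real (Suc n))"]) simp_all
next
  fix x assume "x \<in> eff" "meets_chains (jb_le (\<odot>)) eff x"
  then obtain c where c: "c > 0" "c *\<^sub>R e \<preceq> x" using bound_of_meets_chains[OF atomic fin] by blast
  obtain n where n: "inverse (real (Suc n)) < c" using reals_Archimedean c(1) by blast
  have "pos (x - c *\<^sub>R e + (c - inverse (real (Suc n))) *\<^sub>R e)"
    using c n by (intro pos_add_unit) auto
  then show "\<exists>n. jb_le (\<odot>) (inverse (real (Suc n)) *\<^sub>R e) x"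
    by (intro exI[of _ n]) (simp add: jb_le_iff algebra_simps)
qed

subsection \<open>Effects along an infinite central partition\<close>

text \<open>A diagonal argument: given \<open>d n\<close>, choose \<open>y\<close> with \<open>z n \<odot> y\<close> not above \<open>z n \<odot> d n\<close>.\<close>

lemma not_countably_coinitial:
  assumes atomic: "\<And>g. projection g \<Longrightarrow> g \<noteq> 0 \<Longrightarrow> \<exists>a. minimal a \<and> g \<odot> a = a"
    and part: "central_partition z"
  shows "\<not> countably_coinitial (jb_le (\<odot>)) eff"
proof
  note zp = partition_projection[OF part] and zc = partition_centre[OF part]
  assume "countably_coinitial (jb_le (\<odot>)) eff"
  then obtain d where d: "\<forall>n::nat. d n \<in> eff \<and> meets_chains (jb_le (\<odot>)) eff (d n)"
    and coinitial: "\<forall>x\<in>eff. meets_chains (jb_le (\<odot>)) eff x \<longrightarrow> (\<exists>n. jb_le (\<odot>) (d n) x)"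
    unfolding countably_coinitial_def by blast
  \<comment> \<open>\<open>d n\<close> dominates a positive multiple of an atom under
    \<open>z n\<close>, so \<open>z n \<odot> d n\<close> cannot lie below all small multiples of
    \<open>z n\<close>.\<close>
  have "\<exists>t. 0 < t \<and> t \<le> 1 \<and> \<not> z n \<odot> d n \<preceq> t *\<^sub>R z n" for n
  proof (rule ccontr)
    assume "\<not> ?thesis"
    then have small: "z n \<odot> d n \<preceq> t *\<^sub>R z n" if "0 < t" "t \<le> 1" for t using that by blast
    obtain p where p: "minimal p" "z n \<odot> p = p"
      using atomic[OF zp[of n] partition_nonzero[OF part, of n]] by (elim exE conjE) (rule that)
    have pp: "projection p" "p \<noteq> 0" using p(1) by (simp_all add: minimal_def)
    have "meets_chains (jb_le (\<odot>)) eff (d n)" using d by blast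
    then obtain t where t: "t > 0" "t *\<^sub>R p \<preceq> d n" by (rule minimal_bound_of_meets_chains[OF _ p(1)])
    define s where "s = min (t / 2) 1"
    have s: "0 < s" "s \<le> 1" "s < t" using t by (auto simp: s_def)
    have "z n \<odot> (t *\<^sub>R p) \<preceq> z n \<odot> d n" by (rule central_prod_mono[OF zp zc t(2)])
    then have "t *\<^sub>R p \<preceq> z n \<odot> d n" using p(2) by (simp add: jdistrib)
    then have "t *\<^sub>R p \<preceq> s *\<^sub>R z n" using small[OF s(1,2)] by (rule le_trans)
    then have "quad p (t *\<^sub>R p) \<preceq> quad p (s *\<^sub>R z n)" by (rule quad_mono[OF projection_pos[OF pp(1)]])
    moreover have "quad p (z n) = p"
      using p(2) pp(1) by (simp add: quad_def jprod_commute[of p "z n"])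
    ultimately have "pos ((s - t) *\<^sub>R p)"
      using pp(1) by (simp add: quad_scale_right quad_one scaleR_left_diff_distrib)
    then show False using pos_scale_projection[OF pp] s(3) by fastforce
  qed
  then obtain t where t: "\<And>n. 0 < t n" "\<And>n. t n \<le> 1" "\<And>n. \<not> z n \<odot> d n \<preceq> t n *\<^sub>R z n" by metis
  obtain y where y: "pos y" "y \<preceq> e" "\<And>n. z n \<odot> y = t n *\<^sub>R z n"
  proof (rule partition_glue[OF part, of "\<lambda>n. t n *\<^sub>R z n"])
    show "pos (t n *\<^sub>R z n)" for n using t(1)[of n] by (intro pos_scale[OF projection_pos[OF zp]]) simp
    have "pos ((1 - t n) *\<^sub>R z n)" for n
      using t(2)[of n] by (intro pos_scale[OF projection_pos[OF zp]]) simp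
    then show "t n *\<^sub>R z n \<preceq> z n" for n by (simp add: scaleR_left_diff_distrib)
  qed blast
  have yE: "y \<in> eff" using y by (simp add: effects_iff)
  have "meets_chains (jb_le (\<odot>)) eff y"
    unfolding meets_chains_def
  proof (intro ballI impI)
    fix w assume w: "w \<in> eff" "chain_element (jb_le (\<odot>)) eff w"
    have w01: "pos w" "w \<preceq> e" using w(1) by (simp_all add: effects_iff)
    have "w \<noteq> 0" using w(2) nonleast_effect_iff[OF w(1)] by (simp add: chain_element_def)
    \<comment> \<open>A chain element has a non-zero component on some summand, and there
      \<open>y\<close> is a positive multiple of the unit.\<close>
    then obtain n where n: "z n \<odot> w \<noteq> 0" using partition_faithful[OF part] by blast
    define v where "v = t n *\<^sub>R (z n \<odot> w)"
    have zw: "pos (z n \<odot> w)" by (rule pos_central_prod[OF zp zc w01(1)])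
    then have v0: "pos v" using t(1)[of n] by (simp add: v_def pos_scale)
    have "pos ((1 - t n) *\<^sub>R (z n \<odot> w) + (w - z n \<odot> w))"
      using t(2)[of n] by (intro pos_add pos_scale zw central_prod_le[OF zp zc w01(1)]) simp
    then have vw: "v \<preceq> w" by (simp add: v_def algebra_simps)
    have "z n \<odot> w \<preceq> z n \<odot> e" by (rule central_prod_mono[OF zp zc w01(2)])
    then have "pos (t n *\<^sub>R (z n - z n \<odot> w) + (y - z n \<odot> y))"
      using t(1)[of n] by (intro pos_add pos_scale central_prod_le[OF zp zc y(1)]) simp_all
    then have vy: "v \<preceq> y" by (simp add: v_def y(3) algebra_simps)
    have "v \<in> eff" using v0 le_trans[OF vw w01(2)] by (simp add: effects_iff)
    moreover have "v \<noteq> 0" using n t(1)[of n] by (simp add: v_def)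
    ultimately show "\<exists>v\<in>eff. nonleast (jb_le (\<odot>)) eff v \<and> jb_le (\<odot>) v w \<and> jb_le (\<odot>) v y"
      using vw vy nonleast_effect_iff by (auto simp: jb_le_iff)
  qed
  then obtain n where "d n \<preceq> y" using coinitial yE by (auto simp: jb_le_iff)
  then have "z n \<odot> d n \<preceq> z n \<odot> y" by (rule central_prod_mono[OF zp zc])
  then show False using t(3)[of n] by (simp add: y(3))
qed

lemma moebius_half:
  assumes k: "0 < k" "k < 1" and p: "projection p"
  shows "moebius k ((1 / 2) *\<^sub>R p) = ((1 - k) / (2 - k)) *\<^sub>R p"
proof (rule moebius_unique[OF k])
  have "pos ((1 / 2) *\<^sub>R p + (e - p))"
    using projection_pos[OF p] projection_le_unit[OF p] by (intro pos_add pos_scale) auto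
  moreover have "(1 / 2) *\<^sub>R p + (e - p) = e - (1 / 2) *\<^sub>R p"
    using scaleR_half_sum[of p] by (simp add: algebra_simps)
  ultimately show "(1 / 2) *\<^sub>R p \<preceq> e" by simp
  have "(e - k *\<^sub>R (1 / 2) *\<^sub>R p) \<odot> p = (1 - k / 2) *\<^sub>R p"
    by (simp add: jdistrib p scaleR_left_diff_distrib)
  then have "(e - k *\<^sub>R (1 / 2) *\<^sub>R p) \<odot> (((1 - k) / (2 - k)) *\<^sub>R p) = ((1 - k / 2) * ((1 - k) / (2 - k))) *\<^sub>R p"
    by (simp add: jscale_right)
  also have "(1 - k / 2) * ((1 - k) / (2 - k)) = (1 - k) * (1 / 2)"
    using k by (simp add: field_simps)
  finally show "(e - k *\<^sub>R (1 / 2) *\<^sub>R p) \<odot> (((1 - k) / (2 - k)) *\<^sub>R p) = (1 - k) *\<^sub>R (1 / 2) *\<^sub>R p"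
    by simp
qed

text \<open>Apply \<open>moebius (k n)\<close> with \<open>k n \<longlonglongrightarrow> 1\<close> on the summand of \<open>z n\<close>: the image of \<open>e/2\<close> gets
  arbitrarily small there.\<close>

lemma shrinking_order_iso:
  assumes part: "central_partition z"
  shows "\<exists>h. order_iso_betw (jb_le (\<odot>)) eff (jb_le (\<odot>)) eff h
    \<and> h ((1 / 2) *\<^sub>R e) \<notin> invertible_effects (\<odot>) e"
proof -
  note zp = partition_projection[OF part] and zc = partition_centre[OF part]
  \<comment> \<open>The shift by 2 gives \<open>k 0 = 1/2\<close>, so that all parameters lie
    strictly between 0 and 1. The image of \<open>e/2\<close> on \<open>z n\<close> is at most
    \<open>1 - k n = 1 / (n + 2)\<close> times \<open>z n\<close>.\<close>
  define k where "k n = 1 - 1 / (real n + 2)" for n :: nat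
  have k: "0 < k n" "k n < 1" for n by (simp_all add: k_def field_simps)
  note mb_mono = moebius_mono[OF k] and mb_dual = moebius_dual[OF k] and mb_effect = moebius_effect[OF k]
    and mb_proj = moebius_projection[OF k]
  have ze: "z n \<preceq> e" for n by (rule projection_le_unit[OF zp])
  have mz: "moebius (k n) (z n) = z n" "moebius (k n) (e - z n) = e - z n" for n
    by (rule mb_proj[OF zp ze], rule mb_proj[OF projection_compl[OF zp]]) (use projection_pos[OF zp] in simp)
  have corner: "pos (z n \<odot> x) \<and> z n \<odot> x \<preceq> z n \<and> z n \<odot> x \<preceq> e" if "x \<in> eff" for n x
  proof -
    have x: "pos x" "x \<preceq> e" using that by (simp_all add: effects_iff)
    have "z n \<odot> x \<preceq> z n" using central_prod_mono[OF zp zc x(2), of n] by simp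
    then show ?thesis using pos_central_prod[OF zp zc x(1)] le_trans[OF _ ze] by blast
  qed
  have "\<exists>y. y \<in> eff \<and> (\<forall>n. z n \<odot> y = moebius (k n) (z n \<odot> x))" if x: "x \<in> eff" for x
  proof -
    have "pos (moebius (k n) (z n \<odot> x))" for n using corner[OF x, of n] mb_effect by blast
    moreover have "moebius (k n) (z n \<odot> x) \<preceq> z n" for n
      using moebius_mono[OF k[of n], where x = "z n \<odot> x" and y = "z n"] corner[OF x, of n] ze[of n] mz(1)[of n] by simp
    ultimately obtain y where "pos y" "y \<preceq> e" "\<And>n. z n \<odot> y = moebius (k n) (z n \<odot> x)"
      using partition_glue[OF part, of "\<lambda>n. moebius (k n) (z n \<odot> x)"] by metis
    then show ?thesis by (intro exI[of _ y]) (simp add: effects_iff)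
  qed
  then obtain h where h: "\<And>x. x \<in> eff \<Longrightarrow> h x \<in> eff"
    "\<And>x n. x \<in> eff \<Longrightarrow> z n \<odot> h x = moebius (k n) (z n \<odot> x)" by metis
  have h_le: "x \<preceq> y \<longleftrightarrow> h x \<preceq> h y" if x: "x \<in> eff" and y: "y \<in> eff" for x y
  proof
    assume xy: "x \<preceq> y"
    show "h x \<preceq> h y"
    proof (rule partition_le[OF part])
      fix n
      have "z n \<odot> x \<preceq> z n \<odot> y" by (rule central_prod_mono[OF zp zc xy])
      then show "z n \<odot> h x \<preceq> z n \<odot> h y"
        unfolding h(2)[OF x] h(2)[OF y] using corner[OF y, of n] by (intro mb_mono) auto
    qed
  next
    assume "h x \<preceq> h y"
    show "x \<preceq> y"
    proof (rule partition_le[OF part])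
      fix n
      have "z n \<odot> h x \<preceq> z n \<odot> h y" by (rule central_prod_mono[OF zp zc \<open>h x \<preceq> h y\<close>])
      then have le: "moebius (k n) (z n \<odot> x) \<preceq> moebius (k n) (z n \<odot> y)" unfolding h(2)[OF x] h(2)[OF y] .
      have "pos (moebius (k n) (z n \<odot> x))" using corner[OF x, of n] mb_effect by blast
      \<comment> \<open>The inverse of \<open>moebius (k n)\<close> is
        \<open>w \<mapsto> e - moebius (k n) (e - w)\<close>, which is monotone as well.\<close>
      with le have "moebius (k n) (e - moebius (k n) (z n \<odot> y)) \<preceq> moebius (k n) (e - moebius (k n) (z n \<odot> x))"
        by (intro mb_mono) simp_all
      moreover have "moebius (k n) (e - moebius (k n) w) = e - w" if "pos w" "w \<preceq> e" for w
        using moebius_dual[OF k[of n], where y = "e - w"] that by simp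
      ultimately show "z n \<odot> x \<preceq> z n \<odot> y" using corner[OF x, of n] corner[OF y, of n] by simp
    qed
  qed
  have "h ` eff = eff"
  proof
    show "h ` eff \<subseteq> eff" using h(1) by blast
    show "eff \<subseteq> h ` eff"
    proof
      fix y assume y: "y \<in> eff"
      define b where "b n = e - moebius (k n) (e - z n \<odot> y)" for n
      have b: "pos (b n)" "b n \<preceq> z n" "moebius (k n) (b n) = z n \<odot> y" for n
      proof -
        have zy: "pos (z n \<odot> y)" "z n \<odot> y \<preceq> z n" "z n \<odot> y \<preceq> e" using corner[OF y, of n] by simp_all
        show "pos (b n)" unfolding b_def using mb_effect(2)[of "e - z n \<odot> y"] zy by simp
        show "moebius (k n) (b n) = z n \<odot> y" unfolding b_def by (rule mb_dual[OF zy(1,3)])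
        have "moebius (k n) (e - z n) \<preceq> moebius (k n) (e - z n \<odot> y)"
          using zy by (intro mb_mono) simp_all
        then show "b n \<preceq> z n" by (simp add: b_def mz algebra_simps)
      qed
      obtain x where x: "pos x" "x \<preceq> e" "\<And>n. z n \<odot> x = b n"
        using partition_glue[OF part, of b] b(1,2) by metis
      have xE: "x \<in> eff" using x by (simp add: effects_iff)
      have "h x = y" by (rule partition_eqI[OF part]) (simp add: h(2)[OF xE] x(3) b(3))
      then show "y \<in> h ` eff" using xE by blast
    qed
  qed
  moreover have "inj_on h eff"
  proof (rule inj_onI)
    fix x y assume xy: "x \<in> eff" "y \<in> eff" "h x = h y"
    then have "x \<preceq> y" "y \<preceq> x" using h_le[OF xy(1,2)] h_le[OF xy(2,1)] by simp_all
    then show "x = y" by (rule le_antisym)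
  qed
  ultimately have iso: "order_iso_betw (jb_le (\<odot>)) eff (jb_le (\<odot>)) eff h"
    using h_le by (simp add: order_iso_betw_def bij_betw_def jb_le_iff)
  have "pos ((1 - 1 / 2) *\<^sub>R e)" by (rule pos_unit_scale) simp
  then have half: "(1 / 2) *\<^sub>R e \<in> eff"
    unfolding effects_iff scaleR_left_diff_distrib by simp
  have "h ((1 / 2) *\<^sub>R e) \<notin> invertible_effects (\<odot>) e"
  proof
    assume "h ((1 / 2) *\<^sub>R e) \<in> invertible_effects (\<odot>) e"
    then obtain c where c: "c > 0" "c *\<^sub>R e \<preceq> h ((1 / 2) *\<^sub>R e)"
      unfolding invertible_effects_iff by blast
    have "c \<le> 1 / (real n + 2)" for n
    proof -
      have "z n \<odot> (c *\<^sub>R e) \<preceq> z n \<odot> h ((1 / 2) *\<^sub>R e)" by (rule central_prod_mono[OF zp zc c(2)])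
      also have "z n \<odot> h ((1 / 2) *\<^sub>R e) = ((1 - k n) / (2 - k n)) *\<^sub>R z n"
        unfolding h(2)[OF half] by (simp add: jdistrib moebius_half[OF k zp])
      finally have "pos (((1 - k n) / (2 - k n) - c) *\<^sub>R z n)"
        by (simp add: jdistrib scaleR_left_diff_distrib)
      then have "c \<le> (1 - k n) / (2 - k n)"
        using pos_scale_projection[OF zp partition_nonzero[OF part]] by fastforce
      also have "\<dots> \<le> (1 - k n) / 1" using k[of n] by (intro divide_left_mono) auto
      finally show ?thesis by (simp add: k_def)
    qed
    moreover obtain n where "inverse (real (Suc n)) < c" using reals_Archimedean c(1) by blast
    ultimately have "inverse (real (Suc n)) < 1 / (real n + 2)" by (metis less_le_trans)
    then show False by (simp add: field_simps)
  qed
  then show ?thesis using iso by blast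
qed

lemma minimal_below_projection:
  assumes "jb_atomic (\<odot>)" "projection g" "g \<noteq> 0"
  shows "\<exists>a. minimal a \<and> g \<odot> a = a"
proof -
  obtain a where a: "jb_atom (\<odot>) a" "a \<preceq> g"
    using assms unfolding jb_atomic_def jb_projection_def jb_le_iff by blast
  have m: "minimal a" by (rule minimal_of_atom[OF a(1)])
  then have "pos a" by (simp add: minimal_def projection_pos)
  then have "g \<odot> a = a" using a(2) by (intro below_projection[OF assms(2), where c = 1]) simp_all
  then show ?thesis using m by blast
qed

end

lemma order_iso_betw_comp:
  assumes "order_iso_betw le_A A le_B B f" "order_iso_betw le_B B le_C C g"
  shows "order_iso_betw le_A A le_C C (g \<circ> f)"
  using assms unfolding order_iso_betw_def by (auto intro: bij_betw_trans dest: bij_betwE)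

theorem lemma4p7:
  fixes prodM :: "'a::banach \<Rightarrow> 'a \<Rightarrow> 'a" and eM :: 'a
    and prodN :: "'b::banach \<Rightarrow> 'b \<Rightarrow> 'b" and eN :: 'b
  assumes "jbw_algebra prodM eM TYPE('p::banach)" and "jb_atomic prodM"
    and "jbw_algebra prodN eN TYPE('q::banach)" and "jb_atomic prodN"
    and "\<exists>f. order_iso_betw (jb_le prodM) (effects prodM eM) (jb_le prodN) (effects prodN eN) f"
  shows "(\<forall>f. order_iso_betw (jb_le prodM) (effects prodM eM) (jb_le prodN) (effects prodN eN) f
              \<longrightarrow> f ` invertible_effects prodM eM = invertible_effects prodN eN)
         \<longleftrightarrow> finite_dimensional (jb_centre prodM)"
proof -
  interpret M: jbw_algebra prodM eM "TYPE('p)" by fact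
  interpret N: jbw_algebra prodN eN "TYPE('q)" by fact
  note atomic_M = M.minimal_below_projection[OF assms(2)]
    and atomic_N = N.minimal_below_projection[OF assms(4)]
  show ?thesis
  proof
    assume fin: "finite_dimensional (jb_centre prodM)"
    \<comment> \<open>The order isomorphism transports \<open>countably_coinitial\<close> from
      \<open>M\<close>, which an infinite-dimensional centre of \<open>N\<close> would
      exclude.\<close>
    have finN: "finite_dimensional (jb_centre prodN)"
    proof (rule ccontr)
      assume "\<not> ?thesis"
      then obtain z where "N.central_partition z" using N.central_partition_exists by blast
      then have "\<not> countably_coinitial (jb_le prodN) (effects prodN eN)"
        using N.not_countably_coinitial[OF atomic_N] by blast
      moreover have "countably_coinitial (jb_le prodM) (effects prodM eM)"
        by (rule M.countably_coinitial_of_finite_centre[OF atomic_M fin])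
      ultimately show False using assms(5) order_iso_countably_coinitial by blast
    qed
    have inv_M: "invertible_effects prodM eM
        = {x \<in> effects prodM eM. meets_chains (jb_le prodM) (effects prodM eM) x}"
      by (rule set_eqI, unfold mem_Collect_eq, rule M.invertible_effects_iff_meets_chains[OF _ fin])
        (rule atomic_M)
    have inv_N: "invertible_effects prodN eN
        = {x \<in> effects prodN eN. meets_chains (jb_le prodN) (effects prodN eN) x}"
      by (rule set_eqI, unfold mem_Collect_eq, rule N.invertible_effects_iff_meets_chains[OF _ finN])
        (rule atomic_N)
    show "\<forall>f. order_iso_betw (jb_le prodM) (effects prodM eM) (jb_le prodN) (effects prodN eN) f
        \<longrightarrow> f ` invertible_effects prodM eM = invertible_effects prodN eN"
    proof (intro allI impI)
      fix f assume iso: "order_iso_betw (jb_le prodM) (effects prodM eM) (jb_le prodN) (effects prodN eN) f"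
      show "f ` invertible_effects prodM eM = invertible_effects prodN eN"
        unfolding inv_M inv_N order_iso_image[OF iso] using order_iso_meets_chains[OF iso]
        by (auto simp: order_iso_image[OF iso])
    qed
  next
    assume preserving: "\<forall>f. order_iso_betw (jb_le prodM) (effects prodM eM) (jb_le prodN) (effects prodN eN) f
        \<longrightarrow> f ` invertible_effects prodM eM = invertible_effects prodN eN"
    show "finite_dimensional (jb_centre prodM)"
    proof (rule ccontr)
      assume "\<not> ?thesis"
      then obtain z where "M.central_partition z" using M.central_partition_exists by blast
      then obtain h where h: "order_iso_betw (jb_le prodM) (effects prodM eM) (jb_le prodM) (effects prodM eM) h"
        and half: "h ((1 / 2) *\<^sub>R eM) \<notin> invertible_effects prodM eM"
        using M.shrinking_order_iso by blast
      obtain g where g: "order_iso_betw (jb_le prodM) (effects prodM eM) (jb_le prodN) (effects prodN eN) g"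
        using assms(5) by blast
      have "M.pos ((1 - 1 / 2) *\<^sub>R eM)" by (rule M.pos_unit_scale) simp
      then have eff: "(1 / 2) *\<^sub>R eM \<in> effects prodM eM"
        unfolding M.effects_iff scaleR_left_diff_distrib by simp
      then have "(1 / 2) *\<^sub>R eM \<in> invertible_effects prodM eM"
        unfolding M.invertible_effects_iff by (intro conjI exI[of _ "1 / 2"]) simp_all
      \<comment> \<open>The image is invertible through \<open>g \<circ> h\<close>, so
        \<open>g\<close> also reaches it from an invertible \<open>b\<close>; injectivity identifies
        \<open>b\<close> with \<open>h (e/2)\<close>.\<close>
      then have "g (h ((1 / 2) *\<^sub>R eM)) \<in> invertible_effects prodN eN"
        using preserving[rule_format, OF order_iso_betw_comp[OF h g]] by auto
      then obtain b where b: "b \<in> invertible_effects prodM eM" "g (h ((1 / 2) *\<^sub>R eM)) = g b"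
        using preserving[rule_format, OF g] by auto
      have "inj_on g (effects prodM eM)" "h ((1 / 2) *\<^sub>R eM) \<in> effects prodM eM" "b \<in> effects prodM eM"
        using g h eff b(1) unfolding order_iso_betw_def invertible_effects_def
        by (auto dest: bij_betw_imp_inj_on bij_betwE)
      then have "h ((1 / 2) *\<^sub>R eM) = b" using b(2) by (meson inj_onD)
      then show False using b(1) half by simp
    qed
  qed
qed

end
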